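(* Let $n\ge2$, let $\rho$ be a conformal density on $\mathbb{B}^n$ and let $0<p<\infty$. Then $\rho\in H^p$ if and only if $$\int_{\mathbb{B}^n}\rho(x)^p(1-|x|)^{p-1}\,dx<\infty.$$
   Context: Notation: $\mathbb{B}^n=\{x\in\mathbb{R}^n:|x|<1\}$, $\mathbb{S}^{n-1}=\{x\in\mathbb{R}^n:|x|=1\}$, $\sigma$ is the $(n-1)$-dimensional surface measure on $\mathbb{S}^{n-1}$, and $B_x=B(x,(1-|x|)/2)$ (Euclidean ball) for $x\in\mathbb{B}^n$. For a continuous function $\rho:\mathbb{B}^n\to(0,\infty)$, put $\mathrm{length}_\rho(\gamma)=\int_\gamma\rho\,ds$ (arc length integration) for a curve $\gamma$. For $x,y\in\mathbb{B}^n$ let $d_\rho(x,y)=\inf\mathrm{length}_\rho(\gamma)$, the infimum over all curves $\gamma\subset\mathbb{B}^n$ with endpoints $x$ and $y$. Write $|x|_\rho=d_\rho(x,0)$ and $B_\rho(x,r)=\{y\in\mathbb{B}^n:d_\rho(x,y)<r\}$. $\rho$ satisfies HI$(A)$, $A\ge1$, if for every $z\in\mathbb{B}^n$: $1/A\le\rho(x)/\rho(y)\le A$ for all $x,y\in B_z$. $\rho$ satisfies VG$(B)$, $B>0$, if $\int_{B_\rho(x,r)}\rho^n\,dx\le Br^n$ for all $x\in\mathbb{B}^n$, $r>0$. A conformal density on $\mathbb{B}^n$ is a continuous $\rho:\mathbb{B}^n\to(0,\infty)$ satisfying HI$(A)$ and VG$(B)$ for some $A\ge1$, $B>0$. For $0<p<\infty$,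 $\rho\in H^p$ means that there is $\delta>0$ with $\sup_{0<r<1}\int_{\mathbb{S}^{n-1}}(\delta|r\omega|_\rho)^p\,d\sigma(\omega)<\infty$. *)

theory Defs
  imports "HOL-Analysis.Analysis"
begin

section \<open>Surface measure on the unit sphere\<close>

text \<open>
  Surface measure in \<open>n\<close>-dimensional space, normalised as in the polar coordinate formula:
  a Borel set \<open>A\<close> of unit vectors has measure \<open>n\<close> times the volume of the cone
  \<open>{t *\<^sub>R \<omega> | 0 < t \<le> 1, \<omega> \<in> A}\<close>.
\<close>

definition sphere_measure :: "'a::euclidean_space measure" where
  "sphere_measure =
     scale_measure (ennreal (DIM('a)))
       (distr (restrict_space lborel (cball 0 1 - {0})) (restrict_space borel (sphere 0 1))
         (\<lambda>x. x /\<^sub>R norm x))"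

lemma emeasure_sphere_measure:
  fixes A :: "'a::euclidean_space set"
  assumes "A \<in> sets borel" "A \<subseteq> sphere 0 1"
  shows "emeasure sphere_measure A =
           of_nat DIM('a) * emeasure lborel {x \<in> cball 0 1 - {0}. x /\<^sub>R norm x \<in> A}"
proof -
  let ?C = "cball 0 1 - {0} :: 'a set"
  have "(\<lambda>x::'a. x /\<^sub>R norm x) \<in> borel_measurable (restrict_space borel ?C)"
    by (intro borel_measurable_continuous_on_restrict continuous_intros) auto
  then have "(\<lambda>x::'a. x /\<^sub>R norm x) \<in> borel_measurable (restrict_space lborel ?C)"
    by (simp cong: measurable_cong_sets add: sets_restrict_space)
  then have m: "(\<lambda>x::'a. x /\<^sub>R norm x) \<in>
      restrict_space lborel ?C \<rightarrow>\<^sub>M restrict_space borel (sphere 0 1)"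
    by (intro measurable_restrict_space2) (auto simp: space_restrict_space)
  have A: "A \<in> sets (restrict_space borel (sphere 0 1))"
    using assms by (subst sets_restrict_space_iff) auto
  have eq: "(\<lambda>x. x /\<^sub>R norm x) -` A \<inter> space (restrict_space lborel ?C) =
      {x \<in> ?C. x /\<^sub>R norm x \<in> A}"
    by (auto simp: space_restrict_space)
  show ?thesis
    unfolding sphere_measure_def emeasure_scale_measure emeasure_distr[OF m A] eq
    by (subst emeasure_restrict_space) (auto simp: ennreal_of_nat_eq_real_of_nat)
qed

section \<open>Arc length integrals\<close>

definition inscribed_lengths :: "(real \<Rightarrow> 'a::metric_space) \<Rightarrow> real \<Rightarrow> real \<Rightarrow> real set" where
  "inscribed_lengths g a b =
     {\<Sum>i<k. dist (g (t i)) (g (t (Suc i))) | (k::nat) (t::nat \<Rightarrow> real).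
        mono_on {..k} t \<and> t 0 = a \<and> t k = b}"

definition rectifiable :: "(real \<Rightarrow> 'a::metric_space) \<Rightarrow> bool" where
  "rectifiable g \<longleftrightarrow> path g \<and> bdd_above (inscribed_lengths g 0 1)"

definition arc_len :: "(real \<Rightarrow> 'a::metric_space) \<Rightarrow> real \<Rightarrow> real" where
  "arc_len g t = Sup (inscribed_lengths g 0 t)"

text \<open>
  Parametrisation by arc length, on the interval from 0 to \<open>arc_len g 1\<close>. For rectifiable \<open>g\<close>
  the choice of preimage made by \<^const>\<open>inv_into\<close> is immaterial, since \<open>g\<close> is constant on
  each level set of \<^term>\<open>arc_len g\<close>.
\<close>

definition arc_param :: "(real \<Rightarrow> 'a::metric_space) \<Rightarrow> real \<Rightarrow> 'a" where
  "arc_param g s = g (inv_into {0..1} (arc_len g) s)"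

text \<open>The integral \<open>\<integral>\<^sub>g \<rho> ds\<close>, meaningful for rectifiable \<open>g\<close>.\<close>

definition rho_length :: "('a::metric_space \<Rightarrow> real) \<Rightarrow> (real \<Rightarrow> 'a) \<Rightarrow> real" where
  "rho_length \<rho> g = integral {0..arc_len g 1} (\<lambda>s. \<rho> (arc_param g s))"

section \<open>Conformal densities on the unit ball\<close>

text \<open>
  A curve in the ball that is not rectifiable has infinite \<open>\<rho>\<close>-length, because \<open>\<rho>\<close> has a
  positive minimum on it; hence only rectifiable curves occur in the infimum, and all
  lengths can be taken to be real.
\<close>

definition rho_dist :: "('a::euclidean_space \<Rightarrow> real) \<Rightarrow> 'a \<Rightarrow> 'a \<Rightarrow> real" where
  "rho_dist \<rho> x y =
     Inf {rho_length \<rho> g | g. rectifiable g \<and> path_image g \<subseteq> ball 0 1 \<and>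
            pathstart g = x \<and> pathfinish g = y}"

definition rho_norm :: "('a::euclidean_space \<Rightarrow> real) \<Rightarrow> 'a \<Rightarrow> real" where
  "rho_norm \<rho> x = rho_dist \<rho> x 0"

definition rho_ball :: "('a::euclidean_space \<Rightarrow> real) \<Rightarrow> 'a \<Rightarrow> real \<Rightarrow> 'a set" where
  "rho_ball \<rho> x r = {y \<in> ball 0 1. rho_dist \<rho> x y < r}"

definition Harnack_inequality :: "real \<Rightarrow> ('a::euclidean_space \<Rightarrow> real) \<Rightarrow> bool" where
  "Harnack_inequality A \<rho> \<longleftrightarrow>
     (\<forall>z\<in>ball 0 1. \<forall>x\<in>ball z ((1 - norm z) / 2). \<forall>y\<in>ball z ((1 - norm z) / 2).
        1 / A \<le> \<rho> x / \<rho> y \<and> \<rho> x / \<rho> y \<le> A)"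

definition volume_growth :: "real \<Rightarrow> ('a::euclidean_space \<Rightarrow> real) \<Rightarrow> bool" where
  "volume_growth B \<rho> \<longleftrightarrow>
     (\<forall>x\<in>ball 0 1. \<forall>r>0.
        (\<integral>\<^sup>+y\<in>rho_ball \<rho> x r. ennreal (\<rho> y ^ DIM('a)) \<partial>lborel) \<le> ennreal (B * r ^ DIM('a)))"

definition conformal_density :: "('a::euclidean_space \<Rightarrow> real) \<Rightarrow> bool" where
  "conformal_density \<rho> \<longleftrightarrow>
     continuous_on (ball 0 1) \<rho> \<and> (\<forall>x\<in>ball 0 1. 0 < \<rho> x) \<and>
     (\<exists>A\<ge>1. Harnack_inequality A \<rho>) \<and> (\<exists>B>0. volume_growth B \<rho>)"

definition in_Hardy :: "real \<Rightarrow> ('a::euclidean_space \<Rightarrow> real) \<Rightarrow> bool" where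
  "in_Hardy p \<rho> \<longleftrightarrow>
     (\<exists>\<delta>>0. (SUP r\<in>{0<..<1::real}.
        \<integral>\<^sup>+\<omega>. ennreal ((\<delta> * rho_norm \<rho> (r *\<^sub>R \<omega>)) powr p) \<partial>sphere_measure) < \<infinity>)"

end

theory Submission
  imports Defs
begin

text \<open>
  Write \<open>v x = |x|\<^sub>\<rho>\<close>. The main tool is \<open>crossing_estimate\<close>: if along each radius in a set \<open>E\<close> of
  directions the distance from a fixed point \<open>z\<close> runs through \<open>N\<close> consecutive dyadic shells between
  heights \<open>t\<close> and 1, then \<open>\<sigma>(E) \<le> C (1 - t)\<^sup>n\<^sup>-\<^sup>1 / N\<close>. Indeed, each crossing has \<open>\<rho>\<close>-length at least
  the inner radius of the shell, Young's inequality and polar coordinates turn these lengths into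
  integrals of \<open>\<rho>\<^sup>n\<close> over the shells, and volume growth bounds those.

  For \<open>z = 0\<close> it follows that a value \<open>v x = \<lambda>\<close> persists, up to a fixed factor, on half of a cap of size
  comparable to \<open>1 - |x|\<close>, at every radius beyond \<open>|x|\<close>. By Vitali's lemma one selects points with
  \<open>v = \<lambda>\<close> whose caps are disjoint and whose enlarged caps lie over all of \<open>{v \<ge> \<lambda>}\<close>; the total measure
  of the caps is then at most a constant times \<open>\<sigma>{v(R\<omega>) \<ge> c \<lambda>}\<close>.

  Summing over \<open>\<lambda> = 2\<^sup>j \<lambda>\<^sub>0\<close> bounds the volume integral by the means of \<open>v\<^sup>p\<close>, because over each box the
  part of the volume integral where \<open>\<lambda> \<le> v < 2 \<lambda>\<close> is at most \<open>C \<lambda>\<^sup>p\<close> times the measure of the cap.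
  Conversely, \<open>crossing_estimate\<close> with the selected points as \<open>z\<close> gives a good-\<open>\<lambda>\<close> inequality between
  \<open>v\<close> and the integral of \<open>\<rho>\<^sup>p (1 - t)\<^sup>p\<^sup>-\<^sup>1\<close> along a radius, with a factor \<open>1 / N\<close> that can be absorbed.
\<close>

section \<open>Variation and arc length\<close>

text \<open>For p > 1 no comparison on a single ray leads from the volume integral to the means:
  near t = 1 the profile 1 / ((1 - t) log (1 / (1 - t))) has infinite length, although its p-th
  power times (1 - t)^(p-1) is integrable. So level sets have to be compared, and volume growth must
  enter. It enters in a scale-free way: divided by the inner radius of a shell, the n-th power of
  \<rho> integrates over that shell to at most a fixed constant. N shells thus cost N times this
  constant whatever their radii, whereas a ray that crosses all of them within height 1 - t pays
  about N (N / (1 - t))^(n-1). The quotient is the decay in N, and n >= 2 turns it into a factor 1 /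
  N. The estimates are proved at a fixed radius R < 1, with constants independent of R. There the
  means are finite, so that half of a mean can be absorbed, and the disjoint caps have measure
  bounded below, so that only finitely many are selected. Levels start above the maximum of v on the
  ball of radius 9 / 10, which keeps all stopping points near the sphere.\<close>

definition variation :: "(real \<Rightarrow> 'a::metric_space) \<Rightarrow> real \<Rightarrow> real \<Rightarrow> real" where
  "variation g a b = Sup (inscribed_lengths g a b)"

lemma arc_len_eq_variation: "arc_len g t = variation g 0 t"
  by (simp add: arc_len_def variation_def)

lemma mono_on_atMost_bounds:
  fixes t :: "nat \<Rightarrow> real"
  assumes "mono_on {..k} t" "i \<le> k"
  shows "t 0 \<le> t i" "t i \<le> t k"
  using assms by (auto intro: mono_onD)

lemma inscribed_lengthsI:
  "mono_on {..k} t \<Longrightarrow> t 0 = a \<Longrightarrow> t k = b \<Longrightarrow>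
     (\<Sum>i<k. dist (g (t i)) (g (t (Suc i)))) \<in> inscribed_lengths g a b"
  by (auto simp: inscribed_lengths_def)

lemma inscribed_lengthsE:
  assumes "x \<in> inscribed_lengths g a b"
  obtains k t where "mono_on {..k} t" "t 0 = a" "t k = b"
    "x = (\<Sum>i<k. dist (g (t i)) (g (t (Suc i))))"
  using assms by (auto simp: inscribed_lengths_def)

lemma dist_in_inscribed_lengths:
  assumes "a \<le> b"
  shows "dist (g a) (g b) \<in> inscribed_lengths g a b"
  using inscribed_lengthsI[of 1 "\<lambda>i. if i = 0 then a else b" a b g] assms
  by (auto simp: mono_on_def)

lemma inscribed_lengths_concat:
  assumes "x \<in> inscribed_lengths g a b" "y \<in> inscribed_lengths g b c"
  shows "x + y \<in> inscribed_lengths g a c"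
proof -
  obtain k t where t: "mono_on {..k} t" "t 0 = a" "t k = b"
    "x = (\<Sum>i<k. dist (g (t i)) (g (t (Suc i))))"
    using assms(1) by (rule inscribed_lengthsE)
  obtain l s where s: "mono_on {..l} s" "s 0 = b" "s l = c"
    "y = (\<Sum>i<l. dist (g (s i)) (g (s (Suc i))))"
    using assms(2) by (rule inscribed_lengthsE)
  define r where "r = (\<lambda>i. if i \<le> k then t i else s (i - k))"
  have r1: "r (k + i) = s i" for i
    using t s by (auto simp: r_def)
  have "mono_on {..k + l} r"
  proof (rule mono_onI)
    fix i j assume ij: "i \<in> {..k + l}" "j \<in> {..k + l}" "i \<le> j"
    consider "j \<le> k" | "i \<le> k" "k < j" | "k < i" by linarith
    then show "r i \<le> r j"
    proof cases
      case 1 then show ?thesis using ij t(1) by (auto simp: r_def mono_on_def)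
    next
      case 2
      have "t i \<le> t k" using 2 t(1) by (auto simp: mono_on_def)
      moreover have "s 0 \<le> s (j - k)" using 2 ij s(1) by (auto simp: mono_on_def)
      ultimately show ?thesis using 2 t s by (auto simp: r_def)
    next
      case 3
      then have "s (i - k) \<le> s (j - k)" using ij by (intro mono_onD[OF s(1)]) auto
      then show ?thesis using 3 ij by (simp add: r_def)
    qed
  qed
  moreover have "r 0 = a" using t by (simp add: r_def)
  moreover have "r (k + l) = c" using s r1 by simp
  ultimately have "(\<Sum>i<k + l. dist (g (r i)) (g (r (Suc i)))) \<in> inscribed_lengths g a c"
    by (intro inscribed_lengthsI)
  also have "(\<Sum>i<k + l. dist (g (r i)) (g (r (Suc i)))) =
      (\<Sum>i<k. dist (g (r i)) (g (r (Suc i)))) + (\<Sum>i<l. dist (g (r (k + i))) (g (r (Suc (k + i)))))"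
    by (induction l) auto
  also have "(\<Sum>i<k. dist (g (r i)) (g (r (Suc i)))) = x"
    unfolding t by (intro sum.cong) (auto simp: r_def)
  also have "(\<Sum>i<l. dist (g (r (k + i))) (g (r (Suc (k + i))))) = y"
    unfolding s using r1 r1[of "Suc i" for i] by (intro sum.cong) auto
  finally show ?thesis .
qed

text \<open>By the triangle inequality, inserting \<open>b\<close> into a partition does not
  decrease the sum. The induction peels off the last partition point until \<open>b\<close> lies in
  the last subinterval, which avoids an explicit search for its index.\<close>

lemma inscribed_lengths_split:
  assumes "x \<in> inscribed_lengths g a c" "a \<le> b" "b \<le> c"
  shows "\<exists>y\<in>inscribed_lengths g a b. \<exists>z\<in>inscribed_lengths g b c. x \<le> y + z"
proof -
  have "\<exists>y\<in>inscribed_lengths g (t 0) b. \<exists>z\<in>inscribed_lengths g b (t k).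
      (\<Sum>i<k. dist (g (t i)) (g (t (Suc i)))) \<le> y + z"
    if "mono_on {..k} t" "t 0 \<le> b" "b \<le> t k" for k :: nat and t
    using that
  proof (induction k)
    case 0
    then have "b = t 0" by auto
    then show ?case
      using dist_in_inscribed_lengths[of b b g] by (auto intro!: bexI[of _ 0])
  next
    case (Suc k)
    have m: "mono_on {..k} t" using Suc.prems(1) by (auto simp: mono_on_def)
    have le: "t k \<le> t (Suc k)" using Suc.prems(1) by (auto simp: mono_on_def)
    show ?case
    proof (cases "b \<le> t k")
      case True
      obtain y z where yz: "y\<in>inscribed_lengths g (t 0) b" "z\<in>inscribed_lengths g b (t k)"
        "(\<Sum>i<k. dist (g (t i)) (g (t (Suc i)))) \<le> y + z"
        using Suc.IH[OF m Suc.prems(2) True] by auto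
      have "z + dist (g (t k)) (g (t (Suc k))) \<in> inscribed_lengths g b (t (Suc k))"
        using yz(2) dist_in_inscribed_lengths[OF le] by (rule inscribed_lengths_concat)
      then show ?thesis using yz by (intro bexI[of _ y] bexI) auto
    next
      case False
      have "(\<Sum>i<k. dist (g (t i)) (g (t (Suc i)))) + dist (g (t k)) (g b) \<in> inscribed_lengths g (t 0) b"
        by (intro inscribed_lengths_concat[of _ _ _ "t k"] inscribed_lengthsI m
            dist_in_inscribed_lengths) (use False in auto)
      moreover have "dist (g b) (g (t (Suc k))) \<in> inscribed_lengths g b (t (Suc k))"
        using Suc.prems by (intro dist_in_inscribed_lengths) auto
      ultimately show ?thesis
        by (intro bexI) (auto simp: dist_triangle)
    qed
  qed
  moreover obtain k t where "mono_on {..k} t" "t 0 = a" "t k = c"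
    "x = (\<Sum>i<k. dist (g (t i)) (g (t (Suc i))))"
    using assms(1) by (rule inscribed_lengthsE)
  ultimately show ?thesis using assms by metis
qed

lemma inscribed_lengths_subinterval:
  assumes "bdd_above (inscribed_lengths g a d)" "a \<le> b" "b \<le> c" "c \<le> d"
  shows "bdd_above (inscribed_lengths g b c)"
proof -
  obtain M where M: "x \<le> M" if "x \<in> inscribed_lengths g a d" for x
    using assms(1) by (auto simp: bdd_above_def)
  have "x \<le> M" if x: "x \<in> inscribed_lengths g b c" for x
  proof -
    have "dist (g a) (g b) + (x + dist (g c) (g d)) \<in> inscribed_lengths g a d"
      using assms by (intro inscribed_lengths_concat[OF dist_in_inscribed_lengths]
          inscribed_lengths_concat[OF x] dist_in_inscribed_lengths)
    from M[OF this] show ?thesis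
      using zero_le_dist[of "g a" "g b"] zero_le_dist[of "g c" "g d"] by linarith
  qed
  then show ?thesis by (auto simp: bdd_above_def)
qed

lemma variation_upper:
  assumes "bdd_above (inscribed_lengths g a b)" "x \<in> inscribed_lengths g a b"
  shows "x \<le> variation g a b"
  unfolding variation_def using assms by (intro cSup_upper)

lemma dist_le_variation:
  assumes "bdd_above (inscribed_lengths g a b)" "a \<le> b"
  shows "dist (g a) (g b) \<le> variation g a b"
  using assms by (intro variation_upper dist_in_inscribed_lengths)

lemma variation_add:
  assumes bd: "bdd_above (inscribed_lengths g a c)" and "a \<le> b" "b \<le> c"
  shows "variation g a c = variation g a b + variation g b c"
proof (rule antisym)
  have b1: "bdd_above (inscribed_lengths g a b)" and b2: "bdd_above (inscribed_lengths g b c)"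
    using assms by (auto intro: inscribed_lengths_subinterval[OF bd])
  have ne: "inscribed_lengths g a b \<noteq> {}" "inscribed_lengths g b c \<noteq> {}" "inscribed_lengths g a c \<noteq> {}"
    using dist_in_inscribed_lengths assms by (metis empty_iff order_trans)+
  show "variation g a c \<le> variation g a b + variation g b c"
    unfolding variation_def[of g a c]
  proof (rule cSup_least[OF ne(3)])
    fix x assume "x \<in> inscribed_lengths g a c"
    then obtain y z where "y \<in> inscribed_lengths g a b" "z \<in> inscribed_lengths g b c" "x \<le> y + z"
      using inscribed_lengths_split assms by metis
    then show "x \<le> variation g a b + variation g b c"
      using variation_upper[OF b1] variation_upper[OF b2] by fastforce
  qed
  have "variation g a b \<le> variation g a c - variation g b c"
    unfolding variation_def[of g a b]
  proof (rule cSup_least[OF ne(1)])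
    fix x assume x: "x \<in> inscribed_lengths g a b"
    have "variation g b c \<le> variation g a c - x"
      unfolding variation_def[of g b c]
    proof (rule cSup_least[OF ne(2)])
      fix y assume "y \<in> inscribed_lengths g b c"
      then show "y \<le> variation g a c - x"
        using variation_upper[OF bd inscribed_lengths_concat[OF x]] by fastforce
    qed
    then show "x \<le> variation g a c - variation g b c" by simp
  qed
  then show "variation g a b + variation g b c \<le> variation g a c" by simp
qed

lemma variation_nonneg:
  assumes "bdd_above (inscribed_lengths g a b)" "a \<le> b"
  shows "0 \<le> variation g a b"
  using dist_le_variation[OF assms] zero_le_dist order_trans by blast

lemma inscribed_lengths_refl: "inscribed_lengths g a a = {0}"
proof -
  have "x = 0" if "x \<in> inscribed_lengths g a a" for x
    using that
  proof (rule inscribed_lengthsE)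
    fix k t assume t: "mono_on {..k} t" "t 0 = a" "t k = a"
      "x = (\<Sum>i<k. dist (g (t i)) (g (t (Suc i))))"
    have "t i = a" if "i \<le> k" for i
      using t mono_on_atMost_bounds[OF t(1) that] by simp
    then show "x = 0" unfolding t by (intro sum.neutral) auto
  qed
  moreover have "0 \<in> inscribed_lengths g a a"
    using dist_in_inscribed_lengths[of a a g] by simp
  ultimately show ?thesis by auto
qed

lemma variation_refl [simp]: "variation g a a = 0"
  by (simp add: variation_def inscribed_lengths_refl)

lemma inscribed_lengths_comp_mono:
  assumes "mono_on {a..b} \<phi>"
  shows "inscribed_lengths (g \<circ> \<phi>) a b \<subseteq> inscribed_lengths g (\<phi> a) (\<phi> b)"
proof
  fix x assume "x \<in> inscribed_lengths (g \<circ> \<phi>) a b"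
  then obtain k t where t: "mono_on {..k} t" "t 0 = a" "t k = b"
    "x = (\<Sum>i<k. dist ((g \<circ> \<phi>) (t i)) ((g \<circ> \<phi>) (t (Suc i))))"
    by (rule inscribed_lengthsE)
  have "t i \<in> {a..b}" if "i \<le> k" for i
    using t mono_on_atMost_bounds[OF t(1) that] by simp
  then have "mono_on {..k} (\<phi> \<circ> t)"
    using t(1) assms by (auto simp: mono_on_def)
  from inscribed_lengthsI[OF this, of "\<phi> a" "\<phi> b" g] show "x \<in> inscribed_lengths g (\<phi> a) (\<phi> b)"
    using t by simp
qed

lemma inscribed_lengths_comp_affine:
  assumes "(m::real) > 0"
  shows "inscribed_lengths (\<lambda>x. g (m * x + c)) a b = inscribed_lengths g (m * a + c) (m * b + c)"
proof
  show "inscribed_lengths (\<lambda>x. g (m * x + c)) a b \<subseteq> inscribed_lengths g (m * a + c) (m * b + c)"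
    using inscribed_lengths_comp_mono[of a b "\<lambda>x. m * x + c" g] assms
    by (auto simp: mono_on_def comp_def)
  have "mono_on {m * a + c..m * b + c} (\<lambda>x. (x - c) / m)"
    using assms by (auto simp: mono_on_def divide_simps)
  from inscribed_lengths_comp_mono[OF this, of "\<lambda>x. g (m * x + c)"] assms
  show "inscribed_lengths g (m * a + c) (m * b + c) \<subseteq> inscribed_lengths (\<lambda>x. g (m * x + c)) a b"
    by (auto simp: comp_def)
qed

lemma inscribed_lengths_reverse_subset:
  "inscribed_lengths (\<lambda>x. g (c - x)) a b \<subseteq> inscribed_lengths g (c - b) (c - a)"
proof
  fix x assume "x \<in> inscribed_lengths (\<lambda>x. g (c - x)) a b"
  then obtain k t where t: "mono_on {..k} t" "t 0 = a" "t k = b"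
    "x = (\<Sum>i<k. dist (g (c - t i)) (g (c - t (Suc i))))"
    by (rule inscribed_lengthsE)
  have "mono_on {..k} (\<lambda>i. c - t (k - i))"
    using t(1) by (auto simp: mono_on_def)
  from inscribed_lengthsI[OF this, of "c - b" "c - a" g]
  have "(\<Sum>i<k. dist (g (c - t (k - i))) (g (c - t (k - Suc i)))) \<in> inscribed_lengths g (c - b) (c - a)"
    using t by simp
  also have "(\<Sum>i<k. dist (g (c - t (k - i))) (g (c - t (k - Suc i)))) = 
     (\<Sum>i<k. dist (g (c - t (Suc (k - Suc i)))) (g (c - t (k - Suc i))))"
    by (intro sum.cong) (auto simp: Suc_diff_Suc)
  also have "\<dots> = (\<Sum>i<k. dist (g (c - t (Suc i))) (g (c - t i)))"
    using sum.nat_diff_reindex[of "\<lambda>i. dist (g (c - t (Suc i))) (g (c - t i))" k] by simp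
  also have "\<dots> = x" using t by (simp add: dist_commute)
  finally show "x \<in> inscribed_lengths g (c - b) (c - a)" .
qed

lemma inscribed_lengths_reverse:
  "inscribed_lengths (\<lambda>x. g (c - x)) a b = inscribed_lengths g (c - b) (c - a)"
proof
  show "inscribed_lengths (\<lambda>x. g (c - x)) a b \<subseteq> inscribed_lengths g (c - b) (c - a)"
    by (rule inscribed_lengths_reverse_subset)
  show "inscribed_lengths g (c - b) (c - a) \<subseteq> inscribed_lengths (\<lambda>x. g (c - x)) a b"
    using inscribed_lengths_reverse_subset[of "\<lambda>x. g (c - x)" c "c - b" "c - a"] by simp
qed

lemma inscribed_lengths_cong:
  assumes "\<And>x. a \<le> x \<Longrightarrow> x \<le> b \<Longrightarrow> g x = h x"
  shows "inscribed_lengths g a b = inscribed_lengths h a b"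
proof -
  have "inscribed_lengths g a b \<subseteq> inscribed_lengths h a b"
    if gh: "\<And>x. a \<le> x \<Longrightarrow> x \<le> b \<Longrightarrow> g x = h x" for g h
  proof
    fix x assume "x \<in> inscribed_lengths g a b"
    then obtain k t where t: "mono_on {..k} t" "t 0 = a" "t k = b"
      "x = (\<Sum>i<k. dist (g (t i)) (g (t (Suc i))))"
      by (rule inscribed_lengthsE)
    have "g (t i) = h (t i)" if "i \<le> k" for i
      using t mono_on_atMost_bounds[OF t(1) that] by (intro gh) auto
    then have "x = (\<Sum>i<k. dist (h (t i)) (h (t (Suc i))))"
      unfolding t by (intro sum.cong) auto
    then show "x \<in> inscribed_lengths h a b"
      using inscribed_lengthsI[OF t(1-3)] by simp
  qed
  from this[of g h] this[of h g] show ?thesis using assms by auto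
qed

text \<open>Take a partition of \<open>{a..c}\<close> whose sum is within e / 2 of the supremum and
  insert a point \<open>b\<close> right after \<open>a\<close>. The part from \<open>b\<close> on
  loses at most \<open>dist (g a) (g b)\<close>, which continuity makes smaller than e / 2, and
  additivity leaves less than \<open>e\<close> for the variation on \<open>{a..b}\<close>.\<close>

lemma variation_small_right:
  fixes g :: "real \<Rightarrow> 'a::metric_space"
  assumes bd: "bdd_above (inscribed_lengths g a c)" and "a < c"
    and cont: "continuous (at a within {a..c}) g" and "0 < e"
  shows "\<exists>b. a < b \<and> b \<le> c \<and> variation g a b < e"
proof -
  have key: "\<exists>b0>t 0. b0 \<le> t k \<and> (\<forall>b. t 0 < b \<and> b \<le> b0 \<longrightarrow> (\<exists>z\<in>inscribed_lengths g b (t k).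
      (\<Sum>i<k. dist (g (t i)) (g (t (Suc i)))) \<le> dist (g (t 0)) (g b) + z))"
    if "mono_on {..k} t" "t 0 < t k" for k :: nat and t
    using that
  proof (induction k)
    case 0 then show ?case by simp
  next
    case (Suc k)
    have m: "mono_on {..k} t" using Suc.prems(1) by (auto simp: mono_on_def)
    have le: "t k \<le> t (Suc k)" using Suc.prems(1) by (auto simp: mono_on_def)
    have le0: "t 0 \<le> t k" using m by (auto simp: mono_on_def)
    show ?case
    proof (cases "t 0 < t k")
      case True
      obtain b0 where b0: "b0 > t 0" "b0 \<le> t k"
        and z: "\<And>b. t 0 < b \<Longrightarrow> b \<le> b0 \<Longrightarrow> (\<exists>z\<in>inscribed_lengths g b (t k).
          (\<Sum>i<k. dist (g (t i)) (g (t (Suc i)))) \<le> dist (g (t 0)) (g b) + z)"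
        using Suc.IH[OF m True] by blast
      show ?thesis
      proof (intro exI[of _ b0] conjI allI impI)
        show "b0 \<le> t (Suc k)" using b0 le by simp
        fix b assume "t 0 < b \<and> b \<le> b0"
        then obtain z where "z \<in> inscribed_lengths g b (t k)"
          "(\<Sum>i<k. dist (g (t i)) (g (t (Suc i)))) \<le> dist (g (t 0)) (g b) + z"
          using z by blast
        then show "\<exists>z\<in>inscribed_lengths g b (t (Suc k)).
            (\<Sum>i<Suc k. dist (g (t i)) (g (t (Suc i)))) \<le> dist (g (t 0)) (g b) + z"
          using inscribed_lengths_concat[OF _ dist_in_inscribed_lengths[OF le]]
          by (intro bexI[of _ "z + dist (g (t k)) (g (t (Suc k)))"]) auto
      qed (use b0 in auto)
    next
      case False
      then have tk: "t k = t 0" using le0 by simp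
      have "dist (g (t i)) (g (t (Suc i))) = 0" if "i < k" for i
        using mono_on_atMost_bounds[OF m, of i] mono_on_atMost_bounds[OF m, of "Suc i"] tk that
        by simp
      then have "(\<Sum>i<k. dist (g (t i)) (g (t (Suc i)))) = 0"
        by (intro sum.neutral) auto
      then have *: "(\<Sum>i<Suc k. dist (g (t i)) (g (t (Suc i)))) = dist (g (t 0)) (g (t (Suc k)))"
        using tk by simp
      show ?thesis unfolding *
        by (intro exI[of _ "t (Suc k)"])
          (use Suc.prems in \<open>auto intro!: bexI dist_in_inscribed_lengths dist_triangle\<close>)
    qed
  qed
  have "variation g a c - e / 2 < Sup (inscribed_lengths g a c)"
    using \<open>0 < e\<close> by (simp add: variation_def)
  then obtain x where x: "x \<in> inscribed_lengths g a c" "variation g a c - e / 2 < x"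
    using dist_in_inscribed_lengths[of a c g] \<open>a < c\<close>
    by (metis empty_iff less_cSupD less_imp_le)
  obtain k t where t: "mono_on {..k} t" "t 0 = a" "t k = c"
    "x = (\<Sum>i<k. dist (g (t i)) (g (t (Suc i))))"
    using x(1) by (rule inscribed_lengthsE)
  obtain b0 where b0: "b0 > a" "b0 \<le> c"
    and z: "\<And>b. a < b \<Longrightarrow> b \<le> b0 \<Longrightarrow> \<exists>z\<in>inscribed_lengths g b c. x \<le> dist (g a) (g b) + z"
    using key[OF t(1)] t \<open>a < c\<close> by auto
  obtain d where d: "d > 0" "\<And>y. y \<in> {a..c} \<Longrightarrow> dist y a < d \<Longrightarrow> dist (g y) (g a) < e / 2"
    using cont \<open>0 < e\<close> unfolding continuous_within_eps_delta by (metis half_gt_zero)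
  define b where "b = min b0 (a + d / 2)"
  have b: "a < b" "b \<le> b0" "dist b a < d" "b \<in> {a..c}"
    using b0 d by (auto simp: b_def dist_real_def min_def)
  obtain z where zz: "z \<in> inscribed_lengths g b c" "x \<le> dist (g a) (g b) + z"
    using z b by blast
  have "z \<le> variation g b c"
    using b by (intro variation_upper zz inscribed_lengths_subinterval[OF bd]) auto
  moreover have "variation g a c = variation g a b + variation g b c"
    using b by (intro variation_add bd) auto
  moreover have "dist (g a) (g b) < e / 2" using d(2)[OF b(4,3)] by (simp add: dist_commute)
  ultimately have "variation g a b < e" using zz x by linarith
  then show ?thesis using b by auto
qed

text \<open>Reflecting the parameter reduces this to \<open>variation_small_right\<close>.\<close>

lemma variation_small_left:
  fixes g :: "real \<Rightarrow> 'a::metric_space"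
  assumes bd: "bdd_above (inscribed_lengths g a c)" and "a < c"
    and cont: "continuous (at c within {a..c}) g" and "0 < e"
  shows "\<exists>b. a \<le> b \<and> b < c \<and> variation g b c < e"
proof -
  have "continuous (at 0 within {0..c - a}) (\<lambda>x. g (c - x))"
    unfolding continuous_within_eps_delta
  proof (intro allI impI)
    fix e :: real assume "e > 0"
    then obtain d where d: "d > 0" "\<And>y. y \<in> {a..c} \<Longrightarrow> dist y c < d \<Longrightarrow> dist (g y) (g c) < e"
      using cont unfolding continuous_within_eps_delta by metis
    then show "\<exists>d>0. \<forall>x'\<in>{0..c - a}. dist x' 0 < d \<longrightarrow> dist (g (c - x')) (g (c - 0)) < e"
      by (intro exI[of _ d]) (auto simp: dist_real_def)
  qed
  then obtain b where b: "0 < b" "b \<le> c - a" "variation (\<lambda>x. g (c - x)) 0 b < e"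
    using variation_small_right[of "\<lambda>x. g (c - x)" 0 "c - a" e] assms
    by (auto simp: inscribed_lengths_reverse)
  then show ?thesis
    by (intro exI[of _ "c - b"]) (auto simp: variation_def inscribed_lengths_reverse)
qed

section \<open>Arc length of a rectifiable curve and its parametrisation\<close>

context
  fixes g :: "real \<Rightarrow> 'a::metric_space"
  assumes rect: "rectifiable g"
begin

lemma rectifiable_path: "path g"
  using rect by (simp add: rectifiable_def)

lemma rectifiable_bdd: "0 \<le> a \<Longrightarrow> a \<le> b \<Longrightarrow> b \<le> 1 \<Longrightarrow> bdd_above (inscribed_lengths g a b)"
  using rect inscribed_lengths_subinterval[of g 0 1 a b] by (simp add: rectifiable_def)

lemma arc_len_diff:
  "0 \<le> a \<Longrightarrow> a \<le> b \<Longrightarrow> b \<le> 1 \<Longrightarrow> arc_len g b - arc_len g a = variation g a b"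
  using variation_add[OF rectifiable_bdd, of 0 b a] by (simp add: arc_len_eq_variation)

lemma arc_len_0: "arc_len g 0 = 0"
  by (simp add: arc_len_eq_variation)

lemma arc_len_mono: "0 \<le> a \<Longrightarrow> a \<le> b \<Longrightarrow> b \<le> 1 \<Longrightarrow> arc_len g a \<le> arc_len g b"
  using arc_len_diff variation_nonneg[OF rectifiable_bdd] by (metis diff_ge_0_iff_ge)

text \<open>As \<open>arc_len g\<close> is monotone, it suffices to find on either side of
  \<open>x\<close> one point up to which the variation is below \<open>e\<close>. At an endpoint of
  \<open>{0..1}\<close> the missing side is represented by \<open>x\<close> itself.\<close>

lemma continuous_on_arc_len: "continuous_on {0..1} (arc_len g)"
proof (unfold continuous_on_iff, intro ballI allI impI)
  fix x e :: real assume x: "x \<in> {0..1}" and "e > 0"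
  have cont: "continuous_on {0..1} g"
    using rectifiable_path by (simp add: path_def)
  have "\<exists>b. x \<le> b \<and> b \<le> 1 \<and> (x < 1 \<longrightarrow> x < b) \<and> variation g x b < e"
  proof (cases "x < 1")
    case True
    have "continuous (at x within {x..1}) g"
      using cont x continuous_on_subset[of "{0..1}" g "{x..1}"] by (auto simp: continuous_on_eq_continuous_within)
    then obtain b where "x < b" "b \<le> 1" "variation g x b < e"
      using variation_small_right[of g x 1 e] True x \<open>e > 0\<close> rectifiable_bdd[of x 1] by auto
    then show ?thesis by (intro exI[of _ b]) auto
  next
    case False then show ?thesis using \<open>e > 0\<close> x by (auto intro!: exI[of _ 1])
  qed
  then obtain b where b: "x \<le> b" "b \<le> 1" "x < 1 \<Longrightarrow> x < b" "variation g x b < e" by auto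
  have "\<exists>a. 0 \<le> a \<and> a \<le> x \<and> (0 < x \<longrightarrow> a < x) \<and> variation g a x < e"
  proof (cases "0 < x")
    case True
    have "continuous (at x within {0..x}) g"
      using cont x continuous_on_subset[of "{0..1}" g "{0..x}"] by (auto simp: continuous_on_eq_continuous_within)
    then obtain a where "0 \<le> a" "a < x" "variation g a x < e"
      using variation_small_left[of g 0 x e] True x \<open>e > 0\<close> rectifiable_bdd[of 0 x] by auto
    then show ?thesis by (intro exI[of _ a]) auto
  next
    case False then show ?thesis using \<open>e > 0\<close> x by (auto intro!: exI[of _ 0])
  qed
  then obtain a where a: "0 \<le> a" "a \<le> x" "0 < x \<Longrightarrow> a < x" "variation g a x < e" by auto
  define d where "d = min (if x < 1 then b - x else 1) (if 0 < x then x - a else 1)"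
  have "d > 0" using a b by (auto simp: d_def)
  moreover have "dist (arc_len g y) (arc_len g x) < e" if y: "y \<in> {0..1}" "dist y x < d" for y
  proof (cases "x \<le> y")
    case True
    then have "y \<le> b" using y b unfolding d_def dist_real_def by (auto split: if_splits)
    then have "arc_len g y \<le> arc_len g b" "arc_len g x \<le> arc_len g y"
      using y b x True by (auto intro!: arc_len_mono)
    moreover have "arc_len g b - arc_len g x < e" using b x by (subst arc_len_diff) auto
    ultimately show ?thesis by (simp add: dist_real_def)
  next
    case False
    then have "a \<le> y" using y a unfolding d_def dist_real_def by (auto split: if_splits)
    then have "arc_len g a \<le> arc_len g y" "arc_len g y \<le> arc_len g x"
      using y a x False by (auto intro!: arc_len_mono)
    moreover have "arc_len g x - arc_len g a < e" using a x by (subst arc_len_diff) auto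
    ultimately show ?thesis by (simp add: dist_real_def)
  qed
  ultimately show "\<exists>d>0. \<forall>x'\<in>{0..1}. dist x' x < d \<longrightarrow> dist (arc_len g x') (arc_len g x) < e"
    by auto
qed

lemma arc_len_surj:
  assumes "s \<in> {0..arc_len g 1}"
  obtains u where "u \<in> {0..1}" "arc_len g u = s"
  using IVT'[of "arc_len g" 0 s 1] assms continuous_on_arc_len by (auto simp: arc_len_0)

lemma dist_le_arc_len:
  assumes "u \<in> {0..1}" "w \<in> {0..1}"
  shows "dist (g u) (g w) \<le> \<bar>arc_len g u - arc_len g w\<bar>"
proof -
  have *: "dist (g u) (g w) \<le> \<bar>arc_len g u - arc_len g w\<bar>" if "u \<le> w" "0 \<le> u" "w \<le> 1" for u w
    using that dist_le_variation[OF rectifiable_bdd, of u w] arc_len_diff[of u w] by linarith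
  show ?thesis using *[of u w] *[of w u] assms
    by (cases "u \<le> w") (auto simp: dist_commute abs_minus_commute)
qed

text \<open>Parameters with the same arc length have images at distance 0 by
  \<open>dist_le_arc_len\<close>, so any choice of preimage gives the same point.\<close>

lemma arc_param_arc_len:
  assumes "u \<in> {0..1}"
  shows "arc_param g (arc_len g u) = g u"
proof -
  let ?w = "inv_into {0..1} (arc_len g) (arc_len g u)"
  have "?w \<in> {0..1}" "arc_len g ?w = arc_len g u"
    using assms by (meson inv_into_into f_inv_into_f imageI)+
  then have "dist (g ?w) (g u) \<le> 0" using dist_le_arc_len[of ?w u] assms by simp
  then show ?thesis by (simp add: arc_param_def)
qed

lemma arc_param_in_path_image: "s \<in> {0..arc_len g 1} \<Longrightarrow> arc_param g s \<in> path_image g"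
  by (metis arc_len_surj arc_param_arc_len imageI path_image_def)

lemma dist_arc_param:
  assumes "s \<in> {0..arc_len g 1}" "s' \<in> {0..arc_len g 1}"
  shows "dist (arc_param g s) (arc_param g s') \<le> \<bar>s - s'\<bar>"
proof -
  obtain u w where "u \<in> {0..1}" "arc_len g u = s" "w \<in> {0..1}" "arc_len g w = s'"
    using assms arc_len_surj by metis
  then show ?thesis using dist_le_arc_len[of u w] arc_param_arc_len by metis
qed

lemma continuous_on_arc_param: "continuous_on {0..arc_len g 1} (arc_param g)"
  unfolding continuous_on_iff
  using dist_arc_param by (metis dist_real_def order.strict_trans1)

lemma continuous_on_rho_arc_param:
  assumes "continuous_on (path_image g) (\<rho> :: _ \<Rightarrow> real)"
  shows "continuous_on {0..arc_len g 1} (\<lambda>s. \<rho> (arc_param g s))"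
  using arc_param_in_path_image by (intro continuous_on_compose2[OF assms continuous_on_arc_param]) auto

end

section \<open>Reversal and concatenation of curves\<close>

lemma rectifiable_reversepath:
  assumes g: "rectifiable g"
  shows "rectifiable (reversepath g)"
  using assms by (auto simp: rectifiable_def reversepath_def inscribed_lengths_reverse
      intro: path_reversepath[unfolded reversepath_def, THEN iffD2])

lemma rho_length_reversepath:
  assumes g: "rectifiable g"
  shows "rho_length \<rho> (reversepath g) = rho_length \<rho> g"
proof -
  note rg = rectifiable_reversepath[OF g]
  have L: "arc_len (reversepath g) u = arc_len g 1 - arc_len g (1 - u)" if "u \<in> {0..1}" for u
    using arc_len_diff[OF g, of "1 - u" 1] that
    by (simp add: arc_len_def variation_def reversepath_def inscribed_lengths_reverse)
  have L1: "arc_len (reversepath g) 1 = arc_len g 1"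
    using L[of 1] arc_len_0[OF g] by simp
  have "arc_param (reversepath g) (arc_len g 1 - s) = arc_param g s" if s: "s \<in> {0..arc_len g 1}" for s
  proof -
    obtain u where u: "u \<in> {0..1}" "arc_len g u = s" using arc_len_surj[OF g s] .
    have "arc_len (reversepath g) (1 - u) = arc_len g 1 - s"
      using L[of "1 - u"] u by simp
    then show ?thesis
      using arc_param_arc_len[OF rg, of "1 - u"] arc_param_arc_len[OF g, of u] u
      by (simp add: reversepath_def)
  qed
  then have "integral {0..arc_len g 1} (\<lambda>s. \<rho> (arc_param g s)) =
      integral {0..arc_len g 1} (\<lambda>s. \<rho> (arc_param (reversepath g) (arc_len g 1 - s)))"
    by (intro integral_cong) simp
  also have "\<dots> = integral {-arc_len g 1..-0} (\<lambda>s. \<rho> (arc_param (reversepath g) (arc_len g 1 + s)))"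
    by (subst Henstock_Kurzweil_Integration.integral_reflect_real[symmetric]) simp
  also have "\<dots> = integral {0..arc_len g 1} (\<lambda>s. \<rho> (arc_param (reversepath g) s))"
    using integral_shift_Icc_real[of "-arc_len g 1" "0" "\<lambda>s. \<rho> (arc_param (reversepath g) s)" "arc_len g 1"]
    by (simp add: comp_def)
  finally show ?thesis by (simp add: rho_length_def L1)
qed

text \<open>Inscribed sums are unchanged by an increasing affine change of parameter, so each half
  of \<open>g +++ h\<close> carries the inscribed sums of its piece. In terms of arc length the
  joined curve is \<open>g\<close> followed by \<open>h\<close> shifted by the length of
  \<open>g\<close>, and the integral splits at that length.\<close>

lemma
  assumes g: "rectifiable g" and h: "rectifiable h" and gh: "pathfinish g = pathstart h"
  shows rectifiable_joinpaths: "rectifiable (g +++ h)"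
    and rho_length_joinpaths: "continuous_on (path_image g \<union> path_image h) (\<rho> :: _ \<Rightarrow> real) \<Longrightarrow>
      rho_length \<rho> (g +++ h) = rho_length \<rho> g + rho_length \<rho> h"
proof -
  have I1: "inscribed_lengths (g +++ h) 0 (u / 2) = inscribed_lengths g 0 u" if "u \<le> 1" for u
  proof -
    have "inscribed_lengths (g +++ h) 0 (u / 2) = inscribed_lengths (\<lambda>x. g (2 * x + 0)) 0 (u / 2)"
      using that by (intro inscribed_lengths_cong) (auto simp: joinpaths_def)
    then show ?thesis by (subst (asm) inscribed_lengths_comp_affine) auto
  qed
  have I2: "inscribed_lengths (g +++ h) (1 / 2) ((u + 1) / 2) = inscribed_lengths h 0 u" if "u \<le> 1" for u
  proof -
    have "inscribed_lengths (g +++ h) (1 / 2) ((u + 1) / 2) = inscribed_lengths (\<lambda>x. h (2 * x + -1)) (1/2) ((u + 1) / 2)"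
      using that gh by (intro inscribed_lengths_cong) 
        (auto simp: joinpaths_def pathfinish_def pathstart_def mult.commute)
    then show ?thesis by (subst (asm) inscribed_lengths_comp_affine) (auto simp: field_simps)
  qed
  have bdd: "bdd_above (inscribed_lengths (g +++ h) 0 1)"
  proof -
    have "x \<le> arc_len g 1 + arc_len h 1" if x: "x \<in> inscribed_lengths (g +++ h) 0 1" for x
    proof -
      obtain y z where "y \<in> inscribed_lengths (g +++ h) 0 (1 / 2)" "z \<in> inscribed_lengths (g +++ h) (1 / 2) 1" "x \<le> y + z"
        using inscribed_lengths_split[OF x, of "1 / 2"] by auto
      moreover from this have "y \<le> arc_len g 1" "z \<le> arc_len h 1"
        using I1[of 1] I2[of 1] rectifiable_bdd[OF g, of 0 1] rectifiable_bdd[OF h, of 0 1]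
        by (auto simp: arc_len_eq_variation intro!: variation_upper)
      ultimately show ?thesis by simp
    qed
    then show ?thesis by (auto simp: bdd_above_def)
  qed
  show rj: "rectifiable (g +++ h)"
    using g h gh bdd by (simp add: rectifiable_def)
  assume \<rho>: "continuous_on (path_image g \<union> path_image h) \<rho>"
  let ?j = "g +++ h" and ?L = "arc_len g 1" and ?M = "arc_len h 1"
  have L1: "arc_len ?j (u / 2) = arc_len g u" if "u \<in> {0..1}" for u
    using that by (simp add: arc_len_def I1)
  have L2: "arc_len ?j ((u + 1) / 2) = ?L + arc_len h u" if "u \<in> {0..1}" for u
    using that arc_len_diff[OF rj, of "1 / 2" "(u + 1) / 2"] L1[of 1]
    by (simp add: variation_def I2 flip: arc_len_def)
  have L: "arc_len ?j 1 = ?L + ?M" using L2[of 1] by simp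
  have p1: "arc_param ?j s = arc_param g s" if s: "s \<in> {0..?L}" for s
  proof -
    obtain u where u: "u \<in> {0..1}" "arc_len g u = s" using arc_len_surj[OF g s] .
    then show ?thesis using L1[of u] arc_param_arc_len[OF rj, of "u/2"] arc_param_arc_len[OF g, of u]
      by (auto simp: joinpaths_def)
  qed
  have p2: "arc_param ?j (s + ?L) = arc_param h s" if s: "s \<in> {0..?M}" for s
  proof -
    obtain u where u: "u \<in> {0..1}" "arc_len h u = s" using arc_len_surj[OF h s] .
    \<comment> \<open>At u = 0 the parameter is 1 / 2, where \<open>+++\<close> still follows
      \<open>g\<close>; the common endpoint gives the value.\<close>
    have "?j ((u + 1) / 2) = h u" using u gh 
      by (cases "u = 0") (auto simp: joinpaths_def pathfinish_def pathstart_def field_simps)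
    then show ?thesis using u L2[of u] arc_param_arc_len[OF rj, of "(u + 1)/2"] arc_param_arc_len[OF h, of u]
      by (auto simp: add.commute)
  qed
  have nn: "0 \<le> ?L" "0 \<le> ?M" using arc_len_mono[OF g, of 0 1] arc_len_mono[OF h, of 0 1] arc_len_0[OF g] arc_len_0[OF h] by auto
  have "path_image ?j = path_image g \<union> path_image h" using gh by (simp add: path_image_join)
  then have int: "(\<lambda>s. \<rho> (arc_param ?j s)) integrable_on {0..?L + ?M}"
    using continuous_on_rho_arc_param[OF rj, of \<rho>] \<rho> L by (intro integrable_continuous_interval) auto
  have "rho_length \<rho> ?j = integral {0..?L} (\<lambda>s. \<rho> (arc_param ?j s)) + integral {?L..?L + ?M} (\<lambda>s. \<rho> (arc_param ?j s))"
    unfolding rho_length_def L using nn int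
    by (intro Henstock_Kurzweil_Integration.integral_combine[symmetric]) auto
  also have "integral {0..?L} (\<lambda>s. \<rho> (arc_param ?j s)) = rho_length \<rho> g"
    unfolding rho_length_def by (intro integral_cong) (simp add: p1)
  also have "integral {?L..?L + ?M} (\<lambda>s. \<rho> (arc_param ?j s)) = integral {0..?M} (\<lambda>s. \<rho> (arc_param ?j (s + ?L)))"
    using integral_shift_Icc_real[of 0 ?M "\<lambda>s. \<rho> (arc_param ?j s)" ?L]
    by (simp add: comp_def add.commute)
  also have "\<dots> = rho_length \<rho> h"
    unfolding rho_length_def by (intro integral_cong) (simp add: p2)
  finally show "rho_length \<rho> ?j = rho_length \<rho> g + rho_length \<rho> h" .
qed

section \<open>The distance of a density\<close>

lemma inscribed_lengths_linepath:
  fixes x y :: "'a::real_normed_vector"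
  assumes "a \<le> b"
  shows "inscribed_lengths (linepath x y) a b = {(b - a) * dist x y}"
proof -
  have d: "dist (linepath x y s) (linepath x y t) = (t - s) * dist x y" if "s \<le> t" for s t
  proof -
    have "linepath x y s - linepath x y t = (s - t) *\<^sub>R (y - x)"
      by (simp add: linepath_def algebra_simps)
    then show ?thesis using that by (simp add: dist_norm norm_minus_commute)
  qed
  have "z = (b - a) * dist x y" if z: "z \<in> inscribed_lengths (linepath x y) a b" for z
  proof -
    obtain k t where t: "mono_on {..k} t" "t 0 = a" "t k = b"
      "z = (\<Sum>i<k. dist (linepath x y (t i)) (linepath x y (t (Suc i))))"
      using z by (rule inscribed_lengthsE)
    have "t i \<le> t (Suc i)" if "i < k" for i
      using mono_onD[OF t(1), of i "Suc i"] that by simp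
    then have "z = (\<Sum>i<k. (t (Suc i) - t i) * dist x y)"
      unfolding t(4) by (simp add: d)
    also have "\<dots> = (t k - t 0) * dist x y"
      unfolding sum_distrib_right[symmetric] by (simp add: sum_lessThan_telescope)
    finally show ?thesis using t by simp
  qed
  moreover have "(b - a) * dist x y \<in> inscribed_lengths (linepath x y) a b"
    using dist_in_inscribed_lengths[OF assms, of "linepath x y"] unfolding d[OF assms] .
  ultimately show ?thesis by blast
qed

lemma rectifiable_linepath:
  fixes x y :: "'a::real_normed_vector"
  shows "rectifiable (linepath x y)"
  by (simp add: rectifiable_def inscribed_lengths_linepath)

lemma arc_len_linepath:
  fixes x y :: "'a::real_normed_vector"
  shows "u \<ge> 0 \<Longrightarrow> arc_len (linepath x y) u = u * dist x y"
  by (simp add: arc_len_def inscribed_lengths_linepath)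

lemma rho_length_le:
  assumes g: "rectifiable g" and c: "continuous_on (path_image g) \<rho>"
    and K: "\<And>z. z \<in> path_image g \<Longrightarrow> \<rho> z \<le> K"
  shows "rho_length \<rho> g \<le> K * arc_len g 1"
proof -
  have "rho_length \<rho> g \<le> integral {0..arc_len g 1} (\<lambda>s. K)"
    unfolding rho_length_def
    by (intro integral_le integrable_continuous_interval continuous_on_rho_arc_param g c K
        arc_param_in_path_image continuous_on_const)
  also have "\<dots> = K * arc_len g 1"
    using arc_len_mono[OF g, of 0 1] arc_len_0[OF g] by simp
  finally show ?thesis .
qed

lemma rho_length_nonneg:
  assumes g: "rectifiable g" and c: "continuous_on (path_image g) \<rho>"
    and K: "\<And>z. z \<in> path_image g \<Longrightarrow> 0 \<le> \<rho> z"
  shows "0 \<le> rho_length \<rho> g"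
  unfolding rho_length_def
  by (intro integral_nonneg integrable_continuous_interval continuous_on_rho_arc_param g c K
      arc_param_in_path_image)

lemma rho_length_radial:
  fixes \<omega> :: "'a::real_normed_vector"
  assumes "norm \<omega> = 1" "s \<le> t"
  shows "rho_length \<rho> (linepath (s *\<^sub>R \<omega>) (t *\<^sub>R \<omega>)) = integral {s..t} (\<lambda>\<tau>. \<rho> (\<tau> *\<^sub>R \<omega>))"
proof -
  let ?g = "linepath (s *\<^sub>R \<omega>) (t *\<^sub>R \<omega>)"
  have d: "dist (s *\<^sub>R \<omega>) (t *\<^sub>R \<omega>) = t - s"
    using assms by (simp add: dist_norm scaleR_left_diff_distrib[symmetric])
  have L: "arc_len ?g u = u * (t - s)" if "u \<ge> 0" for u
    using that by (simp only: arc_len_linepath d)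
  have "arc_param ?g \<sigma> = (\<sigma> + s) *\<^sub>R \<omega>" if "\<sigma> \<in> {0..t - s}" for \<sigma>
  \<comment> \<open>For s = t the segment is constant, and the rescaling by \<open>t - s\<close>
    used in the other case would divide by 0.\<close>
  proof (cases "s = t")
    case True
    then show ?thesis
      using that arc_param_arc_len[OF rectifiable_linepath, of 0 "s *\<^sub>R \<omega>" "t *\<^sub>R \<omega>"] L[of 0]
      by (simp add: linepath_def)
  next
    case False
    define u where "u = \<sigma> / (t - s)"
    have u: "u \<in> {0..1}" "\<sigma> = u * (t - s)" using that False assms by (auto simp: u_def)
    have "arc_param ?g \<sigma> = ?g u"
      using arc_param_arc_len[OF rectifiable_linepath u(1), of "s *\<^sub>R \<omega>" "t *\<^sub>R \<omega>"] L[of u] u by simp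
    also have "\<dots> = (\<sigma> + s) *\<^sub>R \<omega>" unfolding u(2) by (simp add: linepath_def algebra_simps)
    finally show ?thesis .
  qed
  then have "rho_length \<rho> ?g = integral {0..t - s} (\<lambda>\<sigma>. \<rho> ((\<sigma> + s) *\<^sub>R \<omega>))"
    unfolding rho_length_def using L[of 1] by (auto intro!: integral_cong)
  also have "\<dots> = integral {s..t} (\<lambda>\<tau>. \<rho> (\<tau> *\<^sub>R \<omega>))"
    using integral_shift_Icc_real[of 0 "t - s" "\<lambda>\<tau>. \<rho> (\<tau> *\<^sub>R \<omega>)" s]
    by (simp add: comp_def add.commute)
  finally show ?thesis .
qed

section \<open>Metric properties and Harnack estimates for a density with fixed constants\<close>

locale conf_density =
  fixes \<rho> :: "'a::euclidean_space \<Rightarrow> real" and A B :: real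
  assumes cont: "continuous_on (ball 0 1) \<rho>"
    and pos: "\<And>x. x \<in> ball 0 1 \<Longrightarrow> 0 < \<rho> x"
    and A1: "1 \<le> A" and harnack: "Harnack_inequality A \<rho>"
    and B0: "0 < B" and growth: "volume_growth B \<rho>"
    and dim2: "2 \<le> DIM('a)"
begin

abbreviation d :: "'a \<Rightarrow> 'a \<Rightarrow> real" where "d \<equiv> rho_dist \<rho>"
abbreviation v :: "'a \<Rightarrow> real" where "v \<equiv> rho_norm \<rho>"

definition curves :: "'a \<Rightarrow> 'a \<Rightarrow> (real \<Rightarrow> 'a) set" where
  "curves x y = {g. rectifiable g \<and> path_image g \<subseteq> ball 0 1 \<and> pathstart g = x \<and> pathfinish g = y}"

lemma rho_dist_eq: "d x y = (INF g\<in>curves x y. rho_length \<rho> g)"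
  unfolding rho_dist_def curves_def by (rule arg_cong[where f = Inf]) auto

lemma curves_continuous: "g \<in> curves x y \<Longrightarrow> continuous_on (path_image g) \<rho>"
  using cont by (auto simp: curves_def intro: continuous_on_subset)

lemma curves_rho_length_nonneg: "g \<in> curves x y \<Longrightarrow> 0 \<le> rho_length \<rho> g"
  using pos by (intro rho_length_nonneg curves_continuous) (auto simp: curves_def intro!: less_imp_le)

lemma bdd_below_curves: "bdd_below (rho_length \<rho> ` curves x y)"
  using curves_rho_length_nonneg by (intro bdd_belowI[of _ 0]) auto

text \<open>Convexity of the ball makes the set of competing curves nonempty; together with
  \<open>bdd_below_curves\<close> this gives the real-valued infimum its meaning.\<close>

lemma linepath_curve: "x \<in> ball 0 1 \<Longrightarrow> y \<in> ball 0 1 \<Longrightarrow> linepath x y \<in> curves x y"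
  using closed_segment_subset[OF _ _ convex_ball, of x 0 1 y] by (simp add: curves_def rectifiable_linepath)

lemma rho_dist_le: "g \<in> curves x y \<Longrightarrow> d x y \<le> rho_length \<rho> g"
  unfolding rho_dist_eq by (intro cINF_lower bdd_below_curves)

lemma rho_dist_greatest:
  assumes "x \<in> ball 0 1" "y \<in> ball 0 1" "\<And>g. g \<in> curves x y \<Longrightarrow> m \<le> rho_length \<rho> g"
  shows "m \<le> d x y"
  unfolding rho_dist_eq using linepath_curve[OF assms(1,2)] by (intro cINF_greatest assms(3)) auto

lemma rho_dist_nonneg: "x \<in> ball 0 1 \<Longrightarrow> y \<in> ball 0 1 \<Longrightarrow> 0 \<le> d x y"
  by (intro rho_dist_greatest curves_rho_length_nonneg)

lemma rho_dist_sym: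
  assumes "x \<in> ball 0 1" "y \<in> ball 0 1"
  shows "d x y = d y x"
proof -
  have "d x y \<le> d y x" if xy: "x \<in> ball 0 1" "y \<in> ball 0 1" for x y
  proof (rule rho_dist_greatest[OF xy(2,1)])
    fix g assume "g \<in> curves y x"
    then have "reversepath g \<in> curves x y" "rectifiable g"
      by (auto simp: curves_def rectifiable_reversepath)
    then show "d x y \<le> rho_length \<rho> g"
      using rho_dist_le rho_length_reversepath by metis
  qed
  then show ?thesis using assms by (auto intro: antisym)
qed

lemma rho_dist_triangle:
  assumes "x \<in> ball 0 1" "y \<in> ball 0 1" "z \<in> ball 0 1"
  shows "d x z \<le> d x y + d y z"
proof -
  have "d x z - rho_length \<rho> g \<le> d y z" if g: "g \<in> curves x y" for g
  proof (rule rho_dist_greatest[OF assms(2,3)])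
    fix h assume h: "h \<in> curves y z"
    have gh: "rectifiable g" "rectifiable h" "pathfinish g = pathstart h"
      using g h by (auto simp: curves_def)
    have "path_image (g +++ h) \<subseteq> ball 0 1"
      using g h gh by (simp add: path_image_join curves_def)
    then have "g +++ h \<in> curves x z"
      using g h rectifiable_joinpaths[OF gh] by (simp add: curves_def)
    then have "d x z \<le> rho_length \<rho> (g +++ h)" by (rule rho_dist_le)
    also have "\<dots> = rho_length \<rho> g + rho_length \<rho> h"
      using g h by (intro rho_length_joinpaths gh continuous_on_subset[OF cont]) (auto simp: curves_def)
    finally show "d x z - rho_length \<rho> g \<le> rho_length \<rho> h" by simp
  qed
  then have "d x z - d y z \<le> d x y"
    by (intro rho_dist_greatest assms) (simp add: algebra_simps)
  then show ?thesis by simp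
qed

lemma rho_dist_diff_le:
  assumes "x \<in> ball 0 1" "y \<in> ball 0 1" "z \<in> ball 0 1"
  shows "\<bar>d z x - d z y\<bar> \<le> d x y"
  using rho_dist_triangle[of z x y] rho_dist_triangle[of z y x] rho_dist_sym[of x y] assms by linarith

lemma rho_norm_sym: "x \<in> ball 0 1 \<Longrightarrow> v x = d 0 x"
  unfolding rho_norm_def by (intro rho_dist_sym) auto

lemma rho_norm_nonneg: "x \<in> ball 0 1 \<Longrightarrow> 0 \<le> v x"
  unfolding rho_norm_def by (intro rho_dist_nonneg) auto

lemma rho_dist_radial:
  assumes "norm (\<omega>::'a) = 1" "0 \<le> s" "s \<le> t" "t < 1" "z \<in> ball 0 1"
  shows "\<bar>d z (t *\<^sub>R \<omega>) - d z (s *\<^sub>R \<omega>)\<bar> \<le> integral {s..t} (\<lambda>\<tau>. \<rho> (\<tau> *\<^sub>R \<omega>))"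
proof -
  have "\<bar>d z (s *\<^sub>R \<omega>) - d z (t *\<^sub>R \<omega>)\<bar> \<le> d (s *\<^sub>R \<omega>) (t *\<^sub>R \<omega>)"
    using assms by (intro rho_dist_diff_le) auto
  also have "\<dots> \<le> rho_length \<rho> (linepath (s *\<^sub>R \<omega>) (t *\<^sub>R \<omega>))"
    using assms by (intro rho_dist_le linepath_curve) auto
  also have "\<dots> = integral {s..t} (\<lambda>\<tau>. \<rho> (\<tau> *\<^sub>R \<omega>))"
    using assms by (intro rho_length_radial)
  finally show ?thesis by linarith
qed

lemma harnack_ball_subset:
  assumes "x \<in> ball 0 1"
  shows "ball x ((1 - norm x) / 2) \<subseteq> ball (0::'a) 1"
proof
  fix y assume y: "y \<in> ball x ((1 - norm x) / 2)"
  then have "norm y \<le> norm x + (1 - norm x) / 2"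
    using norm_triangle_ineq2[of y x] by (simp add: dist_norm norm_minus_commute field_simps)
  also have "\<dots> < 1" using assms by (simp add: field_simps)
  finally show "y \<in> ball 0 1" by simp
qed

lemma harnack_le:
  assumes "z \<in> ball 0 1" "x \<in> ball z ((1 - norm z) / 2)" "y \<in> ball z ((1 - norm z) / 2)"
  shows "\<rho> x \<le> A * \<rho> y"
proof -
  have "\<rho> x / \<rho> y \<le> A" using harnack assms unfolding Harnack_inequality_def by blast
  moreover have "0 < \<rho> y" using assms harnack_ball_subset pos by blast
  ultimately show ?thesis by (simp add: divide_simps)
qed

text \<open>The segment from \<open>x\<close> to \<open>y\<close> stays in the Harnack ball of
  \<open>x\<close>, where \<rho> is at most \<open>A * \<rho> x\<close>.\<close>

lemma rho_dist_local:
  assumes x: "x \<in> ball 0 1" and y: "y \<in> ball x ((1 - norm x) / 2)"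
  shows "d x y \<le> A * \<rho> x * dist x y"
proof -
  have xx: "x \<in> ball x ((1 - norm x) / 2)" using x by simp
  have seg: "path_image (linepath x y) \<subseteq> ball x ((1 - norm x) / 2)"
    using xx y by (simp add: closed_segment_subset)
  have yb: "y \<in> ball 0 1" using harnack_ball_subset x y by blast
  have "d x y \<le> rho_length \<rho> (linepath x y)"
    by (intro rho_dist_le linepath_curve x yb)
  also have "\<dots> \<le> (A * \<rho> x) * arc_len (linepath x y) 1"
    using seg by (intro rho_length_le rectifiable_linepath curves_continuous[OF linepath_curve] x yb
        harnack_le[OF x _ xx]) auto
  finally show ?thesis by (simp add: arc_len_linepath)
qed

text \<open>The condition \<open>1 / 3 \<le> norm x\<close> says that the origin lies outside the
  open Harnack ball of \<open>x\<close>. Every curve from \<open>x\<close> to 0 therefore has length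
  at least the radius of that ball, and on an initial piece of this length it stays where \<rho> is
  at least \<open>\<rho> x / A\<close>.\<close>

lemma rho_norm_lower:
  assumes "1 / 3 \<le> norm x" "norm x < 1"
  shows "\<rho> x * (1 - norm x) \<le> 2 * A * v x"
proof -
  define r where "r = (1 - norm x) / 2"
  have xb: "x \<in> ball 0 1" and r: "0 < r" "r \<le> norm x" using assms by (auto simp: r_def)
  have xx: "x \<in> ball x r" using r by simp
  have "\<rho> x / A * r \<le> d x 0"
  proof (rule rho_dist_greatest)
    fix g assume g: "g \<in> curves x 0"
    then have gr: "rectifiable g" by (simp add: curves_def)
    let ?L = "arc_len g 1"
    have L0: "0 \<le> ?L" using arc_len_mono[OF gr, of 0 1] arc_len_0[OF gr] by simp
    have g0: "arc_param g 0 = x"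
      using arc_param_arc_len[OF gr, of 0] arc_len_0[OF gr] g by (simp add: curves_def pathstart_def)
    have gL: "arc_param g ?L = 0"
      using arc_param_arc_len[OF gr, of 1] g by (simp add: curves_def pathfinish_def)
    have "norm x \<le> ?L" using dist_arc_param[OF gr, of 0 ?L] L0 by (simp add: g0 gL)
    then have rL: "r \<le> ?L" using r by simp
    have c: "continuous_on {0..?L} (\<lambda>s. \<rho> (arc_param g s))"
      by (intro continuous_on_rho_arc_param gr curves_continuous[OF g])
    have nn: "0 \<le> \<rho> (arc_param g s)" if "s \<in> {0..?L}" for s
      using arc_param_in_path_image[OF gr that] g pos by (auto simp: curves_def intro!: less_imp_le)
    have bd: "\<rho> x / A \<le> \<rho> (arc_param g s)" if "s \<in> {0..<r}" for s
    proof -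
      have "dist x (arc_param g s) \<le> s" using dist_arc_param[OF gr, of 0 s] that rL g0 by simp
      then have "arc_param g s \<in> ball x r" using that by simp
      then have "\<rho> x \<le> A * \<rho> (arc_param g s)"
        using xx unfolding r_def by (intro harnack_le[OF xb])
      then show ?thesis using A1 by (simp add: divide_simps mult.commute)
    qed
    \<comment> \<open>At arc length \<open>r\<close> the curve may have reached the boundary of the
      open Harnack ball; continuity extends the bound to this endpoint of the interval of
      integration.\<close>
    have bd': "\<rho> x / A \<le> \<rho> (arc_param g s)" if "s \<in> {0..r}" for s
    proof (rule continuous_ge_on_closure[of "{0..<r}" "\<lambda>s. \<rho> (arc_param g s)"])
      show "continuous_on (closure {0..<r}) (\<lambda>s. \<rho> (arc_param g s))"
        using r rL by (intro continuous_on_subset[OF c]) auto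
    qed (use that r bd in auto)
    have "\<rho> x / A * r = integral {0..r} (\<lambda>s. \<rho> x / A)" using r by simp
    also have "\<dots> \<le> integral {0..r} (\<lambda>s. \<rho> (arc_param g s))"
      using rL by (intro integral_le bd' integrable_continuous_interval continuous_on_subset[OF c] continuous_on_const) auto
    also have "\<dots> \<le> integral {0..?L} (\<lambda>s. \<rho> (arc_param g s))"
      using rL nn by (intro integral_subset_le integrable_continuous_interval continuous_on_subset[OF c]) auto
    finally show "\<rho> x / A * r \<le> rho_length \<rho> g" by (simp add: rho_length_def)
  qed (use xb in auto)
  then show ?thesis using A1 unfolding rho_norm_def r_def by (simp add: divide_simps mult.commute mult.left_commute)
qed

lemma continuous_on_rho_dist:
  assumes z: "z \<in> ball 0 1"
  shows "continuous_on (ball 0 1) (d z)"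
  unfolding continuous_on_iff
proof (intro ballI allI impI)
  fix x e :: 'a and \<epsilon> :: real assume x: "x \<in> ball 0 1" and e: "\<epsilon> > 0"
  define r where "r = min ((1 - norm x) / 2) (\<epsilon> / (A * \<rho> x))"
  have rp: "0 < A * \<rho> x" using A1 pos[OF x] by simp
  then have "r > 0" using x e by (simp add: r_def)
  moreover have "dist (d z y) (d z x) < \<epsilon>" if y: "y \<in> ball 0 1" "dist y x < r" for y
  proof -
    have "\<bar>d z x - d z y\<bar> \<le> d x y" using x y z by (intro rho_dist_diff_le)
    also have "\<dots> \<le> A * \<rho> x * dist x y"
      using y x by (intro rho_dist_local) (auto simp: r_def dist_commute)
    also have "\<dots> < \<epsilon>" using y rp by (simp add: r_def dist_commute pos_less_divide_eq mult.commute)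
    finally show ?thesis by (simp add: dist_real_def)
  qed
  ultimately show "\<exists>\<delta>>0. \<forall>y\<in>ball 0 1. dist y x < \<delta> \<longrightarrow> dist (d z y) (d z x) < \<epsilon>" by blast
qed

lemma continuous_on_rho_norm: "continuous_on (ball 0 1) v"
  using continuous_on_rho_dist[of 0] continuous_on_cong[of "ball 0 1" "ball 0 1" v "d 0"] rho_norm_sym
  by simp

end

section \<open>Polar coordinates and spherical caps\<close>

lemma space_sphere_measure [simp]: "space (sphere_measure :: 'a::euclidean_space measure) = sphere 0 1"
  by (simp add: sphere_measure_def space_scale_measure space_restrict_space)

lemma sets_sphere_measure [measurable_cong]:
  "sets (sphere_measure :: 'a::euclidean_space measure) = sets (restrict_space borel (sphere 0 1))"
  by (simp add: sphere_measure_def)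

lemma sets_sphere_measure_iff:
  "A \<in> sets (sphere_measure :: 'a::euclidean_space measure) \<longleftrightarrow> A \<in> sets borel \<and> A \<subseteq> sphere 0 1"
  by (subst sets_sphere_measure, subst sets_restrict_space_iff) auto

lemma borel_measurable_sphere_measure:
  "f \<in> borel_measurable borel \<Longrightarrow> f \<in> borel_measurable (sphere_measure :: 'a::euclidean_space measure)"
  unfolding measurable_cong_sets[OF sets_sphere_measure refl] by (rule measurable_restrict_space1)

definition radial_cone :: "'a::euclidean_space set \<Rightarrow> real \<Rightarrow> 'a set" where
  "radial_cone A s = {x. x \<noteq> 0 \<and> norm x \<le> s \<and> x /\<^sub>R norm x \<in> A}"

lemma radial_cone_measurable [measurable]:
  assumes [measurable]: "A \<in> sets borel"
  shows "radial_cone A s \<in> sets (borel :: 'a::euclidean_space measure)"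
  unfolding radial_cone_def by measurable

lemma emeasure_sphere_measure_cone:
  fixes A :: "'a::euclidean_space set"
  assumes "A \<in> sets sphere_measure"
  shows "emeasure sphere_measure A = ennreal DIM('a) * emeasure lborel (radial_cone A 1)"
proof -
  have "{x \<in> cball 0 1 - {0}. x /\<^sub>R norm x \<in> A} = radial_cone A 1"
    by (auto simp: radial_cone_def)
  then show ?thesis
    using emeasure_sphere_measure[of A] assms by (simp add: sets_sphere_measure_iff ennreal_of_nat_eq_real_of_nat)
qed

lemma emeasure_radial_cone:
  fixes A :: "'a::euclidean_space set"
  assumes [measurable]: "A \<in> sets borel" and "s \<ge> 0"
  shows "emeasure lborel (radial_cone A s) = ennreal (s ^ DIM('a)) * emeasure lborel (radial_cone A 1)"
proof (cases "s = 0")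
  case True
  then have "radial_cone A s = {}" by (auto simp: radial_cone_def)
  then show ?thesis using True by simp
next
  case False
  then have s: "s > 0" using assms by simp
  have "emeasure lborel (radial_cone A s) =
      emeasure (density (distr lborel borel (\<lambda>x. 0 + s *\<^sub>R x)) (\<lambda>_. \<bar>s\<bar> ^ DIM('a))) (radial_cone A s)"
    using lborel_affine[of s "0 :: 'a"] s by simp
  also have "\<dots> = ennreal (s ^ DIM('a)) * emeasure (distr lborel borel (\<lambda>x. s *\<^sub>R x)) (radial_cone A s)"
    using s by (simp add: emeasure_density nn_integral_cmult ennreal_power)
  also have "emeasure (distr lborel borel (\<lambda>x. s *\<^sub>R x)) (radial_cone A s) =
      emeasure lborel ((\<lambda>x. s *\<^sub>R x) -` radial_cone A s)"
    by (subst emeasure_distr) auto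
  also have "(\<lambda>x. s *\<^sub>R x) -` radial_cone A s = radial_cone A 1"
  proof -
    have "(s *\<^sub>R x) /\<^sub>R norm (s *\<^sub>R x) = x /\<^sub>R norm x" "norm (s *\<^sub>R x) \<le> s \<longleftrightarrow> norm x \<le> 1"
      "s *\<^sub>R x \<noteq> 0 \<longleftrightarrow> x \<noteq> 0" for x :: 'a
      using s by auto
    then show ?thesis
      by (intro set_eqI) (simp only: vimage_eq radial_cone_def mem_Collect_eq)
  qed
  finally show ?thesis .
qed

lemma emeasure_radial_cone_finite: "emeasure lborel (radial_cone (A :: 'a::euclidean_space set) s) < \<infinity>"
proof -
  have "emeasure lborel (radial_cone A s) \<le> emeasure lborel (cball (0::'a) s)"
    by (intro emeasure_mono) (auto simp: radial_cone_def)
  then show ?thesis using emeasure_lborel_cball_finite[of "0::'a" s] by (simp add: order.strict_trans1)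
qed

lemma finite_sphere_measure: "finite_measure (sphere_measure :: 'a::euclidean_space measure)"
proof
  have "sphere 0 1 \<in> sets (sphere_measure :: 'a measure)" by (simp add: sets_sphere_measure_iff)
  then show "emeasure (sphere_measure :: 'a measure) (space sphere_measure) \<noteq> \<infinity>"
    using emeasure_radial_cone_finite[of "sphere 0 1 :: 'a set" 1]
    by (simp add: emeasure_sphere_measure_cone ennreal_mult_eq_top_iff)
qed

text \<open>The radial factor of polar coordinates, confined to \<open>{0<..1}\<close> so that it is
  finite and its product with \<open>sphere_measure\<close> describes the punctured closed
  ball.\<close>

definition radial_measure :: "nat \<Rightarrow> real measure" where
  "radial_measure n = density lborel (\<lambda>t. ennreal (t ^ (n - 1)) * indicator {0<..1} t)"

text \<open>Half-lines are the sets on which \<open>polar_measure\<close> compares measures in the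
  radius. Clamping the endpoint makes one formula valid for every real \<open>s\<close>.\<close>

lemma emeasure_radial_measure:
  assumes "n \<ge> 1"
  shows "emeasure (radial_measure n) {s<..} = ennreal ((1 - min 1 (max 0 s) ^ n) / n)"
proof -
  let ?a = "min 1 (max 0 s)"
  have "emeasure (radial_measure n) {s<..} =
      (\<integral>\<^sup>+t. ennreal (t ^ (n - 1)) * indicator {0<..1} t * indicator {s<..} t \<partial>lborel)"
    unfolding radial_measure_def by (subst emeasure_density) auto
  also have "\<dots> = (\<integral>\<^sup>+t. ennreal (t ^ (n - 1)) * indicator {?a..1} t \<partial>lborel)"
  proof (rule nn_integral_cong_AE)
    have "AE t in lborel. t \<noteq> ?a \<and> t \<noteq> (1::real)"
      using AE_lborel_singleton[of ?a] AE_lborel_singleton[of "1::real"] by eventually_elim auto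
    then show "AE t in lborel. ennreal (t ^ (n - 1)) * indicator {0<..1} t * indicator {s<..} t =
        ennreal (t ^ (n - 1)) * indicator {?a..1} t"
      by eventually_elim (auto simp: indicator_def min_def max_def)
  qed
  also have "\<dots> = ennreal (1 ^ n / n - ?a ^ n / n)"
    by (intro nn_integral_FTC_Icc) (use assms in \<open>auto intro!: derivative_eq_intros\<close>)
  finally show ?thesis by (simp add: diff_divide_distrib)
qed

lemma finite_radial_measure:
  assumes "n \<ge> 1"
  shows "finite_measure (radial_measure n)"
proof
  have "emeasure (radial_measure n) (space (radial_measure n)) \<le> emeasure (radial_measure n) {-1<..}"
    unfolding radial_measure_def by (subst (1 2) emeasure_density) (auto intro!: nn_integral_mono simp: indicator_def)
  also have "\<dots> < \<infinity>" using emeasure_radial_measure[OF assms, of "-1"] by simp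
  finally show "emeasure (radial_measure n) (space (radial_measure n)) \<noteq> \<infinity>" by simp
qed

abbreviation "punctured_cball \<equiv> (cball 0 1 - {0} :: 'a::euclidean_space set)"

lemma polar_measurable:
  "(\<lambda>x. (x /\<^sub>R norm x, norm x)) \<in>
     measurable (restrict_space lborel punctured_cball) ((sphere_measure :: 'a::euclidean_space measure) \<Otimes>\<^sub>M borel)"
proof (rule measurable_Pair)
  have "(\<lambda>x::'a. x /\<^sub>R norm x) \<in> restrict_space lborel punctured_cball \<rightarrow>\<^sub>M restrict_space borel (sphere 0 1)"
    by (intro measurable_restrict_space2 measurable_restrict_space1) (auto simp: space_restrict_space)
  then show "(\<lambda>x::'a. x /\<^sub>R norm x) \<in> restrict_space lborel punctured_cball \<rightarrow>\<^sub>M sphere_measure"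
    unfolding measurable_cong_sets[OF refl sets_sphere_measure] .
qed (auto intro!: measurable_restrict_space1)

text \<open>Agreement is needed only on rectangles \<open>A \<times> Y\<close>. For a fixed set
  \<open>A\<close> of directions this compares two measures in the radius, and on half-lines it
  reduces to the scaling of cones over \<open>A\<close> by \<open>s ^ DIM('a)\<close>. The factor
  \<open>DIM('a)\<close> in \<open>sphere_measure\<close> cancels the one from integrating
  \<open>t ^ (DIM('a) - 1)\<close>.\<close>

lemma polar_measure:
  "(sphere_measure :: 'a::euclidean_space measure) \<Otimes>\<^sub>M radial_measure DIM('a) =
    distr (restrict_space lborel punctured_cball) (sphere_measure \<Otimes>\<^sub>M borel) (\<lambda>x. (x /\<^sub>R norm x, norm x))"
    (is "_ = distr ?M _ ?T")
proof (rule pair_measure_eqI)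
  interpret S: finite_measure "sphere_measure :: 'a measure" by (rule finite_sphere_measure)
  interpret R: finite_measure "radial_measure DIM('a)" by (rule finite_radial_measure) simp
  show "sigma_finite_measure (sphere_measure :: 'a measure)" by unfold_locales
  show "sigma_finite_measure (radial_measure DIM('a))" by unfold_locales
  have "sets (radial_measure DIM('a)) = sets borel" by (simp add: radial_measure_def)
  then show "sets (sphere_measure \<Otimes>\<^sub>M radial_measure DIM('a)) = sets (distr ?M (sphere_measure \<Otimes>\<^sub>M borel) ?T)"
    unfolding sets_distr by (intro sets_pair_measure_cong refl)
  fix A :: "'a set" and Y assume A: "A \<in> sets sphere_measure" and Y: "Y \<in> sets (radial_measure DIM('a))"
  have A'[measurable]: "A \<in> sets borel" using A by (simp add: sets_sphere_measure_iff)
  let ?n = "DIM('a)"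
  \<comment> \<open>\<open>P\<close> and \<open>Q\<close> are the two sides of the claim as measures
    in \<open>Y\<close> alone.\<close>
  define P where "P = density (radial_measure ?n) (\<lambda>_. emeasure sphere_measure A)"
  define Q where "Q = distr (density lborel (indicator (radial_cone A 1))) borel (norm :: 'a \<Rightarrow> real)"
  have Q: "emeasure Q X = emeasure lborel (radial_cone A 1 \<inter> norm -` X)" if [measurable]: "X \<in> sets borel" for X
  proof -
    have "emeasure Q X = emeasure (density lborel (indicator (radial_cone A 1))) (norm -` X)"
      unfolding Q_def by (subst emeasure_distr) auto
    also have "\<dots> = emeasure lborel (radial_cone A 1 \<inter> norm -` X)"
      by (subst emeasure_density)
        (auto simp: indicator_inter_arith[symmetric] measurable_sets_borel[OF borel_measurable_norm])
    finally show ?thesis .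
  qed
  have P: "emeasure P X = emeasure sphere_measure A * emeasure (radial_measure ?n) X" if [measurable]: "X \<in> sets borel" for X
    unfolding P_def by (subst emeasure_density) (auto simp: radial_measure_def nn_integral_cmult)
  have "Q = P"
  proof (rule measure_eqI_lessThan)
    show "sets Q = sets borel" "sets P = sets borel" by (auto simp: Q_def P_def radial_measure_def)
    fix s :: real
    let ?a = "min 1 (max 0 s)"
    have "emeasure Q {s<..} \<le> emeasure lborel (radial_cone A 1)"
      by (subst Q) (auto intro!: emeasure_mono)
    then show "emeasure Q {s<..} < \<infinity>" using emeasure_radial_cone_finite[of A 1] by (simp add: order.strict_trans1)
    have "radial_cone A 1 \<inter> norm -` {s<..} = radial_cone A 1 - radial_cone A ?a"
    proof -
      have "s < norm x \<longleftrightarrow> \<not> norm x \<le> ?a" if "x \<noteq> 0" "norm x \<le> 1" for x :: 'a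
        using that by (auto simp: min_def max_def) (smt (verit) norm_ge_zero)
      then show ?thesis by (auto simp: radial_cone_def)
    qed
    then have "emeasure Q {s<..} = emeasure lborel (radial_cone A 1 - radial_cone A ?a)"
      by (subst Q) auto
    also have "\<dots> = emeasure lborel (radial_cone A 1) - emeasure lborel (radial_cone A ?a)"
      using emeasure_radial_cone_finite[of A ?a] by (intro emeasure_Diff) (auto simp: radial_cone_def)
    also have "\<dots> = emeasure P {s<..}"
    proof -
      obtain c where c: "emeasure lborel (radial_cone A 1) = ennreal c" "c \<ge> 0"
        using emeasure_radial_cone_finite[of A 1] by (metis ennreal_cases infinity_ennreal_def less_irrefl)
      have le: "?a ^ ?n \<le> 1" by (intro power_le_one) auto
      have "emeasure lborel (radial_cone A ?a) = ennreal (?a ^ ?n * c)"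
        using c by (subst emeasure_radial_cone) (auto simp: ennreal_mult)
      then have "emeasure lborel (radial_cone A 1) - emeasure lborel (radial_cone A ?a) = ennreal (c - ?a ^ ?n * c)"
        using c by (simp add: ennreal_minus)
      moreover have "emeasure P {s<..} = ennreal (?n * c) * ennreal ((1 - ?a ^ ?n) / ?n)"
        using c by (simp add: P emeasure_radial_measure emeasure_sphere_measure_cone[OF A] ennreal_mult)
      then have "emeasure P {s<..} = ennreal (?n * c * ((1 - ?a ^ ?n) / ?n))"
        using le c by (subst ennreal_mult) auto
      moreover have "?n * c * ((1 - ?a ^ ?n) / ?n) = c - ?a ^ ?n * c"
        by (simp add: field_simps)
      ultimately show ?thesis by simp
    qed
    finally show "emeasure Q {s<..} = emeasure P {s<..}" .
  qed
  have Y': "Y \<in> sets borel" using Y by (simp add: radial_measure_def)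
  have "emeasure sphere_measure A * emeasure (radial_measure ?n) Y = emeasure P Y" using P[OF Y'] ..
  also have "\<dots> = emeasure Q Y" using \<open>Q = P\<close> by simp
  also have "\<dots> = emeasure lborel (radial_cone A 1 \<inter> norm -` Y)" by (rule Q[OF Y'])
  also have "radial_cone A 1 \<inter> norm -` Y = ?T -` (A \<times> Y) \<inter> space ?M"
    by (auto simp: radial_cone_def space_restrict_space)
  also have "emeasure lborel \<dots> = emeasure ?M \<dots>"
    by (subst emeasure_restrict_space) (auto simp: space_restrict_space)
  also have "\<dots> = emeasure (distr ?M (sphere_measure \<Otimes>\<^sub>M borel) ?T) (A \<times> Y)"
    using A Y' by (intro emeasure_distr[symmetric] polar_measurable) auto
  finally show "emeasure sphere_measure A * emeasure (radial_measure ?n) Y =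
      emeasure (distr ?M (sphere_measure \<Otimes>\<^sub>M borel) ?T) (A \<times> Y)" .
qed

lemma scaleR_pair_measurable:
  "(\<lambda>(\<omega>, t). t *\<^sub>R \<omega>) \<in> borel_measurable ((sphere_measure :: 'a::euclidean_space measure) \<Otimes>\<^sub>M (borel :: real measure))"
proof -
  have "(\<lambda>\<omega>. \<omega>) \<in> borel_measurable (sphere_measure :: 'a measure)"
    by (intro borel_measurable_sphere_measure) simp
  then have "(\<lambda>p. snd p *\<^sub>R fst p) \<in> borel_measurable ((sphere_measure :: 'a measure) \<Otimes>\<^sub>M (borel :: real measure))"
    by (intro borel_measurable_scaleR measurable_compose[OF measurable_fst] measurable_snd) auto
  then show ?thesis by (simp add: case_prod_beta)
qed

theorem nn_integral_polar:
  fixes f :: "'a::euclidean_space \<Rightarrow> ennreal"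
  assumes f[measurable]: "f \<in> borel_measurable borel"
  shows "(\<integral>\<^sup>+x\<in>ball 0 1. f x \<partial>lborel) =
    (\<integral>\<^sup>+\<omega>. (\<integral>\<^sup>+t\<in>{0<..<1}. f (t *\<^sub>R \<omega>) * ennreal (t ^ (DIM('a) - 1)) \<partial>lborel) \<partial>sphere_measure)"
proof -
  let ?M = "restrict_space lborel punctured_cball :: 'a measure"
  let ?T = "\<lambda>x::'a. (x /\<^sub>R norm x, norm x)"
  interpret R: finite_measure "radial_measure DIM('a)" by (rule finite_radial_measure) simp
  \<comment> \<open>The product measure reaches up to radius 1; cutting \<open>f\<close> off at the
    open ball removes the sphere on both sides, and the origin is a null set.\<close>
  define h where "h = (\<lambda>x. f x * indicator (ball 0 1) x)"
  have h[measurable]: "h \<in> borel_measurable borel"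
    unfolding h_def by (intro borel_measurable_times_ennreal f borel_measurable_indicator) simp
  let ?H = "\<lambda>(\<omega>, t). h (t *\<^sub>R \<omega>)"
  have H: "?H \<in> borel_measurable ((sphere_measure :: 'a measure) \<Otimes>\<^sub>M (borel :: real measure))"
    using measurable_compose[OF scaleR_pair_measurable h] by (simp add: case_prod_beta)
  have sr: "sets (radial_measure DIM('a)) = sets borel" by (simp add: radial_measure_def)
  have H': "?H \<in> borel_measurable ((sphere_measure :: 'a measure) \<Otimes>\<^sub>M radial_measure DIM('a))"
    using H unfolding measurable_cong_sets[OF sets_pair_measure_cong[OF refl sr] refl] .
  have "(\<integral>\<^sup>+x\<in>ball 0 1. f x \<partial>lborel) = (\<integral>\<^sup>+x\<in>punctured_cball. h x \<partial>lborel)"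
    using AE_lborel_singleton[of "0::'a"]
    by (intro nn_integral_cong_AE) (auto elim!: eventually_mono simp: h_def indicator_def)
  also have "\<dots> = (\<integral>\<^sup>+x. h x \<partial>?M)"
    by (subst nn_integral_restrict_space) auto
  also have "\<dots> = (\<integral>\<^sup>+x. ?H (?T x) \<partial>?M)"
    by (intro nn_integral_cong) (auto simp: space_restrict_space)
  also have "\<dots> = (\<integral>\<^sup>+p. ?H p \<partial>distr ?M (sphere_measure \<Otimes>\<^sub>M borel) ?T)"
    using H by (intro nn_integral_distr[symmetric] polar_measurable) auto
  also have "\<dots> = (\<integral>\<^sup>+p. ?H p \<partial>(sphere_measure \<Otimes>\<^sub>M radial_measure DIM('a)))"
    by (subst polar_measure) simp
  also have "\<dots> = (\<integral>\<^sup>+\<omega>. (\<integral>\<^sup>+t. h (t *\<^sub>R \<omega>) \<partial>radial_measure DIM('a)) \<partial>sphere_measure)"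
    using R.nn_integral_fst[OF H', symmetric] by simp
  also have "\<dots> = (\<integral>\<^sup>+\<omega>. (\<integral>\<^sup>+t\<in>{0<..<1}. f (t *\<^sub>R \<omega>) * ennreal (t ^ (DIM('a) - 1)) \<partial>lborel) \<partial>sphere_measure)"
  proof (rule nn_integral_cong)
    fix \<omega> :: 'a assume "\<omega> \<in> space sphere_measure"
    then have \<omega>: "norm \<omega> = 1" by simp
    have "(\<integral>\<^sup>+t. h (t *\<^sub>R \<omega>) \<partial>radial_measure DIM('a)) =
        (\<integral>\<^sup>+t. (ennreal (t ^ (DIM('a) - 1)) * indicator {0<..1} t) * h (t *\<^sub>R \<omega>) \<partial>lborel)"
      unfolding radial_measure_def by (subst nn_integral_density) auto
    also have "\<dots> = (\<integral>\<^sup>+t\<in>{0<..<1}. f (t *\<^sub>R \<omega>) * ennreal (t ^ (DIM('a) - 1)) \<partial>lborel)"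
      using \<omega> by (intro nn_integral_cong) (auto simp: h_def indicator_def mult.commute)
    finally show "(\<integral>\<^sup>+t. h (t *\<^sub>R \<omega>) \<partial>radial_measure DIM('a)) =
        (\<integral>\<^sup>+t\<in>{0<..<1}. f (t *\<^sub>R \<omega>) * ennreal (t ^ (DIM('a) - 1)) \<partial>lborel)" .
  qed
  finally show ?thesis .
qed

lemma borel_measurable_radial_integral:
  fixes f :: "'a::euclidean_space \<Rightarrow> ennreal" and w :: "real \<Rightarrow> ennreal"
  assumes f: "f \<in> borel_measurable borel" and w: "w \<in> borel_measurable borel"
  shows "(\<lambda>\<omega>. \<integral>\<^sup>+t. f (t *\<^sub>R \<omega>) * w t \<partial>lborel) \<in> borel_measurable sphere_measure"
proof -
  have "(\<lambda>(\<omega>, t). f (t *\<^sub>R \<omega>)) \<in> borel_measurable ((sphere_measure :: 'a measure) \<Otimes>\<^sub>M (borel :: real measure))"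
    using measurable_compose[OF scaleR_pair_measurable f] by (simp add: case_prod_beta)
  then have "(\<lambda>p. f (snd p *\<^sub>R fst p) * w (snd p)) \<in> borel_measurable ((sphere_measure :: 'a measure) \<Otimes>\<^sub>M (borel :: real measure))"
    by (intro borel_measurable_times_ennreal measurable_compose[OF measurable_snd w]) (simp add: case_prod_beta)
  then have "(\<lambda>p. f (snd p *\<^sub>R fst p) * w (snd p)) \<in> borel_measurable ((sphere_measure :: 'a measure) \<Otimes>\<^sub>M lborel)"
    unfolding measurable_cong_sets[OF sets_pair_measure_cong[OF refl sets_lborel] refl] .
  from lborel.borel_measurable_nn_integral_fst[OF this] show ?thesis by simp
qed

section \<open>Measure of spherical caps\<close>

definition cap :: "'a::euclidean_space \<Rightarrow> real \<Rightarrow> 'a set" where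
  "cap \<omega> h = sphere 0 1 \<inter> cball \<omega> h"

lemma cap_sets [measurable]: "cap \<omega> h \<in> sets borel" "cap \<omega> h \<in> sets sphere_measure"
  by (auto simp: cap_def sets_sphere_measure_iff)

lemma dist_normalize:
  fixes x :: "'a::real_normed_vector"
  assumes "x \<noteq> 0" "norm x \<le> 1"
  shows "dist x (x /\<^sub>R norm x) = 1 - norm x"
proof -
  have "x - x /\<^sub>R norm x = (norm x - 1) *\<^sub>R (x /\<^sub>R norm x)"
    using assms by (simp add: algebra_simps)
  then show ?thesis using assms by (simp only: dist_norm norm_scaleR) simp
qed

text \<open>The part of the cone over the cap with radii in \<open>{1 - h<..<1}\<close> lies in the
  ball of radius \<open>2 * h\<close> about \<omega>. In polar coordinates its volume is at least h
  / 2^(n-1) times the measure of the cap, because \<open>h \<le> 1 / 2\<close> keeps the radii above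
  1 / 2.\<close>

lemma emeasure_cap_upper:
  fixes \<omega> :: "'a::euclidean_space"
  assumes "norm \<omega> = 1" "0 < h" "h \<le> 1 / 2"
  shows "emeasure sphere_measure (cap \<omega> h) \<le> ennreal (4 ^ DIM('a) * unit_ball_vol DIM('a) * h ^ (DIM('a) - 1))"
proof -
  let ?n = "DIM('a)" and ?\<sigma> = "sphere_measure :: 'a measure"
  define G where "G = {x::'a. x \<noteq> 0 \<and> 1 - h < norm x \<and> x /\<^sub>R norm x \<in> cap \<omega> h}"
  have [measurable]: "G \<in> sets borel" unfolding G_def by measurable
  have sub: "G \<inter> ball 0 1 \<subseteq> cball \<omega> (2 * h)"
  proof
    fix x assume x: "x \<in> G \<inter> ball 0 1"
    have "dist x (x /\<^sub>R norm x) = 1 - norm x"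
      using x by (intro dist_normalize) (auto simp: G_def)
    moreover have "dist \<omega> (x /\<^sub>R norm x) \<le> h" using x by (simp add: G_def cap_def)
    ultimately show "x \<in> cball \<omega> (2 * h)"
      using dist_triangle2[of \<omega> x "x /\<^sub>R norm x"] x by (simp add: G_def)
  qed
  have "emeasure ?\<sigma> (cap \<omega> h) * ennreal (h * (1/2) ^ (?n - 1)) =
      (\<integral>\<^sup>+\<omega>'. ennreal (h * (1/2) ^ (?n - 1)) * indicator (cap \<omega> h) \<omega>' \<partial>?\<sigma>)"
    by (subst nn_integral_cmult_indicator) (simp_all add: mult.commute)
  also have "\<dots> \<le> (\<integral>\<^sup>+\<omega>'. (\<integral>\<^sup>+t\<in>{0<..<1}. indicator G (t *\<^sub>R \<omega>') * ennreal (t ^ (?n - 1)) \<partial>lborel) \<partial>?\<sigma>)"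
  proof (rule nn_integral_mono)
    fix \<omega>' :: 'a assume "\<omega>' \<in> space ?\<sigma>"
    then have \<omega>': "norm \<omega>' = 1" by simp
    show "ennreal (h * (1/2) ^ (?n - 1)) * indicator (cap \<omega> h) \<omega>' \<le>
        (\<integral>\<^sup>+t\<in>{0<..<1}. indicator G (t *\<^sub>R \<omega>') * ennreal (t ^ (?n - 1)) \<partial>lborel)"
    proof (cases "\<omega>' \<in> cap \<omega> h")
      case True
      have "ennreal (h * (1/2) ^ (?n - 1)) = (\<integral>\<^sup>+t. ennreal ((1/2) ^ (?n - 1)) * indicator {1 - h<..<1} t \<partial>lborel)"
        using assms by (subst nn_integral_cmult_indicator) (simp_all add: ennreal_mult' mult.commute)
      also have "\<dots> \<le> (\<integral>\<^sup>+t\<in>{0<..<1}. indicator G (t *\<^sub>R \<omega>') * ennreal (t ^ (?n - 1)) \<partial>lborel)"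
        using assms True \<omega>'
        by (intro nn_integral_mono) (auto simp: indicator_def G_def intro!: ennreal_leI power_mono)
      finally show ?thesis using True by simp
    qed simp
  qed
  also have "\<dots> = (\<integral>\<^sup>+x\<in>ball 0 1. indicator G x \<partial>lborel)"
    by (rule nn_integral_polar[symmetric]) measurable
  also have "\<dots> \<le> (\<integral>\<^sup>+x. indicator (cball \<omega> (2 * h)) x \<partial>lborel)"
    using sub by (intro nn_integral_mono) (auto simp: indicator_def)
  also have "\<dots> = ennreal (unit_ball_vol ?n * (2 * h) ^ ?n)"
    using assms by (simp add: emeasure_cball)
  finally have le: "emeasure ?\<sigma> (cap \<omega> h) * ennreal (h * (1/2) ^ (?n - 1)) \<le> ennreal (unit_ball_vol ?n * (2 * h) ^ ?n)" .
  have fin: "emeasure ?\<sigma> (cap \<omega> h) \<noteq> \<infinity>"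
    using finite_measure.emeasure_finite[OF finite_sphere_measure] by auto
  then obtain m where m: "emeasure ?\<sigma> (cap \<omega> h) = ennreal m" "m \<ge> 0"
    by (metis ennreal_cases infinity_ennreal_def)
  obtain k where k: "?n = Suc k" using DIM_positive[where 'a='a] by (metis Suc_pred)
  have "m * (h * (1/2) ^ k) \<le> unit_ball_vol ?n * (2 * h) ^ Suc k"
    using le assms m by (simp add: k ennreal_mult'[symmetric])
  then have "(m * (1/2)^k) * h \<le> (unit_ball_vol ?n * 2 * (2 * h) ^ k) * h" by (simp add: algebra_simps)
  then have "m * (1/2) ^ k \<le> unit_ball_vol ?n * 2 * (2 * h) ^ k" using assms mult_le_cancel_right_pos by blast
  then have "(m * (1/2) ^ k) * 2 ^ k \<le> (unit_ball_vol ?n * 2 * (2 * h) ^ k) * 2 ^ k" by (intro mult_right_mono) auto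
  then have "m \<le> unit_ball_vol ?n * 2 * (2 * h) ^ k * 2 ^ k" by (simp add: power_divide)
  also have "\<dots> = 2 * 4 ^ k * unit_ball_vol ?n * h ^ k"
  proof -
    have "(4::real) ^ k = 2 ^ k * 2 ^ k" by (simp flip: power_mult_distrib)
    then show ?thesis by (simp add: power_mult_distrib)
  qed
  also have "\<dots> \<le> 4 ^ ?n * unit_ball_vol ?n * h ^ k"
    using assms by (intro mult_right_mono) (auto simp: k)
  finally show ?thesis using m by (simp add: k ennreal_leI)
qed

text \<open>The ball of radius \<open>h / 4\<close> about
  \<open>(1 - h / 4) *\<^sub>R \<omega>\<close> fits into the part of the cone over the cap with
  radii in \<open>{1 - h / 2<..<1}\<close>: its points project to directions within h / 4 + h / 4 +
  h / 2 of \<omega>. That part has volume at most h / 2 times the measure of the cap.\<close>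

lemma emeasure_cap_lower:
  fixes \<omega> :: "'a::euclidean_space"
  assumes "norm \<omega> = 1" "0 < h" "h \<le> 1"
  shows "ennreal (unit_ball_vol DIM('a) / 4 ^ DIM('a) * h ^ (DIM('a) - 1)) \<le> emeasure sphere_measure (cap \<omega> h)"
proof -
  let ?n = "DIM('a)" and ?\<sigma> = "sphere_measure :: 'a measure"
  define G where "G = {x::'a. x \<noteq> 0 \<and> 1 - h / 2 < norm x \<and> x /\<^sub>R norm x \<in> cap \<omega> h}"
  have [measurable]: "G \<in> sets borel" unfolding G_def by measurable
  have sub: "ball ((1 - h / 4) *\<^sub>R \<omega>) (h / 4) \<subseteq> G \<inter> ball 0 1"
  proof
    fix x assume x: "x \<in> ball ((1 - h / 4) *\<^sub>R \<omega>) (h / 4)"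
    have n1: "norm ((1 - h / 4) *\<^sub>R \<omega>) = 1 - h / 4" using assms by simp
    have x': "norm ((1 - h / 4) *\<^sub>R \<omega> - x) < h / 4" using x by (simp add: dist_norm)
    then have nx: "1 - h / 2 < norm x" "norm x < 1"
      using norm_triangle_ineq2[of "(1 - h / 4) *\<^sub>R \<omega>" x] norm_triangle_ineq2[of x "(1 - h / 4) *\<^sub>R \<omega>"] n1
      by (auto simp: norm_minus_commute)
    then have x0: "x \<noteq> 0" using assms by auto
    have "dist x (x /\<^sub>R norm x) = 1 - norm x"
      using nx x0 by (intro dist_normalize) auto
    moreover have "dist \<omega> ((1 - h / 4) *\<^sub>R \<omega>) = h / 4"
    proof -
      have "\<omega> - (1 - h / 4) *\<^sub>R \<omega> = (h / 4) *\<^sub>R \<omega>" by (simp add: algebra_simps)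
      then show ?thesis using assms by (simp add: dist_norm)
    qed
    ultimately have "dist \<omega> (x /\<^sub>R norm x) \<le> h"
      using dist_triangle[of \<omega> x "(1 - h / 4) *\<^sub>R \<omega>"] dist_triangle[of \<omega> "x /\<^sub>R norm x" x] nx x by simp
    then show "x \<in> G \<inter> ball 0 1" using nx x0 by (simp add: G_def cap_def)
  qed
  have "ennreal (unit_ball_vol ?n * (h / 4) ^ ?n) = emeasure lborel (ball ((1 - h / 4) *\<^sub>R \<omega>) (h / 4))"
    using assms by (simp add: emeasure_ball)
  also have "\<dots> = (\<integral>\<^sup>+x. indicator (ball ((1 - h / 4) *\<^sub>R \<omega>) (h / 4)) x \<partial>lborel)" by simp
  also have "\<dots> \<le> (\<integral>\<^sup>+x\<in>ball 0 1. indicator G x \<partial>lborel)"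
    using sub by (intro nn_integral_mono) (auto simp: indicator_def)
  also have "\<dots> = (\<integral>\<^sup>+\<omega>'. (\<integral>\<^sup>+t\<in>{0<..<1}. indicator G (t *\<^sub>R \<omega>') * ennreal (t ^ (?n - 1)) \<partial>lborel) \<partial>?\<sigma>)"
    by (rule nn_integral_polar) measurable
  also have "\<dots> \<le> (\<integral>\<^sup>+\<omega>'. ennreal (h / 2) * indicator (cap \<omega> h) \<omega>' \<partial>?\<sigma>)"
  proof (rule nn_integral_mono)
    fix \<omega>' :: 'a assume "\<omega>' \<in> space ?\<sigma>"
    then have \<omega>': "norm \<omega>' = 1" by simp
    have "(\<integral>\<^sup>+t\<in>{0<..<1}. indicator G (t *\<^sub>R \<omega>') * ennreal (t ^ (?n - 1)) \<partial>lborel) \<le>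
        (\<integral>\<^sup>+t. indicator (cap \<omega> h) \<omega>' * indicator {1 - h / 2..1} t \<partial>lborel)"
      using assms \<omega>'
      by (intro nn_integral_mono) (auto simp: indicator_def G_def power_le_one)
    also have "\<dots> = ennreal (h / 2) * indicator (cap \<omega> h) \<omega>'"
      using assms by (simp add: nn_integral_cmult_indicator mult.commute)
    finally show "(\<integral>\<^sup>+t\<in>{0<..<1}. indicator G (t *\<^sub>R \<omega>') * ennreal (t ^ (?n - 1)) \<partial>lborel) \<le> ennreal (h / 2) * indicator (cap \<omega> h) \<omega>'" .
  qed
  also have "\<dots> = emeasure ?\<sigma> (cap \<omega> h) * ennreal (h / 2)"
    by (subst nn_integral_cmult_indicator) (simp_all add: mult.commute)
  finally have le: "ennreal (unit_ball_vol ?n * (h / 4) ^ ?n) \<le> emeasure ?\<sigma> (cap \<omega> h) * ennreal (h / 2)" .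
  have fin: "emeasure ?\<sigma> (cap \<omega> h) \<noteq> \<infinity>"
    using finite_measure.emeasure_finite[OF finite_sphere_measure] by auto
  then obtain m where m: "emeasure ?\<sigma> (cap \<omega> h) = ennreal m" "m \<ge> 0"
    by (metis ennreal_cases infinity_ennreal_def)
  obtain k where k: "?n = Suc k" using DIM_positive[where 'a='a] by (metis Suc_pred)
  have "unit_ball_vol ?n * (h / 4) ^ Suc k \<le> m * (h / 2)"
    using le assms m by (simp add: k ennreal_mult'[symmetric])
  then have "(unit_ball_vol ?n * (h ^ k / 4 ^ Suc k)) * h \<le> (m / 2) * h" by (simp add: power_divide mult_ac)
  then have "unit_ball_vol ?n * (h ^ k / 4 ^ Suc k) \<le> m / 2" using assms mult_le_cancel_right_pos by blast
  also have "\<dots> \<le> m" using m by simp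
  finally show ?thesis using m by (simp add: k ennreal_leI)
qed

section \<open>Crossing dyadic shells\<close>

text \<open>A crude form of Young's inequality: beyond the threshold \<open>e\<close> the inserted
  factors \<open>x / e\<close> are at least 1. The free parameter \<open>e\<close> is fitted to the
  number of shells in \<open>crossing_estimate\<close>.\<close>

lemma young_power:
  fixes x e :: real
  assumes "0 \<le> x" "0 < e" "1 \<le> n"
  shows "x \<le> e + x ^ n / e ^ (n - 1)"
proof (cases "x \<le> e")
  case True
  then show ?thesis using assms by (simp add: add_increasing2)
next
  case False
  obtain k where k: "n = Suc k" using assms by (metis Suc_le_D One_nat_def)
  have "x * 1 \<le> x * (x / e) ^ k"
    using False assms by (intro mult_left_mono one_le_power) auto
  also have "\<dots> = x ^ n / e ^ (n - 1)" by (simp add: k power_divide)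
  finally show ?thesis using assms by simp
qed

text \<open>\<open>D\<close> stands for a distance along a ray and \<open>r\<close> for the density
  on it. No order of \<open>p\<close> and \<open>q\<close> is assumed, since both occur: the low
  value is taken at the outer radius in \<open>persistence\<close> and at the inner one in
  \<open>good_lambda\<close>.\<close>

lemma crossing_integral:
  fixes D r :: "real \<Rightarrow> real"
  assumes contD: "continuous_on {a..b} D" and contr: "continuous_on {a..b} r"
    and nn: "\<And>x. x \<in> {a..b} \<Longrightarrow> 0 \<le> r x"
    and inc: "\<And>x y. a \<le> x \<Longrightarrow> x \<le> y \<Longrightarrow> y \<le> b \<Longrightarrow> \<bar>D y - D x\<bar> \<le> integral {x..y} r"
    and pq: "p \<in> {a..b}" "q \<in> {a..b}" "D p \<le> s" "2 * s \<le> D q" and "0 < s"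
  shows "ennreal s \<le> (\<integral>\<^sup>+t\<in>{a..b}. ennreal (r t) * indicator {t. s \<le> D t \<and> D t < 2 * s} t \<partial>lborel)"
proof -
  \<comment> \<open>Among all pairs of a point below level s and a point above level 2 s take one at minimal
    distance; between them D stays strictly inside the shell, whatever their order.\<close>
  define K where "K = ({a..b} \<inter> D -` {..s}) \<times> ({a..b} \<inter> D -` {2 * s..})"
  have "closed ({a..b} \<inter> D -` {..s})" "closed ({a..b} \<inter> D -` {2 * s..})"
    by (intro continuous_closed_preimage contD closed_atLeastAtMost closed_atMost closed_atLeast)+
  then have "compact ({a..b} \<inter> ({a..b} \<inter> D -` {..s}))" "compact ({a..b} \<inter> ({a..b} \<inter> D -` {2 * s..}))"
    using compact_Int_closed[OF compact_Icc] by blast+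
  then have "compact K" unfolding K_def by (intro compact_Times) simp_all
  moreover have "K \<noteq> {}" using pq by (auto simp: K_def)
  moreover have "continuous_on K (\<lambda>z. \<bar>fst z - snd z\<bar>)" by (intro continuous_intros)
  ultimately obtain z where z: "z \<in> K" "\<And>w. w \<in> K \<Longrightarrow> \<bar>fst z - snd z\<bar> \<le> \<bar>fst w - snd w\<bar>"
    using continuous_attains_inf[of K "\<lambda>z. \<bar>fst z - snd z\<bar>"] by blast
  define x y where "x = min (fst z) (snd z)" and "y = max (fst z) (snd z)"
  have xy: "a \<le> x" "x \<le> y" "y \<le> b" using z(1) by (auto simp: x_def y_def K_def)
  have between: "s \<le> D u \<and> D u < 2 * s" if "u \<in> {x<..<y}" for u
  proof (rule ccontr)
    assume "\<not> ?thesis"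
    then have "(u, snd z) \<in> K \<or> (fst z, u) \<in> K"
      using z(1) that xy by (cases z) (auto simp: K_def)
    then have "\<bar>fst z - snd z\<bar> \<le> \<bar>u - snd z\<bar> \<or> \<bar>fst z - snd z\<bar> \<le> \<bar>fst z - u\<bar>"
      using z(2) by fastforce
    then show False using that by (auto simp: x_def y_def min_def max_def split: if_splits)
  qed
  have "s \<le> D (snd z) - D (fst z)" using z(1) by (auto simp: K_def)
  then have "s \<le> \<bar>D y - D x\<bar>" by (auto simp: x_def y_def min_def max_def)
  also have "\<dots> \<le> integral {x..y} r" using xy by (intro inc)
  finally have "ennreal s \<le> ennreal (integral {x..y} r)" by (rule ennreal_leI)
  also have "\<dots> = (\<integral>\<^sup>+t. ennreal (r t) * indicator {x..y} t \<partial>lborel)"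
  proof -
    have c: "continuous_on {x..y} r" using contr xy by (auto intro: continuous_on_subset)
    have "((\<lambda>t. r t * indicator {x..y} t) has_integral integral {x..y} r) UNIV"
      using integrable_integral[OF integrable_continuous_interval[OF c]]
      unfolding has_integral_restrict_UNIV[of "{x..y}" r, symmetric]
      by (rule has_integral_eq[rotated]) (auto simp: indicator_def)
    moreover have "(\<lambda>t. r t * indicator {x..y} t) \<in> borel_measurable borel"
      using borel_measurable_continuous_on_indicator[of "{x..y}" r] c by (simp add: mult.commute)
    ultimately have "(\<integral>\<^sup>+t. ennreal (r t * indicator {x..y} t) \<partial>lborel) = ennreal (integral {x..y} r)"
      using xy nn by (intro nn_integral_has_integral_lborel) (auto simp: indicator_def)
    moreover have "ennreal (r t * indicator {x..y} t) = ennreal (r t) * indicator {x..y} t" for t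
      by (simp add: indicator_def)
    ultimately show ?thesis by simp
  qed
  \<comment> \<open>At \<open>x\<close> and \<open>y\<close> themselves \<open>D\<close> may lie
    outside the half-open shell, so the integrands are compared only almost everywhere.\<close>
  also have "\<dots> \<le> (\<integral>\<^sup>+t\<in>{a..b}. ennreal (r t) * indicator {t. s \<le> D t \<and> D t < 2 * s} t \<partial>lborel)"
    using AE_lborel_singleton[of x] AE_lborel_singleton[of y]
  proof (intro nn_integral_mono_AE, eventually_elim)
    case (elim t)
    show ?case
      using elim between[of t] xy by (cases "t \<in> {x..y}") auto
  qed
  finally show ?thesis .
qed

context conf_density begin

text \<open>The density and its distances are controlled only on the ball, so measurability on the
  whole space is stated for their cut-offs.\<close>

lemma measurable_on_ball:
  fixes f :: "'a \<Rightarrow> real"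
  assumes "continuous_on (ball 0 1) f"
  shows "(\<lambda>x. indicator (ball 0 1) x * f x) \<in> borel_measurable borel"
  using borel_measurable_continuous_on_indicator[OF _ assms] by simp

lemma sets_ball_preimage:
  fixes f :: "'a \<Rightarrow> real"
  assumes "continuous_on (ball 0 1) f" and [measurable]: "Y \<in> sets borel"
  shows "{x \<in> ball 0 1. f x \<in> Y} \<in> sets borel"
proof -
  have [measurable]: "(\<lambda>x. indicator (ball 0 1) x * f x) \<in> borel_measurable borel"
    by (rule measurable_on_ball[OF assms(1)])
  have "{x \<in> ball 0 1. f x \<in> Y} = ball 0 1 \<inter> ((\<lambda>x. indicator (ball 0 1) x * f x) -` Y \<inter> space borel)"
    by auto
  also have "\<dots> \<in> sets borel" by (intro sets.Int measurable_sets[of _ borel borel]) auto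
  finally show ?thesis .
qed

definition shell :: "'a \<Rightarrow> real \<Rightarrow> 'a set" where
  "shell z s = {x \<in> ball 0 1. s \<le> d z x \<and> d z x < 2 * s}"

lemma shell_sets [measurable]:
  assumes "z \<in> ball 0 1"
  shows "shell z s \<in> sets borel"
proof -
  have "shell z s = {x \<in> ball 0 1. d z x \<in> {s..<2 * s}}" by (auto simp: shell_def)
  then show ?thesis using sets_ball_preimage[OF continuous_on_rho_dist[OF assms], of "{s..<2 * s}"] by simp
qed

lemma shell_subset_rho_ball: "shell z s \<subseteq> rho_ball \<rho> z (2 * s)"
  by (auto simp: shell_def rho_ball_def)

lemma volume_growthD:
  assumes "z \<in> ball 0 1" "0 < r"
  shows "(\<integral>\<^sup>+y\<in>rho_ball \<rho> z r. ennreal (\<rho> y ^ DIM('a)) \<partial>lborel) \<le> ennreal (B * r ^ DIM('a))"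
  using growth assms by (simp add: volume_growth_def)

lemma disjoint_shells:
  assumes "0 < s"
  shows "disjoint_family (\<lambda>i. shell z (2 ^ i * s))"
proof -
  have "shell z (2 ^ i * s) \<inter> shell z (2 ^ j * s) = {}" if "i < j" for i j :: nat
  proof -
    have "(2::real) * 2 ^ i \<le> 2 ^ j"
      using that power_increasing[of "Suc i" j "2::real"] by simp
    then have "2 * (2 ^ i * s) \<le> 2 ^ j * s" using assms by (simp flip: mult.assoc)
    then show ?thesis by (auto simp: shell_def)
  qed
  then show ?thesis unfolding disjoint_family_on_def by (metis inf_commute linorder_neqE_nat)
qed

lemma sets_rho_ball:
  assumes "z \<in> ball 0 1"
  shows "rho_ball \<rho> z r \<in> sets borel"
proof -
  have "rho_ball \<rho> z r = {x \<in> ball 0 1. d z x \<in> {..<r}}" by (auto simp: rho_ball_def)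
  also have "\<dots> \<in> sets borel"
    by (rule sets_ball_preimage[OF continuous_on_rho_dist[OF assms]]) simp
  finally show ?thesis .
qed

lemma measurable_rho_power:
  assumes [measurable]: "S \<in> sets borel" and "S \<subseteq> ball 0 1"
  shows "(\<lambda>x. ennreal (\<rho> x ^ k) * indicator S x) \<in> borel_measurable borel"
proof -
  have [measurable]: "(\<lambda>x. indicator (ball 0 1) x * \<rho> x) \<in> borel_measurable borel"
    by (rule measurable_on_ball[OF cont])
  have "(\<lambda>x. ennreal (\<rho> x ^ k) * indicator S x) =
      (\<lambda>x. ennreal ((indicator (ball 0 1) x * \<rho> x) ^ k) * indicator S x)"
    using assms by (auto simp: fun_eq_iff indicator_def)
  then show ?thesis by simp
qed

lemma rho_ball_subset: "rho_ball \<rho> z r \<subseteq> ball 0 1"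
  by (auto simp: rho_ball_def)

lemma continuous_on_radial:
  fixes f :: "'a \<Rightarrow> real"
  assumes "continuous_on (ball 0 1) f" "norm (\<omega>::'a) = 1" "0 \<le> a" "b < 1"
  shows "continuous_on {a..b} (\<lambda>t. f (t *\<^sub>R \<omega>))"
  by (intro continuous_on_compose2[OF assms(1)] continuous_intros) (use assms in auto)

lemma crossing_estimate:
  fixes E :: "'a set" and N :: nat
  assumes z: "z \<in> ball 0 1" and t: "1 / 2 \<le> t" "t \<le> R" "R < 1" and s: "0 < s" and N: "1 \<le> N"
    and E: "E \<in> sets sphere_measure"
    and cross: "\<And>\<omega>. \<omega> \<in> E \<Longrightarrow>
      \<exists>p\<in>{t..R}. \<exists>q\<in>{t..R}. d z (p *\<^sub>R \<omega>) \<le> s \<and> 2 ^ N * s \<le> d z (q *\<^sub>R \<omega>)"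
  shows "emeasure sphere_measure E \<le> ennreal (8 ^ DIM('a) * B * (1 - t) ^ (DIM('a) - 1) / N)"
proof -
  let ?\<sigma> = "sphere_measure :: 'a measure"
  define l where "l = 1 - t"
  \<comment> \<open>This makes \<open>e * l\<close> equal to \<open>N / 2\<close>: the constant
    terms of Young's inequality use up at most half of the N crossings. Within this limit
    \<open>e\<close> is taken as large as possible, since the remaining term carries the factor
    \<open>1 / e ^ (DIM('a) - 1)\<close>.\<close>
  define e where "e = N / (2 * l)"
  have l: "0 < l" using t by (simp add: l_def)
  have e: "0 < e" using N l by (simp add: e_def)
  define sh where "sh = (\<lambda>i::nat. shell z (2 ^ i * s))"
  have sh[measurable]: "sh i \<in> sets borel" for i using z by (simp add: sh_def)
  have disj: "disjoint_family_on sh {..<N}"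
    using disjoint_shells[OF s, of z] by (auto simp: sh_def disjoint_family_on_def)
  have pos': "0 < 2 ^ i * s" for i :: nat using s by simp
  \<comment> \<open>Dividing by the inner radius of the shell makes the estimate scale-free: volume
    growth on the ball of twice that radius bounds every integral of \<open>F i\<close> by
    \<open>B * 2 ^ DIM('a)\<close>.\<close>
  define F where "F = (\<lambda>i x. ennreal ((\<rho> x / (2 ^ i * s)) ^ DIM('a)) * indicator (sh i) x)"
  define G where "G = (\<lambda>x. \<Sum>i<N. F i x)"
  have F[measurable]: "F i \<in> borel_measurable borel" for i
  proof -
    have [measurable]: "(\<lambda>x. indicator (ball 0 1) x * \<rho> x) \<in> borel_measurable borel"
      by (rule measurable_on_ball[OF cont])
    have "F i = (\<lambda>x. ennreal ((indicator (ball 0 1) x * \<rho> x / (2 ^ i * s)) ^ DIM('a)) * indicator (sh i) x)"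
      by (auto simp: F_def fun_eq_iff indicator_def sh_def shell_def)
    then show ?thesis by simp
  qed
  have G[measurable]: "G \<in> borel_measurable borel" unfolding G_def by measurable
  have G_int: "(\<integral>\<^sup>+x\<in>ball 0 1. G x \<partial>lborel) \<le> ennreal (N * (B * 2 ^ DIM('a)))"
  proof -
    have "(\<integral>\<^sup>+x\<in>ball 0 1. G x \<partial>lborel) \<le> (\<integral>\<^sup>+x. G x \<partial>lborel)"
      by (intro nn_integral_mono) (auto simp: indicator_def)
    also have "\<dots> = (\<Sum>i<N. \<integral>\<^sup>+x. F i x \<partial>lborel)"
      unfolding G_def by (intro nn_integral_sum) simp
    also have "\<dots> \<le> (\<Sum>i<N. ennreal (B * 2 ^ DIM('a)))"
    proof (rule sum_mono)
      fix i
      let ?s = "2 ^ i * s"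
      have "(\<integral>\<^sup>+x. F i x \<partial>lborel) \<le>
          (\<integral>\<^sup>+x. ennreal (1 / ?s ^ DIM('a)) * (ennreal (\<rho> x ^ DIM('a)) * indicator (rho_ball \<rho> z (2 * ?s)) x) \<partial>lborel)"
      proof (rule nn_integral_mono)
        fix x
        show "F i x \<le> ennreal (1 / ?s ^ DIM('a)) * (ennreal (\<rho> x ^ DIM('a)) * indicator (rho_ball \<rho> z (2 * ?s)) x)"
        proof (cases "x \<in> sh i")
          case True
          then have "x \<in> ball 0 1" "x \<in> rho_ball \<rho> z (2 * ?s)"
            using shell_subset_rho_ball[of z ?s] by (auto simp: sh_def shell_def)
          then show ?thesis using pos[of x] pos'[of i]
            True
            by (auto simp: F_def power_divide simp flip: ennreal_mult' ennreal_mult'')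
        qed (simp add: F_def)
      qed
      also have "\<dots> = ennreal (1 / ?s ^ DIM('a)) * (\<integral>\<^sup>+x\<in>rho_ball \<rho> z (2 * ?s). ennreal (\<rho> x ^ DIM('a)) \<partial>lborel)"
        using measurable_rho_power[OF sets_rho_ball[OF z] rho_ball_subset]
        by (intro nn_integral_cmult) simp
      also have "\<dots> \<le> ennreal (1 / ?s ^ DIM('a)) * ennreal (B * (2 * ?s) ^ DIM('a))"
        using pos'[of i] by (intro mult_left_mono volume_growthD z) auto
      also have "\<dots> = ennreal (B * 2 ^ DIM('a))"
        using s B0 by (subst ennreal_mult[symmetric]) (auto simp: power_mult_distrib)
      finally show "(\<integral>\<^sup>+x. F i x \<partial>lborel) \<le> ennreal (B * 2 ^ DIM('a))" .
    qed
    also have "\<dots> = ennreal (N * (B * 2 ^ DIM('a)))"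
      using B0 by (simp add: ennreal_mult ennreal_of_nat_eq_real_of_nat)
    finally show ?thesis .
  qed
  have line: "ennreal (N / 2) \<le>
      ennreal (2 ^ (DIM('a) - 1) / e ^ (DIM('a) - 1)) * (\<integral>\<^sup>+\<tau>\<in>{0<..<1}. G (\<tau> *\<^sub>R \<omega>) * ennreal (\<tau> ^ (DIM('a) - 1)) \<partial>lborel)"
    if \<omega>E: "\<omega> \<in> E" for \<omega>
  proof -
    have \<omega>: "norm \<omega> = 1" using \<omega>E E by (auto simp: sets_sphere_measure_iff)
    obtain p q where pq: "p \<in> {t..R}" "q \<in> {t..R}" "d z (p *\<^sub>R \<omega>) \<le> s" "2 ^ N * s \<le> d z (q *\<^sub>R \<omega>)"
      using cross[OF \<omega>E] by blast
    have in_ball: "\<tau> *\<^sub>R \<omega> \<in> ball 0 1" if "\<tau> \<in> {t..R}" for \<tau>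
      using that t \<omega> by simp
    have ray[measurable]: "(\<lambda>\<tau>. \<tau> *\<^sub>R \<omega>) \<in> borel_measurable borel" by measurable
    have ray_measurable: "(\<lambda>\<tau>. ennreal (\<rho> (\<tau> *\<^sub>R \<omega>) / (2 ^ i * s)) * indicator (sh i) (\<tau> *\<^sub>R \<omega>) * indicator {t..R} \<tau>)
        \<in> borel_measurable borel" for i
    proof -
      have [measurable]: "(\<lambda>\<tau>. indicator {t..R} \<tau> * \<rho> (\<tau> *\<^sub>R \<omega>)) \<in> borel_measurable borel"
        using borel_measurable_continuous_on_indicator[of "{t..R}" "\<lambda>\<tau>. \<rho> (\<tau> *\<^sub>R \<omega>)"]
          continuous_on_radial[OF cont \<omega>, of t R] t by simp
      have [measurable]: "(\<lambda>\<tau>. indicator (sh i) (\<tau> *\<^sub>R \<omega>) :: ennreal) \<in> borel_measurable borel"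
        by (rule measurable_compose[OF ray]) simp
      have "(\<lambda>\<tau>. ennreal (\<rho> (\<tau> *\<^sub>R \<omega>) / (2 ^ i * s)) * indicator (sh i) (\<tau> *\<^sub>R \<omega>) * indicator {t..R} \<tau>) =
          (\<lambda>\<tau>. ennreal (indicator {t..R} \<tau> * \<rho> (\<tau> *\<^sub>R \<omega>) / (2 ^ i * s)) * indicator (sh i) (\<tau> *\<^sub>R \<omega>) * indicator {t..R} \<tau>)"
        by (auto simp: indicator_def fun_eq_iff)
      then show ?thesis by simp
    qed
    \<comment> \<open>Since the shells are disjoint, the constant term of Young's inequality contributes at most
      e (R - t), that is, at most half of the N crossings.\<close>
    define f1 where "f1 = (\<lambda>\<tau>. ennreal e * indicator {t..R} \<tau>)"
    define f2 where "f2 = (\<lambda>\<tau>. ennreal (1 / e ^ (DIM('a) - 1)) * (G (\<tau> *\<^sub>R \<omega>) * indicator {t..R} \<tau>))"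
    have "of_nat N = (\<Sum>i<N. 1 :: ennreal)" by simp
    also have "\<dots> \<le> (\<Sum>i<N. \<integral>\<^sup>+\<tau>. ennreal (\<rho> (\<tau> *\<^sub>R \<omega>) / (2 ^ i * s)) * indicator (sh i) (\<tau> *\<^sub>R \<omega>) * indicator {t..R} \<tau> \<partial>lborel)"
    proof (rule sum_mono)
      fix i assume i: "i \<in> {..<N}"
      let ?s = "2 ^ i * s"
      have le1: "s \<le> ?s" using s by simp
      have "(2::real) * 2 ^ i \<le> 2 ^ N"
        using i power_increasing[of "Suc i" N "2::real"] by simp
      then have le2: "2 * ?s \<le> 2 ^ N * s" using s by (simp flip: mult.assoc)
      have "ennreal ?s \<le> (\<integral>\<^sup>+\<tau>\<in>{t..R}. ennreal (\<rho> (\<tau> *\<^sub>R \<omega>)) *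
          indicator {\<tau>. ?s \<le> d z (\<tau> *\<^sub>R \<omega>) \<and> d z (\<tau> *\<^sub>R \<omega>) < 2 * ?s} \<tau> \<partial>lborel)"
      proof (rule crossing_integral[OF _ _ _ _ pq(1,2)])
        show "continuous_on {t..R} (\<lambda>\<tau>. d z (\<tau> *\<^sub>R \<omega>))" "continuous_on {t..R} (\<lambda>\<tau>. \<rho> (\<tau> *\<^sub>R \<omega>))"
          using t \<omega> by (intro continuous_on_radial continuous_on_rho_dist z cont; simp)+
        show "0 \<le> \<rho> (\<tau> *\<^sub>R \<omega>)" if "\<tau> \<in> {t..R}" for \<tau> using pos[OF in_ball[OF that]] by simp
        show "\<bar>d z (y *\<^sub>R \<omega>) - d z (x *\<^sub>R \<omega>)\<bar> \<le> integral {x..y} (\<lambda>\<tau>. \<rho> (\<tau> *\<^sub>R \<omega>))"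
          if "t \<le> x" "x \<le> y" "y \<le> R" for x y
          using that t \<omega> z by (intro rho_dist_radial) auto
      qed (use pq le1 le2 pos' in auto)
      also have "\<dots> = (\<integral>\<^sup>+\<tau>. ennreal ?s * (ennreal (\<rho> (\<tau> *\<^sub>R \<omega>) / ?s) * indicator (sh i) (\<tau> *\<^sub>R \<omega>) * indicator {t..R} \<tau>) \<partial>lborel)"
      proof (rule nn_integral_cong)
        fix \<tau>
        show "ennreal (\<rho> (\<tau> *\<^sub>R \<omega>)) * indicator {\<tau>. ?s \<le> d z (\<tau> *\<^sub>R \<omega>) \<and> d z (\<tau> *\<^sub>R \<omega>) < 2 * ?s} \<tau> * indicator {t..R} \<tau> =
            ennreal ?s * (ennreal (\<rho> (\<tau> *\<^sub>R \<omega>) / ?s) * indicator (sh i) (\<tau> *\<^sub>R \<omega>) * indicator {t..R} \<tau>)"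
        proof (cases "\<tau> \<in> {t..R}")
          case True
          have "ennreal ?s * ennreal (\<rho> (\<tau> *\<^sub>R \<omega>) / ?s) = ennreal (\<rho> (\<tau> *\<^sub>R \<omega>))"
            using pos'[of i] pos[OF in_ball[OF True]] by (subst ennreal_mult[symmetric]) auto
          then show ?thesis using in_ball[OF True] True
            by (simp add: sh_def shell_def indicator_def)
        qed simp
      qed
      also have "\<dots> = ennreal ?s * (\<integral>\<^sup>+\<tau>. ennreal (\<rho> (\<tau> *\<^sub>R \<omega>) / ?s) * indicator (sh i) (\<tau> *\<^sub>R \<omega>) * indicator {t..R} \<tau> \<partial>lborel)"
        using ray_measurable by (intro nn_integral_cmult) simp
      finally have "ennreal ?s * 1 \<le> ennreal ?s * (\<integral>\<^sup>+\<tau>. ennreal (\<rho> (\<tau> *\<^sub>R \<omega>) / ?s) * indicator (sh i) (\<tau> *\<^sub>R \<omega>) * indicator {t..R} \<tau> \<partial>lborel)"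
        by simp
      then show "1 \<le> (\<integral>\<^sup>+\<tau>. ennreal (\<rho> (\<tau> *\<^sub>R \<omega>) / ?s) * indicator (sh i) (\<tau> *\<^sub>R \<omega>) * indicator {t..R} \<tau> \<partial>lborel)"
        using pos'[of i] by (subst (asm) ennreal_mult_le_mult_iff) auto
    qed
    also have "\<dots> \<le> (\<integral>\<^sup>+\<tau>. (\<Sum>i<N. ennreal (\<rho> (\<tau> *\<^sub>R \<omega>) / (2 ^ i * s)) * indicator (sh i) (\<tau> *\<^sub>R \<omega>) * indicator {t..R} \<tau>) \<partial>lborel)"
      using ray_measurable by (intro eq_refl[OF nn_integral_sum[symmetric]]) simp
    also have "\<dots> \<le> (\<integral>\<^sup>+\<tau>. f1 \<tau> + f2 \<tau> \<partial>lborel)"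
    proof (rule nn_integral_mono)
      fix \<tau>
      show "(\<Sum>i<N. ennreal (\<rho> (\<tau> *\<^sub>R \<omega>) / (2 ^ i * s)) * indicator (sh i) (\<tau> *\<^sub>R \<omega>) * indicator {t..R} \<tau>) \<le> f1 \<tau> + f2 \<tau>"
      proof (cases "\<tau> \<in> {t..R}")
        case True
        let ?x = "\<tau> *\<^sub>R \<omega>"
        have \<rho>x: "0 < \<rho> ?x" using pos[OF in_ball[OF True]] .
        have "(\<Sum>i<N. ennreal (\<rho> ?x / (2 ^ i * s)) * indicator (sh i) ?x) \<le>
            (\<Sum>i<N. ennreal e * indicator (sh i) ?x + ennreal (1 / e ^ (DIM('a) - 1)) * F i ?x)"
        proof (rule sum_mono)
          fix i
          have "\<rho> ?x / (2 ^ i * s) \<le> e + (\<rho> ?x / (2 ^ i * s)) ^ DIM('a) / e ^ (DIM('a) - 1)"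
            using \<rho>x pos'[of i] e by (intro young_power) (auto simp: Suc_le_eq)
          then have "ennreal (\<rho> ?x / (2 ^ i * s)) \<le> ennreal (e + (\<rho> ?x / (2 ^ i * s)) ^ DIM('a) / e ^ (DIM('a) - 1))"
            by (rule ennreal_leI)
          also have "\<dots> = ennreal e + ennreal ((\<rho> ?x / (2 ^ i * s)) ^ DIM('a) / e ^ (DIM('a) - 1))"
            using \<rho>x pos'[of i] e by (intro ennreal_plus) auto
          also have "ennreal ((\<rho> ?x / (2 ^ i * s)) ^ DIM('a) / e ^ (DIM('a) - 1)) = ennreal (1 / e ^ (DIM('a) - 1)) * ennreal ((\<rho> ?x / (2 ^ i * s)) ^ DIM('a))"
            using \<rho>x pos'[of i] e by (subst ennreal_mult[symmetric]) auto
          finally show "ennreal (\<rho> ?x / (2 ^ i * s)) * indicator (sh i) ?x \<le> ennreal e * indicator (sh i) ?x + ennreal (1 / e ^ (DIM('a) - 1)) * F i ?x"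
            by (auto simp: F_def indicator_def)
        qed
        also have "\<dots> = ennreal e * (\<Sum>i<N. indicator (sh i) ?x) + ennreal (1 / e ^ (DIM('a) - 1)) * G ?x"
          by (simp add: sum.distrib sum_distrib_left G_def)
        also have "(\<Sum>i<N. indicator (sh i) ?x :: ennreal) = indicator (\<Union>i<N. sh i) ?x"
          using disj by (subst indicator_UN_disjoint) auto
        also have "ennreal e * indicator (\<Union>i<N. sh i) ?x \<le> ennreal e" by (auto simp: indicator_def)
        finally show ?thesis using True by (simp add: f1_def f2_def)
      qed simp
    qed
    also have "\<dots> = (\<integral>\<^sup>+\<tau>. f1 \<tau> \<partial>lborel) + (\<integral>\<^sup>+\<tau>. f2 \<tau> \<partial>lborel)"
      unfolding f1_def f2_def by (intro nn_integral_add) (auto intro!: borel_measurable_times_ennreal measurable_compose[OF ray])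
    also have "(\<integral>\<^sup>+\<tau>. f1 \<tau> \<partial>lborel) \<le> ennreal (N / 2)"
    proof -
      have "(\<integral>\<^sup>+\<tau>. f1 \<tau> \<partial>lborel) = ennreal (e * (R - t))"
        using t e unfolding f1_def by (subst nn_integral_cmult_indicator) (auto simp: ennreal_mult)
      also have "\<dots> \<le> ennreal (e * l)" using e t by (intro ennreal_leI mult_left_mono) (auto simp: l_def)
      also have "e * l = N / 2" using l by (simp add: e_def)
      finally show ?thesis .
    qed
    also have "of_nat N = ennreal (N / 2) + ennreal (N / 2)"
      by (simp flip: ennreal_plus add: ennreal_of_nat_eq_real_of_nat)
    finally have "ennreal (N / 2) \<le> (\<integral>\<^sup>+\<tau>. f2 \<tau> \<partial>lborel)" by simp
    also have "\<dots> \<le> (\<integral>\<^sup>+\<tau>. ennreal (2 ^ (DIM('a) - 1) / e ^ (DIM('a) - 1)) * (G (\<tau> *\<^sub>R \<omega>) * ennreal (\<tau> ^ (DIM('a) - 1)) * indicator {0<..<1} \<tau>) \<partial>lborel)"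
    proof (rule nn_integral_mono)
      fix \<tau>
      show "f2 \<tau> \<le> ennreal (2 ^ (DIM('a) - 1) / e ^ (DIM('a) - 1)) * (G (\<tau> *\<^sub>R \<omega>) * ennreal (\<tau> ^ (DIM('a) - 1)) * indicator {0<..<1} \<tau>)"
      proof (cases "\<tau> \<in> {t..R}")
        case True
        \<comment> \<open>All radii are at least 1 / 2, so inserting this factor supplies the
          Jacobian of polar coordinates.\<close>
        have "1 \<le> (2 * \<tau>) ^ (DIM('a) - 1)" using True t by (intro one_le_power) auto
        then have "1 / e ^ (DIM('a) - 1) \<le> (2 * \<tau>) ^ (DIM('a) - 1) / e ^ (DIM('a) - 1)" using e by (intro divide_right_mono) auto
        then have "ennreal (1 / e ^ (DIM('a) - 1)) \<le> ennreal (2 ^ (DIM('a) - 1) / e ^ (DIM('a) - 1) * \<tau> ^ (DIM('a) - 1))"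
          by (intro ennreal_leI) (simp add: power_mult_distrib)
        also have "\<dots> = ennreal (2 ^ (DIM('a) - 1) / e ^ (DIM('a) - 1)) * ennreal (\<tau> ^ (DIM('a) - 1))"
          using True t e by (intro ennreal_mult) auto
        finally have "ennreal (1 / e ^ (DIM('a) - 1)) * G (\<tau> *\<^sub>R \<omega>) \<le> ennreal (2 ^ (DIM('a) - 1) / e ^ (DIM('a) - 1)) * ennreal (\<tau> ^ (DIM('a) - 1)) * G (\<tau> *\<^sub>R \<omega>)"
          by (intro mult_right_mono) auto
        then show ?thesis using True t by (simp add: f2_def mult_ac)
      qed (simp add: f2_def)
    qed
    also have "\<dots> = ennreal (2 ^ (DIM('a) - 1) / e ^ (DIM('a) - 1)) * (\<integral>\<^sup>+\<tau>\<in>{0<..<1}. G (\<tau> *\<^sub>R \<omega>) * ennreal (\<tau> ^ (DIM('a) - 1)) \<partial>lborel)"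
      by (intro nn_integral_cmult) (auto intro!: borel_measurable_times_ennreal measurable_compose[OF ray])
    finally show ?thesis .
  qed
  let ?I = "\<lambda>\<omega>. \<integral>\<^sup>+\<tau>\<in>{0<..<1}. G (\<tau> *\<^sub>R \<omega>) * ennreal (\<tau> ^ (DIM('a) - 1)) \<partial>lborel"
  let ?k = "2 ^ (DIM('a) - 1) / e ^ (DIM('a) - 1)"
  have "ennreal (N / 2) * emeasure ?\<sigma> E = (\<integral>\<^sup>+\<omega>. ennreal (N / 2) * indicator E \<omega> \<partial>?\<sigma>)"
    using E by (simp add: nn_integral_cmult_indicator)
  also have "\<dots> \<le> (\<integral>\<^sup>+\<omega>. ennreal ?k * ?I \<omega> \<partial>?\<sigma>)"
    using line by (intro nn_integral_mono) (auto simp: indicator_def)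
  also have "\<dots> \<le> ennreal ?k * (\<integral>\<^sup>+\<omega>. ?I \<omega> \<partial>?\<sigma>)"
  proof (rule eq_refl[OF nn_integral_cmult])
    show "?I \<in> borel_measurable ?\<sigma>"
      using borel_measurable_radial_integral[OF G, of "\<lambda>\<tau>. ennreal (\<tau> ^ (DIM('a) - 1)) * indicator {0<..<1} \<tau>"]
      by (simp add: mult.assoc)
  qed
  also have "(\<integral>\<^sup>+\<omega>. ?I \<omega> \<partial>?\<sigma>) = (\<integral>\<^sup>+x\<in>ball 0 1. G x \<partial>lborel)"
    by (rule nn_integral_polar[OF G, symmetric])
  also have "ennreal ?k * (\<integral>\<^sup>+x\<in>ball 0 1. G x \<partial>lborel) \<le> ennreal ?k * ennreal (N * (B * 2 ^ DIM('a)))"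
    by (intro mult_left_mono G_int) simp
  also have "\<dots> = ennreal (?k * (N * (B * 2 ^ DIM('a))))"
    using e B0 by (intro ennreal_mult[symmetric]) auto
  finally have le: "ennreal (N / 2) * emeasure ?\<sigma> E \<le> ennreal (?k * (N * (B * 2 ^ DIM('a))))" .
  obtain m where m: "emeasure ?\<sigma> E = ennreal m" "m \<ge> 0"
    using finite_measure.emeasure_finite[OF finite_sphere_measure] by (metis ennreal_cases infinity_ennreal_def)
  have "N / 2 * m \<le> ?k * (N * (B * 2 ^ DIM('a)))"
    using le m e B0 by (simp flip: ennreal_mult')
  then have "(N / 2) * m \<le> (N / 2) * (2 * (?k * (B * 2 ^ DIM('a))))" by (simp add: mult_ac)
  then have "m \<le> 2 * (?k * (B * 2 ^ DIM('a)))"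
    using N by (subst (asm) mult_le_cancel_left_pos) auto
  also have "?k = 4 ^ (DIM('a) - 1) * l ^ (DIM('a) - 1) / N ^ (DIM('a) - 1)"
  proof -
    have "?k = (2 / e) ^ (DIM('a) - 1)" by (simp add: power_divide)
    also have "2 / e = 4 * l / N" by (simp add: e_def)
    finally show ?thesis by (simp add: power_divide power_mult_distrib)
  qed
  \<comment> \<open>Here \<open>dim2\<close> enters: the power \<open>N ^ (DIM('a) - 1)\<close>
    gained from the choice of \<open>e\<close> is at least \<open>N\<close>.\<close>
  also have "\<dots> \<le> 4 ^ (DIM('a) - 1) * l ^ (DIM('a) - 1) / N"
  proof -
    have "real N \<le> real N ^ (DIM('a) - 1)" using N dim2 by (intro self_le_power) auto
    then show ?thesis using N l by (intro divide_left_mono) auto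
  qed
  finally have "m \<le> 2 * (4 ^ (DIM('a) - 1) * l ^ (DIM('a) - 1) / N * (B * 2 ^ DIM('a)))" using B0 by simp
  also have "\<dots> = (2 * 4 ^ (DIM('a) - 1)) * 2 ^ DIM('a) * (B * l ^ (DIM('a) - 1) / N)" by simp
  also have "\<dots> \<le> 4 ^ DIM('a) * 2 ^ DIM('a) * (B * l ^ (DIM('a) - 1) / N)"
  proof -
    obtain k where "DIM('a) = Suc k" using dim2 by (cases "DIM('a)") auto
    then show ?thesis using B0 l by (intro mult_right_mono) auto
  qed
  also have "(4::real) ^ DIM('a) * 2 ^ DIM('a) = 8 ^ DIM('a)" by (simp flip: power_mult_distrib)
  finally show ?thesis using m by (simp add: l_def ennreal_leI mult.assoc)
qed

end

section \<open>Stopping points and caps\<close>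

context conf_density begin

text \<open>The constant makes \<open>5 * cap_const * (1 - t) = (1 - t) / (8 * A\<^sup>2)\<close>, so that moving a
  point within the fivefold cap changes \<^term>\<open>v\<close> by at most a quarter.\<close>

definition cap_const :: real where "cap_const = 1 / (40 * A ^ 2)"

lemma cap_const_bounds: "0 < cap_const" "cap_const \<le> 1 / 40"
  using A1 one_le_power[OF A1, of 2] by (auto simp: cap_const_def divide_simps)

definition cap_lower :: real where
  "cap_lower = unit_ball_vol DIM('a) / 4 ^ DIM('a) * cap_const ^ (DIM('a) - 1)"

lemma cap_lower_pos: "0 < cap_lower"
  using cap_const_bounds by (simp add: cap_lower_def)

definition cap_upper :: real where
  "cap_upper = 4 ^ DIM('a) * unit_ball_vol DIM('a) * (5 * cap_const) ^ (DIM('a) - 1)"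

lemma cap_upper_pos: "0 < cap_upper"
  using cap_const_bounds by (simp add: cap_upper_def)

lemma emeasure_small_cap_lower:
  assumes "norm (\<omega>::'a) = 1" "0 < l" "l \<le> 1"
  shows "ennreal (cap_lower * l ^ (DIM('a) - 1)) \<le> emeasure sphere_measure (cap \<omega> (cap_const * l))"
proof -
  have "cap_const * l \<le> 1 * 1" using assms cap_const_bounds by (intro mult_mono) auto
  then show ?thesis
    using emeasure_cap_lower[of \<omega> "cap_const * l"] assms cap_const_bounds
    by (simp add: cap_lower_def power_mult_distrib mult.assoc)
qed

lemma emeasure_large_cap_upper:
  assumes "norm (\<omega>::'a) = 1" "0 < l" "l \<le> 1"
  shows "emeasure sphere_measure (cap \<omega> (5 * cap_const * l)) \<le> ennreal (cap_upper * l ^ (DIM('a) - 1))"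
proof -
  have "5 * cap_const * l \<le> 1 / 8 * 1" using assms cap_const_bounds by (intro mult_mono) auto
  then show ?thesis
    using emeasure_cap_upper[of \<omega> "5 * cap_const * l"] assms cap_const_bounds
    by (simp add: cap_upper_def power_mult_distrib mult.assoc)
qed

text \<open>The fivefold cap moves a point by at most (1 - t) / 8, well inside its Harnack ball of
  radius (1 - t) / 2. The bound by \<rho> is the one that can be compared with a radial integral in
  \<open>good_lambda\<close>; the bound by \<open>v\<close> serves
  \<open>persistence\<close>.\<close>

lemma rho_dist_near:
  assumes \<omega>0: "norm (\<omega>0::'a) = 1" and t: "1 / 3 \<le> t" "t < 1" and \<omega>: "\<omega> \<in> cap \<omega>0 (5 * cap_const * (1 - t))"
  shows "t *\<^sub>R \<omega> \<in> ball (t *\<^sub>R \<omega>0) ((1 - norm (t *\<^sub>R \<omega>0)) / 2)"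
    and "d (t *\<^sub>R \<omega>0) (t *\<^sub>R \<omega>) \<le> \<rho> (t *\<^sub>R \<omega>0) * (1 - t) / (8 * A)"
    and "d (t *\<^sub>R \<omega>0) (t *\<^sub>R \<omega>) \<le> v (t *\<^sub>R \<omega>0) / 4"
proof -
  let ?x = "t *\<^sub>R \<omega>0" and ?y = "t *\<^sub>R \<omega>"
  have x: "?x \<in> ball 0 1" "norm ?x = t" using \<omega>0 t by auto
  have "dist ?x ?y = t * dist \<omega>0 \<omega>"
    using t by (simp add: dist_norm flip: scaleR_diff_right)
  also have "\<dots> \<le> 1 * (5 * cap_const * (1 - t))"
    using t \<omega> by (intro mult_mono) (auto simp: cap_def)
  finally have dist: "dist ?x ?y \<le> 5 * cap_const * (1 - t)" by simp
  also have "\<dots> \<le> 1 / 8 * (1 - t)" using t cap_const_bounds by (intro mult_right_mono) auto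
  also have "\<dots> < (1 - t) / 2" using t by simp
  finally show y: "?y \<in> ball ?x ((1 - norm ?x) / 2)" using x by simp
  have "d ?x ?y \<le> A * \<rho> ?x * dist ?x ?y" by (rule rho_dist_local[OF x(1) y])
  also have "\<dots> \<le> A * \<rho> ?x * (5 * cap_const * (1 - t))"
    using dist pos[OF x(1)] A1 by (intro mult_left_mono) auto
  also have "\<dots> = \<rho> ?x * (1 - t) / (8 * A)"
    using A1 by (simp add: cap_const_def power2_eq_square)
  finally show *: "d ?x ?y \<le> \<rho> ?x * (1 - t) / (8 * A)" .
  have "\<rho> ?x * (1 - t) \<le> 2 * A * v ?x" using rho_norm_lower[of ?x] x t by simp
  then have "\<rho> ?x * (1 - t) / (8 * A) \<le> v ?x / 4" using A1 by (simp add: divide_simps mult_ac)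
  with * show "d ?x ?y \<le> v ?x / 4" by (rule order_trans)
qed

lemma sets_sphere_radial:
  fixes f :: "'a \<Rightarrow> real"
  assumes "continuous_on (ball 0 1) f" "0 \<le> R" "R < 1" and [measurable]: "Y \<in> sets borel"
  shows "{\<omega> \<in> sphere 0 1. f (R *\<^sub>R \<omega>) \<in> Y} \<in> sets sphere_measure"
proof -
  have "{x \<in> ball 0 1. f x \<in> Y} \<in> sets borel" by (intro sets_ball_preimage assms)
  then have "(\<lambda>\<omega>. R *\<^sub>R \<omega>) -` {x \<in> ball 0 1. f x \<in> Y} \<inter> space borel \<in> sets borel"
    by (intro measurable_sets[of _ borel borel]) auto
  then have "sphere 0 1 \<inter> (\<lambda>\<omega>. R *\<^sub>R \<omega>) -` {x \<in> ball 0 1. f x \<in> Y} \<in> sets borel" by auto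
  also have "sphere 0 1 \<inter> (\<lambda>\<omega>. R *\<^sub>R \<omega>) -` {x \<in> ball 0 1. f x \<in> Y} = {\<omega> \<in> sphere 0 1. f (R *\<^sub>R \<omega>) \<in> Y}"
    using assms by auto
  finally show ?thesis by (auto simp: sets_sphere_measure_iff)
qed

definition superlevel :: "real \<Rightarrow> real \<Rightarrow> 'a set" where
  "superlevel R L = {\<omega> \<in> sphere 0 1. L \<le> v (R *\<^sub>R \<omega>)}"

lemma sets_superlevel: "0 \<le> R \<Longrightarrow> R < 1 \<Longrightarrow> superlevel R L \<in> sets sphere_measure"
  using sets_sphere_radial[OF continuous_on_rho_norm, of R "{L..}"] by (simp add: superlevel_def)

text \<open>With \<open>z = 0\<close>: a direction of the cap that loses the level would cross many shells around the
  origin on its way to the sphere of radius \<open>R\<close>.\<close>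

lemma persistence:
  obtains m :: nat where "\<And>\<omega>0 t R. norm (\<omega>0::'a) = 1 \<Longrightarrow> 9 / 10 \<le> t \<Longrightarrow> t \<le> R \<Longrightarrow> R < 1 \<Longrightarrow>
      ennreal (cap_lower / 2 * (1 - t) ^ (DIM('a) - 1)) \<le>
        emeasure sphere_measure (cap \<omega>0 (cap_const * (1 - t)) \<inter> superlevel R (v (t *\<^sub>R \<omega>0) / 2 ^ m))"
proof -
  \<comment> \<open>With this \<open>N\<close> the crossing estimate bounds the directions that lose
    the level by half of the lower bound for the cap.\<close>
  define N where "N = Suc (nat \<lceil>2 * (8 ^ DIM('a) * B) / cap_lower\<rceil>)"
  have "2 * (8 ^ DIM('a) * B) / cap_lower \<le> N" unfolding N_def by linarith
  then have N: "8 ^ DIM('a) * B / N \<le> cap_lower / 2" "1 \<le> N"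
    using cap_lower_pos by (auto simp: N_def divide_simps mult.commute)
  show thesis
  proof (rule that[of "Suc N"])
    fix \<omega>0 :: 'a and t R :: real
    assume \<omega>0: "norm \<omega>0 = 1" and t: "9 / 10 \<le> t" "t \<le> R" "R < 1"
    let ?\<sigma> = "sphere_measure :: 'a measure"
    interpret S: finite_measure ?\<sigma> by (rule finite_sphere_measure)
    let ?C = "cap \<omega>0 (cap_const * (1 - t))" and ?x = "t *\<^sub>R \<omega>0"
    \<comment> \<open>One factor 2 more than the N shells require: on the cap, \<open>v\<close> at
      radius \<open>t\<close> may drop to three quarters of \<open>v ?x\<close>, which still exceeds
      \<open>2 ^ N * s\<close>, that is, half of \<open>v ?x\<close>.\<close>
    define s where "s = v ?x / 2 ^ Suc N"
    have x: "?x \<in> ball 0 1" "norm ?x = t" using \<omega>0 t by auto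
    have "0 < \<rho> ?x * (1 - norm ?x)" using pos[OF x(1)] x t by simp
    also have "\<dots> \<le> 2 * A * v ?x" using x t by (intro rho_norm_lower) auto
    finally have v0: "0 < v ?x" using A1 by (simp add: zero_less_mult_iff)
    then have s0: "0 < s" by (simp add: s_def)
    have "cap_const * (1 - t) \<le> 5 * cap_const * (1 - t)" using t cap_const_bounds by simp
    then have sub: "?C \<subseteq> cap \<omega>0 (5 * cap_const * (1 - t))" by (auto simp: cap_def)
    define E where "E = ?C - superlevel R s"
    have E: "E \<in> sets ?\<sigma>" unfolding E_def using t by (intro sets.Diff cap_sets sets_superlevel) auto
    have "emeasure ?\<sigma> E \<le> ennreal (8 ^ DIM('a) * B * (1 - t) ^ (DIM('a) - 1) / N)"
    proof (rule crossing_estimate[of 0 t R s])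
      fix \<omega> assume \<omega>E: "\<omega> \<in> E"
      then have \<omega>: "norm \<omega> = 1" "\<omega> \<in> cap \<omega>0 (5 * cap_const * (1 - t))" "v (R *\<^sub>R \<omega>) < s"
        using subsetD[OF sub, of \<omega>] by (auto simp: E_def cap_def superlevel_def)
      have b: "t *\<^sub>R \<omega> \<in> ball 0 1" "R *\<^sub>R \<omega> \<in> ball 0 1" using \<omega> t by auto
      have "d ?x (t *\<^sub>R \<omega>) \<le> v ?x / 4" by (rule rho_dist_near(3)) (use \<omega>0 t \<omega> in auto)
      moreover have "v ?x \<le> d ?x (t *\<^sub>R \<omega>) + v (t *\<^sub>R \<omega>)"
        using x b unfolding rho_norm_def by (intro rho_dist_triangle) auto
      ultimately have "2 ^ N * s \<le> v (t *\<^sub>R \<omega>)" using v0 by (simp add: s_def)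
      then show "\<exists>p\<in>{t..R}. \<exists>q\<in>{t..R}. d 0 (p *\<^sub>R \<omega>) \<le> s \<and> 2 ^ N * s \<le> d 0 (q *\<^sub>R \<omega>)"
        using \<omega>(3) t rho_norm_sym[OF b(1)] rho_norm_sym[OF b(2)]
        by (intro bexI[of _ R] bexI[of _ t]) auto
    qed (use t s0 N E in auto)
    also have "8 ^ DIM('a) * B * (1 - t) ^ (DIM('a) - 1) / N = 8 ^ DIM('a) * B / N * (1 - t) ^ (DIM('a) - 1)"
      by simp
    also have "ennreal \<dots> \<le> ennreal (cap_lower / 2 * (1 - t) ^ (DIM('a) - 1))"
      using N t by (intro ennreal_leI mult_right_mono) auto
    finally have le: "emeasure ?\<sigma> E \<le> ennreal (cap_lower / 2 * (1 - t) ^ (DIM('a) - 1))" .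
    have "ennreal (cap_lower / 2 * (1 - t) ^ (DIM('a) - 1)) + ennreal (cap_lower / 2 * (1 - t) ^ (DIM('a) - 1)) =
        ennreal (cap_lower * (1 - t) ^ (DIM('a) - 1))"
      using cap_lower_pos t by (simp flip: ennreal_plus)
    also have "\<dots> \<le> emeasure ?\<sigma> ?C" using \<omega>0 t by (intro emeasure_small_cap_lower) auto
    also have "\<dots> = emeasure ?\<sigma> (?C \<inter> superlevel R s) + emeasure ?\<sigma> E"
    proof -
      have "?C = (?C \<inter> superlevel R s) \<union> E" by (auto simp: E_def)
      then show ?thesis
        using t E by (subst (1) \<open>?C = _\<close>, intro plus_emeasure[symmetric] sets.Int cap_sets sets_superlevel)
          (auto simp: E_def)
    qed
    also have "\<dots> \<le> emeasure ?\<sigma> (?C \<inter> superlevel R s) + ennreal (cap_lower / 2 * (1 - t) ^ (DIM('a) - 1))"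
      by (intro add_left_mono le)
    finally show "ennreal (cap_lower / 2 * (1 - t) ^ (DIM('a) - 1)) \<le>
        emeasure ?\<sigma> (?C \<inter> superlevel R (v ?x / 2 ^ Suc N))"
      by (simp add: s_def add.commute)
  qed
qed

section \<open>Selection of stopping points on a level set\<close>

lemma rho_norm_bounded:
  obtains L0 where "0 < L0" "\<And>y. norm (y::'a) \<le> 9 / 10 \<Longrightarrow> v y < L0"
proof -
  have "compact (v ` cball 0 (9 / 10))"
    by (intro compact_continuous_image continuous_on_subset[OF continuous_on_rho_norm] compact_cball) auto
  then have "bounded (v ` cball 0 (9 / 10))" by (rule compact_imp_bounded)
  then obtain b where "b > 0" "\<And>y. y \<in> cball 0 (9 / 10) \<Longrightarrow> norm (v y) \<le> b"
    unfolding bounded_pos by auto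
  then have "v y < b + 1" if "norm y \<le> 9 / 10" for y using that by (fastforce simp: abs_le_iff)
  then show thesis using \<open>b > 0\<close> by (intro that[of "b + 1"]) auto
qed

text \<open>\<open>F\<close> is a set of stopping points, and the boxes over their fivefold caps
  contain the set where \<open>v\<close> is at least \<open>L\<close>. Disjointness of the small
  caps is recorded only through its consequence in the last clause: their total size is paid for by
  a superlevel set at radius \<open>R\<close>.\<close>

definition cap_cover :: "nat \<Rightarrow> real \<Rightarrow> real \<Rightarrow> 'a set \<Rightarrow> bool" where
  "cap_cover m L R F \<longleftrightarrow> finite F \<and> (\<forall>x\<in>F. 9 / 10 \<le> norm x \<and> norm x \<le> R \<and> v x = L) \<and>
     (\<forall>y. norm y \<le> R \<and> L \<le> v y \<longrightarrow> (\<exists>x\<in>F.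
        y /\<^sub>R norm y \<in> cap (x /\<^sub>R norm x) (5 * cap_const * (1 - norm x)) \<and> 1 - norm y < 5 * (1 - norm x))) \<and>
     (\<Sum>x\<in>F. ennreal (cap_lower / 2 * (1 - norm x) ^ (DIM('a) - 1))) \<le> emeasure sphere_measure (superlevel R (L / 2 ^ m))"

text \<open>One exponent has to serve all levels and radii, because the estimates are later summed
  over dyadic levels and used uniformly in \<open>R\<close>.\<close>

definition covering_exponent :: "nat \<Rightarrow> bool" where
  "covering_exponent m \<longleftrightarrow> (\<forall>L R. (\<forall>y. norm (y::'a) \<le> 9 / 10 \<longrightarrow> v y < L) \<longrightarrow> 9 / 10 \<le> R \<longrightarrow> R < 1 \<longrightarrow>
     (\<exists>F. cap_cover m L R F))"

text \<open>All points of the level set within radius \<open>R\<close> are candidates, not only the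
  first ones on their rays. Vitali's lemma is applied to balls about their directions with radii
  proportional to \<open>1 - norm x\<close>; by persistence each of the disjoint caps claims its own
  share of the superlevel set, which bounds the sum of their sizes.\<close>

lemma covering: "\<exists>m. covering_exponent m"
proof -
  obtain m where m: "\<And>\<omega>0 t R. norm (\<omega>0::'a) = 1 \<Longrightarrow> 9 / 10 \<le> t \<Longrightarrow> t \<le> R \<Longrightarrow> R < 1 \<Longrightarrow>
      ennreal (cap_lower / 2 * (1 - t) ^ (DIM('a) - 1)) \<le>
        emeasure sphere_measure (cap \<omega>0 (cap_const * (1 - t)) \<inter> superlevel R (v (t *\<^sub>R \<omega>0) / 2 ^ m))"
    using persistence by blast
  show ?thesis
  proof (intro exI[of _ m], unfold covering_exponent_def, intro allI impI)
    fix L R :: real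
    assume *: "\<forall>y. norm (y::'a) \<le> 9 / 10 \<longrightarrow> v y < L" and R: "9 / 10 \<le> R" "R < 1"
    have small: "v y < L" if "norm y \<le> 9 / 10" for y using * that by blast
    let ?\<sigma> = "sphere_measure :: 'a measure"
    interpret S: finite_measure ?\<sigma> by (rule finite_sphere_measure)
    define K where "K = {x::'a. norm x \<le> R \<and> v x = L}"
    have K: "9 / 10 < norm x" "norm x \<le> R" "v x = L" "x \<noteq> 0" if "x \<in> K" for x
      using that small[of x] by (force simp: K_def)+
    define a where "a = (\<lambda>x::'a. x /\<^sub>R norm x)"
    define r where "r = (\<lambda>x::'a. cap_const * (1 - norm x))"
    have a1: "norm (a x) = 1" "norm x *\<^sub>R a x = x" if "x \<in> K" for x
      using K(4)[OF that] by (auto simp: a_def)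
    have r: "0 < r x \<and> r x \<le> cap_const" if "x \<in> K" for x
      using K[OF that] R cap_const_bounds by (auto simp: r_def)
    obtain C where "countable C" and C: "C \<subseteq> K" "pairwise (\<lambda>i j. disjnt (cball (a i) (r i)) (cball (a j) (r j))) C"
      and cov: "\<And>i. i \<in> K \<Longrightarrow> \<exists>j. j \<in> C \<and> \<not> disjnt (cball (a i) (r i)) (cball (a j) (r j)) \<and>
                        cball (a i) (r i) \<subseteq> ball (a j) (5 * r j)"
      by (rule Vitali_covering_lemma_cballs_balls[OF r, where a = a]) (assumption | rule that)+
    let ?w = "\<lambda>x::'a. cap_lower / 2 * (1 - norm x) ^ (DIM('a) - 1)"
    let ?G = "superlevel R (L / 2 ^ m)"
    have G: "?G \<in> sets ?\<sigma>" using R by (intro sets_superlevel) auto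
    have sum_le: "(\<Sum>x\<in>F. ennreal (?w x)) \<le> emeasure ?\<sigma> ?G" if F: "finite F" "F \<subseteq> C" for F
    proof -
      have "(\<Sum>x\<in>F. ennreal (?w x)) \<le> (\<Sum>x\<in>F. emeasure ?\<sigma> (cap (a x) (r x) \<inter> ?G))"
      proof (rule sum_mono)
        fix x assume "x \<in> F"
        then have x: "x \<in> K" using F C by auto
        show "ennreal (?w x) \<le> emeasure ?\<sigma> (cap (a x) (r x) \<inter> ?G)"
          using m[of "a x" "norm x" R] K[OF x] a1[OF x] R by (simp add: r_def)
      qed
      also have "\<dots> = emeasure ?\<sigma> (\<Union>x\<in>F. cap (a x) (r x) \<inter> ?G)"
      proof (rule sum_emeasure)
        show "disjoint_family_on (\<lambda>x. cap (a x) (r x) \<inter> ?G) F"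
          using C(2) F(2) by (auto simp: disjoint_family_on_def pairwise_def disjnt_def cap_def subset_iff)
      qed (use F G in auto)
      also have "\<dots> \<le> emeasure ?\<sigma> ?G" using G by (intro emeasure_mono) auto
      finally show ?thesis .
    qed
    \<comment> \<open>Points of \<open>K\<close> have norm at most \<open>R\<close>, so every
      selected cap claims at least the fixed share \<open>w0\<close> of a finite measure.\<close>
    have finC: "finite C"
    proof -
      define w0 where "w0 = cap_lower / 2 * (1 - R) ^ (DIM('a) - 1)"
      have w0: "0 < w0" using cap_lower_pos R by (simp add: w0_def)
      obtain M where M: "emeasure ?\<sigma> ?G = ennreal M" "M \<ge> 0"
        using S.emeasure_finite by (metis ennreal_cases infinity_ennreal_def)
      have "card F \<le> nat \<lfloor>M / w0\<rfloor>" if F: "F \<subseteq> C" "finite F" for F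
      proof -
        have "ennreal (card F * w0) = (\<Sum>x\<in>F. ennreal w0)"
          using w0 by (simp add: ennreal_mult ennreal_of_nat_eq_real_of_nat)
        also have "\<dots> \<le> (\<Sum>x\<in>F. ennreal (?w x))"
        proof (rule sum_mono)
          fix x assume "x \<in> F"
          then have x: "x \<in> K" using F C by auto
          show "ennreal w0 \<le> ennreal (?w x)"
            unfolding w0_def using K[OF x] R cap_lower_pos
            by (intro ennreal_leI mult_left_mono power_mono) auto
        qed
        also have "\<dots> \<le> ennreal M" using sum_le[OF F(2,1)] M by simp
        finally have "card F * w0 \<le> M" using M by simp
        then have "card F \<le> M / w0" using w0 by (simp add: pos_le_divide_eq)
        then show ?thesis by linarith
      qed
      then show ?thesis by (intro conjunct1[OF finite_if_finite_subsets_card_bdd]) blast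
    qed
    have "\<exists>x\<in>C. y /\<^sub>R norm y \<in> cap (x /\<^sub>R norm x) (5 * cap_const * (1 - norm x)) \<and> 1 - norm y < 5 * (1 - norm x)"
      if y: "norm y \<le> R" "L \<le> v y" for y
    proof -
      define \<omega> where "\<omega> = y /\<^sub>R norm y"
      have y9: "9 / 10 < norm y" using small[of y] y by (cases "norm y \<le> 9 / 10") auto
      then have y0: "y \<noteq> 0" by auto
      have \<omega>: "norm \<omega> = 1" "norm y *\<^sub>R \<omega> = y" using y0 by (auto simp: \<omega>_def)
      have "v ((9 / 10) *\<^sub>R \<omega>) \<le> L" using small[of "(9/10) *\<^sub>R \<omega>"] \<omega> by simp
      moreover have "continuous_on {9 / 10..norm y} (\<lambda>t. v (t *\<^sub>R \<omega>))"
        using \<omega> y R by (intro continuous_on_radial continuous_on_rho_norm) auto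
      \<comment> \<open>On the way to \<open>y\<close> the ray takes the value \<open>L\<close>. A
        box that captures the point where this happens also captures \<open>y\<close>, which has the
        same direction and is at least as close to the sphere.\<close>
      ultimately obtain t where t: "9 / 10 \<le> t" "t \<le> norm y" "v (t *\<^sub>R \<omega>) = L"
        using IVT'[of "\<lambda>t. v (t *\<^sub>R \<omega>)" "9 / 10" L "norm y"] y y9 \<omega> by auto
      let ?x = "t *\<^sub>R \<omega>"
      have x: "?x \<in> K" "norm ?x = t" "a ?x = \<omega>" using t \<omega> y by (auto simp: K_def a_def)
      obtain j where j: "j \<in> C" "cball (a ?x) (r ?x) \<subseteq> ball (a j) (5 * r j)"
        using cov[OF x(1)] by blast
      \<comment> \<open>The enlarged ball contains the whole small ball and not only its centre, so
        it yields a comparison of heights together with that of directions.\<close>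
      then have "dist (a ?x) (a j) + r ?x < 5 * r j"
        using r[OF x(1)] by (simp add: cball_subset_ball_iff)
      then have le: "dist (a j) \<omega> < 5 * r j" "r ?x < 5 * r j"
        using r[OF x(1)] zero_le_dist[of "a ?x" "a j"] unfolding x(3) dist_commute[of "a j"]
        by linarith+
      have "cap_const * (1 - t) < cap_const * (5 * (1 - norm j))"
        using le(2) unfolding r_def x(2) by (simp only: mult_ac)
      then have "1 - t < 5 * (1 - norm j)" using cap_const_bounds by (subst (asm) mult_less_cancel_left_pos)
      then show ?thesis
        using j(1) le(1) t \<omega> by (intro bexI[of _ j]) (auto simp: cap_def \<omega>_def[symmetric] a_def r_def)
    qed
    then show "\<exists>F. cap_cover m L R F" unfolding cap_cover_def
      using finC C(1) sum_le[OF finC order_refl] K by (intro exI[of _ C] conjI) (auto intro: less_imp_le)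
  qed
qed

end

section \<open>Integrals over boxes and dyadic sums\<close>

text \<open>Young's inequality for the conjugate exponents n / q and n / (n - q), with constants 1.
  The dichotomy is whether Y^(q-1) is dominated by X^(n-q); if not, X is bounded by a power of Y and
  the exponents of Y add up to (q - 1) n / (n - q).\<close>

lemma young_powr:
  fixes X Y q n :: real
  assumes "0 < X" "0 < Y" "0 < q" "q < n"
  shows "X powr q * Y powr (q - 1) \<le> X powr n + Y powr ((q - 1) * n / (n - q))"
proof (cases "Y powr (q - 1) \<le> X powr (n - q)")
  case True
  have "X powr q * Y powr (q - 1) \<le> X powr q * X powr (n - q)"
    using True by (intro mult_left_mono) auto
  also have "\<dots> = X powr n" by (simp flip: powr_add)
  finally show ?thesis by (simp add: add_increasing2)
next
  case False
  then have "(X powr (n - q)) powr (q / (n - q)) \<le> (Y powr (q - 1)) powr (q / (n - q))"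
    using assms by (intro powr_mono2) auto
  then have "X powr q \<le> Y powr ((q - 1) * (q / (n - q)))"
    using assms by (simp add: powr_powr)
  then have "X powr q * Y powr (q - 1) \<le> Y powr ((q - 1) * (q / (n - q))) * Y powr (q - 1)"
    by (intro mult_right_mono) auto
  also have "\<dots> = Y powr ((q - 1) * (q / (n - q)) + (q - 1))" by (simp add: powr_add)
  also have "(q - 1) * (q / (n - q)) + (q - 1) = (q - 1) * n / (n - q)"
    using assms by (simp add: field_simps)
  finally show ?thesis by (simp add: add_increasing)
qed

lemma nn_integral_powr_finite:
  fixes \<beta> :: real
  assumes "\<beta> < 1"
  shows "(\<integral>\<^sup>+u\<in>{0<..<5}. ennreal (u powr - \<beta>) \<partial>lborel) \<le> ennreal (5 powr (1 - \<beta>) / (1 - \<beta>))"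
proof -
  have "((\<lambda>u. u powr - \<beta>) has_integral (5 powr (- \<beta> + 1) / (- \<beta> + 1))) {0..5}"
    using assms by (intro has_integral_powr_from_0) auto
  then have "((\<lambda>u. if u \<in> {0..5} then u powr - \<beta> else 0) has_integral (5 powr (1 - \<beta>) / (1 - \<beta>))) UNIV"
    by (subst has_integral_restrict_UNIV) (simp add: algebra_simps)
  then have "(\<integral>\<^sup>+u. ennreal (if u \<in> {0..5} then u powr - \<beta> else 0) \<partial>lborel) = ennreal (5 powr (1 - \<beta>) / (1 - \<beta>))"
    by (intro nn_integral_has_integral_lborel) auto
  moreover have "(\<integral>\<^sup>+u\<in>{0<..<5}. ennreal (u powr - \<beta>) \<partial>lborel) \<le>
      (\<integral>\<^sup>+u. ennreal (if u \<in> {0..5} then u powr - \<beta> else 0) \<partial>lborel)"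
    by (intro nn_integral_mono) (auto simp: indicator_def)
  ultimately show ?thesis by simp
qed

text \<open>The substitution t = 1 - l u removes \<open>l\<close> from the integral. The 5 is the
  height of a box in units of \<open>l\<close> and goes back to the enlargement factor in Vitali's
  lemma.\<close>

lemma nn_integral_weight:
  fixes \<beta> l :: real
  assumes "\<beta> < 1" "0 < l"
  shows "(\<integral>\<^sup>+t\<in>{1 - 5 * l<..<1}. ennreal (((1 - t) / l) powr - \<beta>) \<partial>lborel) \<le> ennreal (l * (5 powr (1 - \<beta>) / (1 - \<beta>)))"
proof -
  have "(\<integral>\<^sup>+t\<in>{1 - 5 * l<..<1}. ennreal (((1 - t) / l) powr - \<beta>) \<partial>lborel) =
      ennreal \<bar>- l\<bar> * (\<integral>\<^sup>+u. ennreal (((1 - (1 + - l * u)) / l) powr - \<beta>) * indicator {1 - 5 * l<..<1} (1 + - l * u) \<partial>lborel)"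
    using assms by (intro nn_integral_real_affine) auto
  also have "\<dots> = ennreal l * (\<integral>\<^sup>+u\<in>{0<..<5}. ennreal (u powr - \<beta>) \<partial>lborel)"
    using assms by (intro arg_cong2[where f = "(*)"] nn_integral_cong)
      (auto simp: indicator_def zero_less_mult_iff)
  also have "\<dots> \<le> ennreal l * ennreal (5 powr (1 - \<beta>) / (1 - \<beta>))"
    by (intro mult_left_mono nn_integral_powr_finite assms) auto
  also have "\<dots> = ennreal (l * (5 powr (1 - \<beta>) / (1 - \<beta>)))"
    using assms by (intro ennreal_mult[symmetric]) auto
  finally show ?thesis .
qed

section \<open>Dyadic sums as a discrete layer-cake formula\<close>

definition dyadic_const :: "real \<Rightarrow> real" where
  "dyadic_const p = 1 / (1 - 2 powr - p)"

lemma dyadic_const_pos: "0 < p \<Longrightarrow> 0 < dyadic_const p"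
  by (simp add: dyadic_const_def powr_minus divide_simps)

text \<open>Only an initial segment of the indices counts, and a geometric progression is bounded by
  its last term up to the factor \<open>dyadic_const p\<close>, which is the sum of all 2^(-j
  p).\<close>

lemma dyadic_sum_le:
  fixes L u p :: real
  assumes "0 < L" "0 < p"
  shows "(\<Sum>j<k. (2 ^ j * L) powr p * of_bool (2 ^ j * L \<le> u)) \<le> dyadic_const p * u powr p"
proof -
  \<comment> \<open>The recursion of the geometric series; it carries the induction for
    \<open>geo\<close>.\<close>
  have c: "dyadic_const p * 2 powr - p + 1 = dyadic_const p"
    using assms by (simp add: dyadic_const_def powr_minus divide_simps)
  have geo: "(\<Sum>j<Suc k. (2 ^ j * L) powr p) \<le> dyadic_const p * (2 ^ k * L) powr p" for k
  proof (induction k)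
    case 0
    have "0 \<le> dyadic_const p * 2 powr - p" using dyadic_const_pos[OF assms(2)] by simp
    then have "1 \<le> dyadic_const p" using c by linarith
    then have "1 * L powr p \<le> dyadic_const p * L powr p" by (intro mult_right_mono) auto
    then show ?case by simp
  next
    case (Suc k)
    have "(2 ^ k * L) powr p = (2 ^ Suc k * L / 2) powr p" by simp
    also have "\<dots> = (2 ^ Suc k * L) powr p * 2 powr - p"
      using assms by (subst powr_divide) (auto simp: powr_minus divide_inverse)
    finally have "(\<Sum>j<Suc (Suc k). (2 ^ j * L) powr p) \<le>
        dyadic_const p * ((2 ^ Suc k * L) powr p * 2 powr - p) + (2 ^ Suc k * L) powr p"
      using Suc.IH by simp
    also have "\<dots> = (dyadic_const p * 2 powr - p + 1) * (2 ^ Suc k * L) powr p"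
      by (simp add: algebra_simps)
    finally show ?case unfolding c .
  qed
  show ?thesis
  proof (induction k)
    case 0
    then show ?case using dyadic_const_pos[OF assms(2)] by simp
  next
    case (Suc k)
    show ?case
    proof (cases "2 ^ k * L \<le> u")
      case True
      have "(\<Sum>j<Suc k. (2 ^ j * L) powr p * of_bool (2 ^ j * L \<le> u)) \<le> (\<Sum>j<Suc k. (2 ^ j * L) powr p)"
        by (intro sum_mono) auto
      also have "\<dots> \<le> dyadic_const p * (2 ^ k * L) powr p" by (rule geo)
      also have "\<dots> \<le> dyadic_const p * u powr p"
        using True assms dyadic_const_pos[OF assms(2)] by (intro mult_left_mono powr_mono2) auto
      finally show ?thesis .
    next
      case False
      then show ?thesis using Suc.IH by simp
    qed
  qed
qed

lemma dyadic_suminf_le: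
  fixes L u p :: real
  assumes "0 < L" "0 < p"
  shows "(\<Sum>j. ennreal ((2 ^ j * L) powr p) * of_bool (2 ^ j * L \<le> u)) \<le> ennreal (dyadic_const p * u powr p)"
proof -
  have "(\<Sum>j<k. ennreal ((2 ^ j * L) powr p) * of_bool (2 ^ j * L \<le> u)) \<le> ennreal (dyadic_const p * u powr p)" for k
  proof -
    have "(\<Sum>j<k. ennreal ((2 ^ j * L) powr p) * of_bool (2 ^ j * L \<le> u)) =
        (\<Sum>j<k. ennreal ((2 ^ j * L) powr p * of_bool (2 ^ j * L \<le> u)))"
      by (intro sum.cong) auto
    also have "\<dots> = ennreal (\<Sum>j<k. (2 ^ j * L) powr p * of_bool (2 ^ j * L \<le> u))"
      by (intro sum_ennreal) auto
    also have "\<dots> \<le> ennreal (dyadic_const p * u powr p)" by (intro ennreal_leI dyadic_sum_le assms)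
    finally show ?thesis .
  qed
  then show ?thesis by (simp add: suminf_eq_SUP SUP_le_iff)
qed

text \<open>\<open>I\<close> is extended-valued because it will be a multiple of a radial integral,
  which may be infinite in some directions. For finite \<open>I\<close>, taking p-th roots reduces
  the condition to the one in \<open>dyadic_suminf_le\<close>.\<close>

lemma dyadic_suminf_ennreal:
  fixes c L p :: real and I :: ennreal
  assumes "0 < c" "0 < L" "0 < p"
  shows "(\<Sum>j. ennreal ((2 ^ j * L) powr p) * of_bool (ennreal ((c * (2 ^ j * L)) powr p) \<le> I))
    \<le> ennreal (dyadic_const p / c powr p) * I"
proof (cases I)
  case (real i)
  define u where "u = i powr (1 / p) / c"
  have "(c * (2 ^ j * L)) powr p \<le> i \<longleftrightarrow> 2 ^ j * L \<le> u" for j :: nat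
  proof -
    have i: "i = (i powr (1 / p)) powr p" using real assms by (simp add: powr_powr)
    have "(c * (2 ^ j * L)) powr p \<le> i \<longleftrightarrow> c * (2 ^ j * L) \<le> i powr (1 / p)"
    proof
      assume "(c * (2 ^ j * L)) powr p \<le> i"
      then have "((c * (2 ^ j * L)) powr p) powr (1 / p) \<le> i powr (1 / p)"
        using assms by (intro powr_mono2) auto
      then show "c * (2 ^ j * L) \<le> i powr (1 / p)" using assms by (simp add: powr_powr)
    next
      assume "c * (2 ^ j * L) \<le> i powr (1 / p)"
      then have "(c * (2 ^ j * L)) powr p \<le> (i powr (1 / p)) powr p"
        using assms by (intro powr_mono2) auto
      then show "(c * (2 ^ j * L)) powr p \<le> i" unfolding i[symmetric] .
    qed
    then show ?thesis using assms by (simp add: u_def pos_le_divide_eq mult.commute)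
  qed
  then have "(\<Sum>j. ennreal ((2 ^ j * L) powr p) * of_bool (ennreal ((c * (2 ^ j * L)) powr p) \<le> I)) =
      (\<Sum>j. ennreal ((2 ^ j * L) powr p) * of_bool (2 ^ j * L \<le> u))"
    using real by simp
  also have "\<dots> \<le> ennreal (dyadic_const p * u powr p)" by (intro dyadic_suminf_le assms)
  also have "dyadic_const p * u powr p = dyadic_const p / c powr p * i"
    using real assms by (simp add: u_def powr_divide powr_powr)
  also have "ennreal \<dots> = ennreal (dyadic_const p / c powr p) * I"
    unfolding real(2) using real(1) dyadic_const_pos[OF assms(3)] by (intro ennreal_mult) auto
  finally show ?thesis .
next
  case top
  then show ?thesis using assms dyadic_const_pos[OF assms(3)] by (simp add: ennreal_mult_top)
qed

lemma dyadic_interval: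
  fixes L u :: real
  assumes "0 < L" "L \<le> u"
  obtains j :: nat where "2 ^ j * L \<le> u" "u < 2 * (2 ^ j * L)"
proof -
  obtain k :: nat where "u / L < 2 ^ k" using real_arch_pow[of 2 "u / L"] by auto
  then have k: "u < 2 ^ k * L" using assms by (simp add: pos_divide_less_eq)
  define j where "j = (LEAST k. u < 2 ^ k * L)"
  have j: "u < 2 ^ j * L" unfolding j_def using k by (rule LeastI)
  then obtain i where i: "j = Suc i" using assms by (cases j) auto
  have "\<not> u < 2 ^ i * L" using not_less_Least[of i "\<lambda>k. u < 2 ^ k * L"] i by (simp add: j_def)
  then show thesis using j i by (intro that[of i]) auto
qed

lemma term_le_suminf:
  fixes f :: "nat \<Rightarrow> ennreal"
  shows "f j \<le> (\<Sum>j. f j)"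
  using sum_le_suminf[of f "{j}"] by simp

text \<open>Reverse of \<open>dyadic_suminf_le\<close>: the single term whose dyadic interval
  contains \<open>u\<close> suffices, at the price of \<open>2 powr p\<close>. Values below
  \<open>L\<close> are absorbed by the extra summand.\<close>

lemma le_dyadic_suminf:
  fixes L u p :: real
  assumes "0 < L" "0 < p" "0 \<le> u"
  shows "ennreal (u powr p) \<le> ennreal (L powr p) + ennreal (2 powr p) * (\<Sum>j. ennreal ((2 ^ j * L) powr p) * of_bool (2 ^ j * L \<le> u))"
proof (cases "L \<le> u")
  case False
  then have "ennreal (u powr p) \<le> ennreal (L powr p)" using assms by (intro ennreal_leI powr_mono2) auto
  then show ?thesis by (simp add: add_increasing2)
next
  case True
  obtain j :: nat where j: "2 ^ j * L \<le> u" "u < 2 * (2 ^ j * L)"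
    using dyadic_interval[OF assms(1) True] by blast
  have "u powr p \<le> (2 * (2 ^ j * L)) powr p" using j assms by (intro powr_mono2) auto
  also have "\<dots> = 2 powr p * (2 ^ j * L) powr p" using assms by (subst powr_mult) auto
  finally have "ennreal (u powr p) \<le> ennreal (2 powr p * (2 ^ j * L) powr p)" by (rule ennreal_leI)
  also have "\<dots> = ennreal (2 powr p) * ennreal ((2 ^ j * L) powr p)" by (intro ennreal_mult) auto
  also have "\<dots> \<le> ennreal (2 powr p) * (\<Sum>j. ennreal ((2 ^ j * L) powr p) * of_bool (2 ^ j * L \<le> u))"
    using j(1) term_le_suminf[of "\<lambda>j. ennreal ((2 ^ j * L) powr p) * of_bool (2 ^ j * L \<le> u)" j]
    by (intro mult_left_mono) auto
  finally show ?thesis by (simp add: add_increasing)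
qed

section \<open>Volume integrals over boxes\<close>

context conf_density begin

definition weight :: "real \<Rightarrow> 'a \<Rightarrow> ennreal" where
  "weight p x = ennreal (\<rho> x powr p * (1 - norm x) powr (p - 1)) * indicator (ball 0 1) x"

lemma weight_measurable [measurable]: "weight p \<in> borel_measurable borel"
proof -
  have [measurable]: "(\<lambda>x. indicator (ball 0 1) x * \<rho> x) \<in> borel_measurable borel"
    by (rule measurable_on_ball[OF cont])
  have "weight p = (\<lambda>x. ennreal ((indicator (ball 0 1) x * \<rho> x) powr p * (1 - norm x) powr (p - 1)) * indicator (ball 0 1) x)"
    by (auto simp: weight_def fun_eq_iff indicator_def)
  also have "\<dots> \<in> borel_measurable borel"
  proof (intro borel_measurable_times_ennreal borel_measurable_indicator)
    show "(\<lambda>x. ennreal ((indicator (ball 0 1) x * \<rho> x) powr p * (1 - norm x) powr (p - 1))) \<in> borel_measurable borel"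
      by measurable
  qed simp
  finally show ?thesis .
qed

lemma weight_indicator_measurable:
  "S \<in> sets borel \<Longrightarrow> (\<lambda>x. weight p x * indicator S x) \<in> borel_measurable borel"
  by (intro borel_measurable_times_ennreal weight_measurable borel_measurable_indicator)

text \<open>Only exponents up to 1 are treated by Young's inequality; it reduces them to \<open>\<rho> ^ DIM('a)\<close>,
  which is controlled by volume growth, and a power of the distance to the sphere above \<open>-1\<close>.
  Larger exponents follow from \<open>rho_norm_lower\<close>.\<close>

lemma box_estimate_aux:
  fixes cu q :: real
  assumes q: "0 < q" "q \<le> 1" and cu: "0 \<le> cu"
  obtains C where "0 \<le> C" "\<And>E \<Theta> l L. E \<in> sets borel \<Longrightarrow> \<Theta> \<in> sets sphere_measure \<Longrightarrow> 0 < l \<Longrightarrow> 0 < L \<Longrightarrow>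
      emeasure sphere_measure \<Theta> \<le> ennreal (cu * l ^ (DIM('a) - 1)) \<Longrightarrow>
      (\<And>x. x \<in> E \<Longrightarrow> x \<in> ball 0 1 \<and> x \<noteq> 0 \<and> v x < 2 * L \<and> 1 - norm x < 5 * l \<and> x /\<^sub>R norm x \<in> \<Theta>) \<Longrightarrow>
      (\<integral>\<^sup>+x\<in>E. weight q x \<partial>lborel) \<le> ennreal (C * L powr q * l ^ (DIM('a) - 1))"
proof -
  let ?n = "DIM('a)" and ?\<sigma> = "sphere_measure :: 'a measure"
  \<comment> \<open>The negated exponent that Young's inequality leaves on the distance to the
    sphere. It is below 1 precisely because n > 1, and then the power is integrable up to the
    sphere.\<close>
  define \<beta> where "\<beta> = (1 - q) * ?n / (?n - q)"
  have nq: "q < ?n" using q dim2 by simp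
  have "(1 - q) * ?n < ?n - q"
  proof -
    have "q * 1 < q * ?n" using q dim2 by (intro mult_strict_left_mono) auto
    then show ?thesis by (simp add: algebra_simps)
  qed
  then have \<beta>: "\<beta> < 1" using nq by (simp add: \<beta>_def)
  define J where "J = 5 powr (1 - \<beta>) / (1 - \<beta>)"
  have J: "0 \<le> J" using \<beta> by (simp add: J_def)
  show thesis
  proof (rule that[of "B * 2 ^ ?n + cu * J"])
    show "0 \<le> B * 2 ^ ?n + cu * J" using B0 cu J by simp
    fix E \<Theta> :: "'a set" and l L :: real
    assume [measurable]: "E \<in> sets borel" and \<Theta>: "\<Theta> \<in> sets ?\<sigma>" and l: "0 < l" and L: "0 < L"
      and cap: "emeasure ?\<sigma> \<Theta> \<le> ennreal (cu * l ^ (?n - 1))"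
      and E: "\<And>x. x \<in> E \<Longrightarrow> x \<in> ball 0 1 \<and> x \<noteq> 0 \<and> v x < 2 * L \<and> 1 - norm x < 5 * l \<and> x /\<^sub>R norm x \<in> \<Theta>"
    have [measurable]: "\<Theta> \<in> sets borel" using \<Theta> by (simp add: sets_sphere_measure_iff)
    define c where "c = L powr q / l"
    have c: "0 < c" using l L by (simp add: c_def)
    define G1 where "G1 = (\<lambda>x. ennreal (\<rho> x ^ ?n) * indicator (rho_ball \<rho> 0 (2 * L)) x)"
    define G2 where "G2 = (\<lambda>x::'a. ennreal (((1 - norm x) / l) powr - \<beta>) * indicator E x)"
    have [measurable]: "G1 \<in> borel_measurable borel"
      unfolding G1_def by (intro measurable_rho_power sets_rho_ball rho_ball_subset) simp
    have [measurable]: "G2 \<in> borel_measurable borel" unfolding G2_def by measurable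
    have pt: "weight q x * indicator E x \<le> ennreal c * (ennreal ((l / L) ^ ?n) * G1 x + G2 x)" for x
    proof (cases "x \<in> E")
      case True
      then have x: "x \<in> ball 0 1" "v x < 2 * L" using E by auto
      then have xr: "x \<in> rho_ball \<rho> 0 (2 * L)" using rho_norm_sym[of x] by (auto simp: rho_ball_def)
      \<comment> \<open>The density and the distance to the sphere in the natural units
        \<open>L / l\<close> and \<open>l\<close> of the box. With this normalisation both terms of
        Young's inequality integrate to multiples of \<open>l ^ DIM('a)\<close>.\<close>
      define X Y where "X = \<rho> x * l / L" and "Y = (1 - norm x) / l"
      have XY: "0 < X" "0 < Y" using pos[OF x(1)] x l L by (auto simp: X_def Y_def)
      have "\<rho> x powr q * (1 - norm x) powr (q - 1) = (L / l * X) powr q * (l * Y) powr (q - 1)"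
        using l L by (simp add: X_def Y_def)
      also have "\<dots> = (L / l) powr q * l powr (q - 1) * (X powr q * Y powr (q - 1))"
        using l L XY powr_mult[of "L / l" X q] powr_mult[of l Y "q - 1"] by simp
      also have "(L / l) powr q * l powr (q - 1) = c"
        using l L by (simp add: c_def powr_divide powr_diff)
      finally have "\<rho> x powr q * (1 - norm x) powr (q - 1) = c * (X powr q * Y powr (q - 1))" .
      also have "\<dots> \<le> c * (X powr ?n + Y powr ((q - 1) * ?n / (?n - q)))"
        using c XY q nq by (intro mult_left_mono young_powr) auto
      also have "X powr ?n = (l / L) ^ ?n * \<rho> x ^ ?n"
        unfolding powr_realpow[OF XY(1)] by (simp add: X_def power_mult_distrib power_divide)
      also have "(q - 1) * ?n / (?n - q) = - \<beta>" unfolding \<beta>_def minus_divide_left by (simp add: algebra_simps)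
      finally have "\<rho> x powr q * (1 - norm x) powr (q - 1) \<le> c * ((l / L) ^ ?n * \<rho> x ^ ?n + Y powr - \<beta>)" .
      then have "weight q x \<le> ennreal (c * ((l / L) ^ ?n * \<rho> x ^ ?n + Y powr - \<beta>))"
        using x by (simp add: weight_def ennreal_leI)
      also have "\<dots> = ennreal c * (ennreal ((l / L) ^ ?n) * ennreal (\<rho> x ^ ?n) + ennreal (Y powr - \<beta>))"
      proof -
        have "0 \<le> \<rho> x ^ ?n" "0 \<le> (l / L) ^ ?n" using pos[OF x(1)] l L by auto
        then show ?thesis using c by (simp add: ennreal_mult)
      qed
      finally show ?thesis using True xr by (simp add: G1_def G2_def Y_def)
    qed simp
    have I1: "(\<integral>\<^sup>+x. G1 x \<partial>lborel) \<le> ennreal (B * (2 * L) ^ ?n)"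
      unfolding G1_def using L by (intro volume_growthD) auto
    have I2: "(\<integral>\<^sup>+x. G2 x \<partial>lborel) \<le> ennreal (cu * l ^ (?n - 1) * (l * J))"
    proof -
      have "(\<integral>\<^sup>+x. G2 x \<partial>lborel) = (\<integral>\<^sup>+x\<in>ball 0 1. G2 x \<partial>lborel)"
        using E by (intro nn_integral_cong) (auto simp: G2_def indicator_def)
      also have "\<dots> = (\<integral>\<^sup>+\<omega>. (\<integral>\<^sup>+t\<in>{0<..<1}. G2 (t *\<^sub>R \<omega>) * ennreal (t ^ (?n - 1)) \<partial>lborel) \<partial>?\<sigma>)"
        by (rule nn_integral_polar) measurable
      also have "\<dots> \<le> (\<integral>\<^sup>+\<omega>. ennreal (l * J) * indicator \<Theta> \<omega> \<partial>?\<sigma>)"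
      proof (rule nn_integral_mono)
        fix \<omega> :: 'a assume "\<omega> \<in> space ?\<sigma>"
        then have \<omega>: "norm \<omega> = 1" by simp
        have "(\<integral>\<^sup>+t\<in>{0<..<1}. G2 (t *\<^sub>R \<omega>) * ennreal (t ^ (?n - 1)) \<partial>lborel) \<le>
            (\<integral>\<^sup>+t. ennreal (((1 - t) / l) powr - \<beta>) * indicator {1 - 5 * l<..<1} t * indicator \<Theta> \<omega> \<partial>lborel)"
        proof (rule nn_integral_mono)
          fix t :: real
          show "G2 (t *\<^sub>R \<omega>) * ennreal (t ^ (?n - 1)) * indicator {0<..<1} t \<le>
              ennreal (((1 - t) / l) powr - \<beta>) * indicator {1 - 5 * l<..<1} t * indicator \<Theta> \<omega>"
          proof (cases "0 < t \<and> t < 1 \<and> t *\<^sub>R \<omega> \<in> E")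
            case True
            then have "1 - t < 5 * l" "\<omega> \<in> \<Theta>" using E[of "t *\<^sub>R \<omega>"] \<omega> by auto
            moreover have "ennreal (t ^ (?n - 1)) \<le> 1" using True by (simp add: power_le_one)
            then have "G2 (t *\<^sub>R \<omega>) * ennreal (t ^ (?n - 1)) \<le> G2 (t *\<^sub>R \<omega>) * 1" by (intro mult_left_mono) auto
            ultimately show ?thesis using True \<omega> by (simp add: G2_def)
          qed (auto simp: G2_def indicator_def)
        qed
        also have "\<dots> = (\<integral>\<^sup>+t\<in>{1 - 5 * l<..<1}. ennreal (((1 - t) / l) powr - \<beta>) \<partial>lborel) * indicator \<Theta> \<omega>"
          by (intro nn_integral_multc) measurable
        also have "\<dots> \<le> ennreal (l * J) * indicator \<Theta> \<omega>"
          unfolding J_def by (intro mult_right_mono nn_integral_weight \<beta> l) simp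
        finally show "(\<integral>\<^sup>+t\<in>{0<..<1}. G2 (t *\<^sub>R \<omega>) * ennreal (t ^ (?n - 1)) \<partial>lborel) \<le> ennreal (l * J) * indicator \<Theta> \<omega>" .
      qed
      also have "\<dots> = ennreal (l * J) * emeasure ?\<sigma> \<Theta>" using \<Theta> by (rule nn_integral_cmult_indicator)
      also have "\<dots> \<le> ennreal (l * J) * ennreal (cu * l ^ (?n - 1))" by (intro mult_left_mono cap) simp
      also have "\<dots> = ennreal (cu * l ^ (?n - 1) * (l * J))"
        using l J cu by (subst ennreal_mult[symmetric]) (auto simp: mult_ac)
      finally show ?thesis .
    qed
    have "(\<integral>\<^sup>+x\<in>E. weight q x \<partial>lborel) \<le> (\<integral>\<^sup>+x. ennreal c * (ennreal ((l / L) ^ ?n) * G1 x + G2 x) \<partial>lborel)"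
      by (intro nn_integral_mono pt)
    also have "\<dots> = ennreal c * (ennreal ((l / L) ^ ?n) * (\<integral>\<^sup>+x. G1 x \<partial>lborel) + (\<integral>\<^sup>+x. G2 x \<partial>lborel))"
      by (simp add: nn_integral_cmult nn_integral_add)
    also have "\<dots> \<le> ennreal c * (ennreal ((l / L) ^ ?n) * ennreal (B * (2 * L) ^ ?n) + ennreal (cu * l ^ (?n - 1) * (l * J)))"
      by (intro mult_left_mono add_mono I1 I2) auto
    also have "\<dots> = ennreal (c * ((l / L) ^ ?n * (B * (2 * L) ^ ?n) + cu * l ^ (?n - 1) * (l * J)))"
      using c l L B0 cu J by (simp add: ennreal_mult[symmetric] ennreal_plus[symmetric] del: ennreal_plus)
    also have "c * ((l / L) ^ ?n * (B * (2 * L) ^ ?n) + cu * l ^ (?n - 1) * (l * J)) =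
        (B * 2 ^ ?n + cu * J) * L powr q * l ^ (?n - 1)"
    proof -
      obtain k where k: "?n = Suc k" using dim2 by (cases "DIM('a)") auto
      have "(l / L) ^ ?n * (B * (2 * L) ^ ?n) = B * 2 ^ ?n * l ^ ?n"
        using L by (simp add: power_divide power_mult_distrib)
      then show ?thesis using l by (simp add: c_def k field_simps)
    qed
    finally show "(\<integral>\<^sup>+x\<in>E. weight q x \<partial>lborel) \<le> ennreal ((B * 2 ^ ?n + cu * J) * L powr q * l ^ (?n - 1))" .
  qed
qed

lemma box_estimate:
  fixes cu p :: real
  assumes p: "0 < p" and cu: "0 \<le> cu"
  obtains C where "0 \<le> C" "\<And>E \<Theta> l L. E \<in> sets borel \<Longrightarrow> \<Theta> \<in> sets sphere_measure \<Longrightarrow> 0 < l \<Longrightarrow> 0 < L \<Longrightarrow>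
      emeasure sphere_measure \<Theta> \<le> ennreal (cu * l ^ (DIM('a) - 1)) \<Longrightarrow>
      (\<And>x. x \<in> E \<Longrightarrow> x \<in> ball 0 1 \<and> 1 / 3 \<le> norm x \<and> v x < 2 * L \<and> 1 - norm x < 5 * l \<and> x /\<^sub>R norm x \<in> \<Theta>) \<Longrightarrow>
      (\<integral>\<^sup>+x\<in>E. weight p x \<partial>lborel) \<le> ennreal (C * L powr p * l ^ (DIM('a) - 1))"
proof -
  define q where "q = min p 1"
  have q: "0 < q" "q \<le> 1" "q \<le> p" using p by (auto simp: q_def)
  obtain C where C: "0 \<le> C" "\<And>E \<Theta> l L. E \<in> sets borel \<Longrightarrow> \<Theta> \<in> sets sphere_measure \<Longrightarrow> 0 < l \<Longrightarrow> 0 < L \<Longrightarrow>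
      emeasure sphere_measure \<Theta> \<le> ennreal (cu * l ^ (DIM('a) - 1)) \<Longrightarrow>
      (\<And>x. x \<in> E \<Longrightarrow> x \<in> ball 0 1 \<and> x \<noteq> 0 \<and> v x < 2 * L \<and> 1 - norm x < 5 * l \<and> x /\<^sub>R norm x \<in> \<Theta>) \<Longrightarrow>
      (\<integral>\<^sup>+x\<in>E. weight q x \<partial>lborel) \<le> ennreal (C * L powr q * l ^ (DIM('a) - 1))"
    using box_estimate_aux[OF q(1,2) cu] by blast
  show thesis
  proof (rule that[of "(4 * A) powr (p - q) * C"])
    show "0 \<le> (4 * A) powr (p - q) * C" using C by simp
    fix E \<Theta> :: "'a set" and l L :: real
    assume E1: "E \<in> sets borel" and \<Theta>: "\<Theta> \<in> sets sphere_measure" and l: "0 < l" and L: "0 < L"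
      and cap: "emeasure sphere_measure \<Theta> \<le> ennreal (cu * l ^ (DIM('a) - 1))"
      and E: "\<And>x. x \<in> E \<Longrightarrow> x \<in> ball 0 1 \<and> 1 / 3 \<le> norm x \<and> v x < 2 * L \<and> 1 - norm x < 5 * l \<and> x /\<^sub>R norm x \<in> \<Theta>"
    have "(\<integral>\<^sup>+x\<in>E. weight p x \<partial>lborel) \<le> (\<integral>\<^sup>+x. ennreal ((4 * A * L) powr (p - q)) * (weight q x * indicator E x) \<partial>lborel)"
    proof (rule nn_integral_mono)
      fix x
      show "weight p x * indicator E x \<le> ennreal ((4 * A * L) powr (p - q)) * (weight q x * indicator E x)"
      proof (cases "x \<in> E")
        case True
        then have x: "x \<in> ball 0 1" "1 / 3 \<le> norm x" "v x < 2 * L" using E by auto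
        have "\<rho> x * (1 - norm x) \<le> 2 * A * v x" using x by (intro rho_norm_lower) auto
        also have "\<dots> \<le> 2 * A * (2 * L)" using x A1 by (intro mult_left_mono) auto
        finally have a: "\<rho> x * (1 - norm x) \<le> 4 * A * L" by simp
        have x1: "0 < 1 - norm x" "0 < \<rho> x" using x pos[OF x(1)] by auto
        \<comment> \<open>The excess p - q is moved onto the product
          \<open>\<rho> x * (1 - norm x)\<close>, already bounded by a multiple of
          \<open>L\<close>.\<close>
        have "\<rho> x powr p * (1 - norm x) powr (p - 1) =
            (\<rho> x powr (p - q) * \<rho> x powr q) * ((1 - norm x) powr (p - q) * (1 - norm x) powr (q - 1))"
          by (simp flip: powr_add)
        also have "\<dots> = (\<rho> x * (1 - norm x)) powr (p - q) * (\<rho> x powr q * (1 - norm x) powr (q - 1))"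
          using x1 by (simp add: powr_mult)
        also have "\<dots> \<le> (4 * A * L) powr (p - q) * (\<rho> x powr q * (1 - norm x) powr (q - 1))"
          using a x1 q by (intro mult_right_mono powr_mono2) auto
        finally show ?thesis using True x by (simp add: weight_def ennreal_leI flip: ennreal_mult)
      qed simp
    qed
    also have "\<dots> = ennreal ((4 * A * L) powr (p - q)) * (\<integral>\<^sup>+x\<in>E. weight q x \<partial>lborel)"
      using E1 by (intro nn_integral_cmult) auto
    also have "\<dots> \<le> ennreal ((4 * A * L) powr (p - q)) * ennreal (C * L powr q * l ^ (DIM('a) - 1))"
    proof (intro mult_left_mono C(2)[OF E1 \<Theta> l L cap])
      fix x assume "x \<in> E"
      from E[OF this] show "x \<in> ball 0 1 \<and> x \<noteq> 0 \<and> v x < 2 * L \<and> 1 - norm x < 5 * l \<and> x /\<^sub>R norm x \<in> \<Theta>" by auto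
    qed simp
    also have "\<dots> = ennreal ((4 * A * L) powr (p - q) * (C * L powr q * l ^ (DIM('a) - 1)))"
      using C l by (intro ennreal_mult[symmetric]) auto
    also have "(4 * A * L) powr (p - q) = (4 * A) powr (p - q) * L powr (p - q)"
      using A1 L by (simp add: powr_mult)
    also have "(4 * A) powr (p - q) * L powr (p - q) * (C * L powr q * l ^ (DIM('a) - 1)) =
        (4 * A) powr (p - q) * C * (L powr (p - q) * L powr q) * l ^ (DIM('a) - 1)"
      by (simp add: mult_ac)
    also have "L powr (p - q) * L powr q = L powr p" by (simp flip: powr_add)
    finally show "(\<integral>\<^sup>+x\<in>E. weight p x \<partial>lborel) \<le> ennreal ((4 * A) powr (p - q) * C * L powr p * l ^ (DIM('a) - 1))" .
  qed
qed

end

section \<open>From spherical means to the volume integral\<close>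

context conf_density begin

definition mean :: "real \<Rightarrow> real \<Rightarrow> ennreal" where
  "mean p r = (\<integral>\<^sup>+\<omega>. ennreal (v (r *\<^sub>R \<omega>) powr p) \<partial>sphere_measure)"

lemma sphere_measure_finite: "emeasure sphere_measure (sphere (0::'a) 1) < \<infinity>"
  using finite_measure.emeasure_finite[OF finite_sphere_measure, of "sphere (0::'a) 1"]
  by (simp add: less_top)

lemma measurable_radial:
  fixes f :: "'a \<Rightarrow> real"
  assumes "continuous_on (ball 0 1) f" "0 \<le> r" "r < 1"
  shows "(\<lambda>\<omega>. f (r *\<^sub>R \<omega>)) \<in> borel_measurable sphere_measure"
proof -
  have "(\<lambda>\<omega>. indicator (ball 0 1) (r *\<^sub>R \<omega>) * f (r *\<^sub>R \<omega>)) \<in> borel_measurable borel"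
    by (rule measurable_compose[OF _ measurable_on_ball[OF assms(1)]]) simp
  then have "(\<lambda>\<omega>. indicator (ball 0 1) (r *\<^sub>R \<omega>) * f (r *\<^sub>R \<omega>)) \<in> borel_measurable sphere_measure"
    by (rule borel_measurable_sphere_measure)
  also have "?this \<longleftrightarrow> ?thesis"
    using assms by (intro measurable_cong) auto
  finally show ?thesis .
qed

lemma measurable_rho_norm_radial:
  "0 \<le> r \<Longrightarrow> r < 1 \<Longrightarrow> (\<lambda>\<omega>. v (r *\<^sub>R \<omega>)) \<in> borel_measurable sphere_measure"
  by (intro measurable_radial continuous_on_rho_norm)

lemma mean_bounded:
  assumes "0 < p" "0 \<le> r" "\<And>\<omega>. norm (\<omega>::'a) = 1 \<Longrightarrow> 0 \<le> v (r *\<^sub>R \<omega>) \<and> v (r *\<^sub>R \<omega>) \<le> M"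
  shows "mean p r \<le> ennreal (M powr p) * emeasure sphere_measure (sphere (0::'a) 1)"
proof -
  have "mean p r \<le> (\<integral>\<^sup>+\<omega>. ennreal (M powr p) * indicator (sphere (0::'a) 1) \<omega> \<partial>sphere_measure)"
    unfolding mean_def using assms by (intro nn_integral_mono) (auto intro!: ennreal_leI powr_mono2)
  also have "\<dots> = ennreal (M powr p) * emeasure sphere_measure (sphere (0::'a) 1)"
    by (intro nn_integral_cmult_indicator) (simp add: sets_sphere_measure_iff)
  finally show ?thesis .
qed

text \<open>Finiteness at each fixed radius, without any uniformity, is what permits the absorption
  of half a mean in \<open>mean_bounded_if_weight_finite\<close>.\<close>

lemma mean_finite:
  assumes "0 < p" "0 \<le> r" "r < 1"
  shows "mean p r < \<infinity>"
proof -
  have "compact (v ` cball 0 r)"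
    using assms
    by (intro compact_continuous_image continuous_on_subset[OF continuous_on_rho_norm] compact_cball) auto
  then have "bounded (v ` cball 0 r)" by (rule compact_imp_bounded)
  then obtain b where b: "\<And>y. y \<in> cball 0 r \<Longrightarrow> norm (v y) \<le> b"
    unfolding bounded_pos by blast
  have "0 \<le> v (r *\<^sub>R \<omega>) \<and> v (r *\<^sub>R \<omega>) \<le> b" if "norm \<omega> = 1" for \<omega>
    using b[of "r *\<^sub>R \<omega>"] rho_norm_nonneg[of "r *\<^sub>R \<omega>"] that assms by auto
  then have "mean p r \<le> ennreal (b powr p) * emeasure sphere_measure (sphere (0::'a) 1)" by (intro mean_bounded assms)
  also have "\<dots> < \<infinity>" using sphere_measure_finite by (simp add: ennreal_mult_less_top)
  finally show ?thesis .
qed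

lemma emeasure_superlevel_eq:
  assumes "0 \<le> R" "R < 1"
  shows "c * emeasure sphere_measure (superlevel R L) = (\<integral>\<^sup>+\<omega>. c * of_bool (L \<le> v (R *\<^sub>R \<omega>)) \<partial>sphere_measure)"
proof -
  have "(\<integral>\<^sup>+\<omega>. c * of_bool (L \<le> v (R *\<^sub>R \<omega>)) \<partial>sphere_measure) =
      (\<integral>\<^sup>+\<omega>. c * indicator (superlevel R L) \<omega> \<partial>sphere_measure)"
    by (intro nn_integral_cong) (auto simp: superlevel_def indicator_def)
  then show ?thesis using sets_superlevel[OF assms, of L] by (simp add: nn_integral_cmult_indicator)
qed

lemma measurable_superlevel_bool:
  assumes "0 \<le> R" "R < 1"
  shows "(\<lambda>\<omega>. c * of_bool (L \<le> v (R *\<^sub>R \<omega>)) :: ennreal) \<in> borel_measurable sphere_measure"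
proof -
  have "(\<lambda>\<omega>. c * indicator (superlevel R L) \<omega>) \<in> borel_measurable sphere_measure"
    using sets_superlevel[OF assms, of L] by measurable
  also have "?this \<longleftrightarrow> ?thesis"
    by (intro measurable_cong) (auto simp: superlevel_def indicator_def)
  finally show ?thesis .
qed

lemma suminf_superlevel:
  assumes "0 \<le> R" "R < 1"
  shows "(\<Sum>j. c j * emeasure sphere_measure (superlevel R (l j))) =
    (\<integral>\<^sup>+\<omega>. (\<Sum>j. c j * of_bool (l j \<le> v (R *\<^sub>R \<omega>))) \<partial>sphere_measure)"
  unfolding emeasure_superlevel_eq[OF assms]
  by (intro nn_integral_suminf[symmetric] measurable_superlevel_bool assms)

text \<open>After sum and integral are exchanged, each direction contributes a geometric sum
  dominated by the p-th power of \<open>v\<close>; lowering the levels by \<open>2 ^ m\<close> costs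
  the factor \<open>2 powr (m * p)\<close>.\<close>

lemma superlevel_sum_le:
  assumes "0 \<le> R" "R < 1" "0 < L" "0 < p"
  shows "(\<Sum>j. ennreal ((2 ^ j * L) powr p) * emeasure sphere_measure (superlevel R (2 ^ j * L / 2 ^ m)))
     \<le> ennreal (2 powr (m * p) * dyadic_const p) * mean p R"
proof -
  have "(\<Sum>j. ennreal ((2 ^ j * L) powr p) * emeasure sphere_measure (superlevel R (2 ^ j * L / 2 ^ m))) =
      (\<integral>\<^sup>+\<omega>. (\<Sum>j. ennreal ((2 ^ j * L) powr p) * of_bool (2 ^ j * L / 2 ^ m \<le> v (R *\<^sub>R \<omega>))) \<partial>sphere_measure)"
    by (rule suminf_superlevel[OF assms(1,2)])
  also have "\<dots> \<le> (\<integral>\<^sup>+\<omega>. ennreal (2 powr (m * p) * dyadic_const p) * ennreal (v (R *\<^sub>R \<omega>) powr p) \<partial>sphere_measure)"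
  proof (rule nn_integral_mono)
    fix \<omega> :: 'a assume "\<omega> \<in> space sphere_measure"
    then have \<omega>: "norm \<omega> = 1" by simp
    have v0: "0 \<le> v (R *\<^sub>R \<omega>)" using \<omega> assms by (intro rho_norm_nonneg) auto
    have "(\<Sum>j. ennreal ((2 ^ j * L) powr p) * of_bool (2 ^ j * L / 2 ^ m \<le> v (R *\<^sub>R \<omega>))) =
        (\<Sum>j. ennreal ((2 ^ j * L) powr p) * of_bool (2 ^ j * L \<le> 2 ^ m * v (R *\<^sub>R \<omega>)))"
      by (simp add: pos_divide_le_eq mult.commute)
    also have "\<dots> \<le> ennreal (dyadic_const p * (2 ^ m * v (R *\<^sub>R \<omega>)) powr p)"
      by (intro dyadic_suminf_le assms)
    also have "(2 ^ m * v (R *\<^sub>R \<omega>)) powr p = 2 powr (m * p) * v (R *\<^sub>R \<omega>) powr p"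
      using v0 by (simp add: powr_mult powr_powr flip: powr_realpow)
    also have "ennreal (dyadic_const p * (2 powr (m * p) * v (R *\<^sub>R \<omega>) powr p)) =
        ennreal (2 powr (m * p) * dyadic_const p) * ennreal (v (R *\<^sub>R \<omega>) powr p)"
      using dyadic_const_pos[OF assms(4)] by (subst ennreal_mult[symmetric]) (auto simp: mult_ac)
    finally show "(\<Sum>j. ennreal ((2 ^ j * L) powr p) * of_bool (2 ^ j * L / 2 ^ m \<le> v (R *\<^sub>R \<omega>))) \<le>
        ennreal (2 powr (m * p) * dyadic_const p) * ennreal (v (R *\<^sub>R \<omega>) powr p)" .
  qed
  also have "\<dots> = ennreal (2 powr (m * p) * dyadic_const p) * mean p R"
    unfolding mean_def
    by (intro nn_integral_cmult measurable_compose[OF measurable_rho_norm_radial[OF assms(1,2)]]) simp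
  finally show ?thesis .
qed

text \<open>The superlevel sets are taken at twice the dyadic values, to match the left-hand side of the
  good-\<open>\<lambda>\<close> inequality below.\<close>

lemma mean_le_superlevel_sum:
  assumes "0 \<le> R" "R < 1" "0 < L" "0 < p"
  shows "mean p R \<le> ennreal ((2 * L) powr p) * emeasure sphere_measure (sphere (0::'a) 1) +
    ennreal (4 powr p) * (\<Sum>j. ennreal ((2 ^ j * L) powr p) * emeasure sphere_measure (superlevel R (2 * (2 ^ j * L))))"
proof -
  let ?f = "\<lambda>\<omega>. \<Sum>j. ennreal ((2 ^ j * L) powr p) * of_bool (2 * (2 ^ j * L) \<le> v (R *\<^sub>R \<omega>))"
  have f: "?f \<in> borel_measurable sphere_measure"
    by (intro borel_measurable_suminf_order measurable_superlevel_bool assms)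
  have "mean p R \<le> (\<integral>\<^sup>+\<omega>. ennreal ((2 * L) powr p) * indicator (sphere (0::'a) 1) \<omega> + ennreal (4 powr p) * ?f \<omega> \<partial>sphere_measure)"
    unfolding mean_def
  proof (rule nn_integral_mono)
    fix \<omega> :: 'a assume "\<omega> \<in> space sphere_measure"
    then have \<omega>: "norm \<omega> = 1" by simp
    have "ennreal (v (R *\<^sub>R \<omega>) powr p) \<le> ennreal ((2 * L) powr p) + ennreal (2 powr p) *
        (\<Sum>j. ennreal ((2 ^ j * (2 * L)) powr p) * of_bool (2 ^ j * (2 * L) \<le> v (R *\<^sub>R \<omega>)))"
      using \<omega> assms by (intro le_dyadic_suminf rho_norm_nonneg) auto
    also have "(\<Sum>j. ennreal ((2 ^ j * (2 * L)) powr p) * of_bool (2 ^ j * (2 * L) \<le> v (R *\<^sub>R \<omega>))) =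
        (\<Sum>j. ennreal (2 powr p) * (ennreal ((2 ^ j * L) powr p) * of_bool (2 * (2 ^ j * L) \<le> v (R *\<^sub>R \<omega>))))"
    proof (rule suminf_cong)
      fix j :: nat
      have e: "2 ^ j * (2 * L) = 2 * (2 ^ j * L)" by simp
      have "ennreal ((2 * (2 ^ j * L)) powr p) = ennreal (2 powr p) * ennreal ((2 ^ j * L) powr p)"
        using assms by (subst powr_mult) (auto intro: ennreal_mult)
      then show "ennreal ((2 ^ j * (2 * L)) powr p) * of_bool (2 ^ j * (2 * L) \<le> v (R *\<^sub>R \<omega>)) =
          ennreal (2 powr p) * (ennreal ((2 ^ j * L) powr p) * of_bool (2 * (2 ^ j * L) \<le> v (R *\<^sub>R \<omega>)))"
        unfolding e by (simp add: mult.assoc)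
    qed
    also have "\<dots> = ennreal (2 powr p) * ?f \<omega>" by simp
    \<comment> \<open>One factor \<open>2 powr p\<close> comes from the width of the dyadic
      intervals, the other from comparing the level \<open>2 * (2 ^ j * L)\<close> with
      \<open>2 ^ j * L\<close>.\<close>
    also have "ennreal (2 powr p) * (ennreal (2 powr p) * ?f \<omega>) = ennreal (4 powr p) * ?f \<omega>"
    proof -
      have "(4::real) powr p = 2 powr p * 2 powr p" using powr_mult[of "2::real" 2 p] by simp
      then have "ennreal (2 powr p) * ennreal (2 powr p) = ennreal (4 powr p)"
        by (simp add: ennreal_mult)
      then show ?thesis by (simp only: mult.assoc[symmetric])
    qed
    finally show "ennreal (v (R *\<^sub>R \<omega>) powr p) \<le> ennreal ((2 * L) powr p) * indicator (sphere 0 1) \<omega> + ennreal (4 powr p) * ?f \<omega>"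
      using \<omega> by simp
  qed
  also have "\<dots> = (\<integral>\<^sup>+\<omega>. ennreal ((2 * L) powr p) * indicator (sphere (0::'a) 1) \<omega> \<partial>sphere_measure) +
      (\<integral>\<^sup>+\<omega>. ennreal (4 powr p) * ?f \<omega> \<partial>sphere_measure)"
    by (intro nn_integral_add borel_measurable_times_ennreal borel_measurable_const f
        borel_measurable_indicator) (simp add: sets_sphere_measure_iff)
  also have "(\<integral>\<^sup>+\<omega>. ennreal ((2 * L) powr p) * indicator (sphere (0::'a) 1) \<omega> \<partial>sphere_measure) = ennreal ((2 * L) powr p) * emeasure sphere_measure (sphere (0::'a) 1)"
    by (intro nn_integral_cmult_indicator) (simp add: sets_sphere_measure_iff)
  also have "(\<integral>\<^sup>+\<omega>. ennreal (4 powr p) * ?f \<omega> \<partial>sphere_measure) = ennreal (4 powr p) * (\<integral>\<^sup>+\<omega>. ?f \<omega> \<partial>sphere_measure)"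
    by (rule nn_integral_cmult[OF f])
  also have "(\<integral>\<^sup>+\<omega>. ?f \<omega> \<partial>sphere_measure) =
      (\<Sum>j. ennreal ((2 ^ j * L) powr p) * emeasure sphere_measure (superlevel R (2 * (2 ^ j * L))))"
    by (rule suminf_superlevel[OF assms(1,2), symmetric])
  finally show ?thesis .
qed

lemma central_weight_finite: "(\<integral>\<^sup>+x\<in>cball 0 (1 / 3). weight p x \<partial>lborel) < \<infinity>"
proof -
  have "continuous_on (cball 0 (1 / 3)) (\<lambda>x. \<rho> x powr p * (1 - norm x) powr (p - 1))"
  proof (intro continuous_intros continuous_on_subset[OF cont] ballI)
    fix x :: 'a assume "x \<in> cball 0 (1 / 3)"
    then have "x \<in> ball 0 1" by auto
    then show "\<rho> x \<noteq> 0" "1 - norm x \<noteq> 0" using pos[of x] by auto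
  qed auto
  then have "bounded ((\<lambda>x. \<rho> x powr p * (1 - norm x) powr (p - 1)) ` cball 0 (1 / 3))"
    by (intro compact_imp_bounded compact_continuous_image compact_cball)
  then obtain b where b: "\<And>x. x \<in> cball 0 (1 / 3) \<Longrightarrow> norm (\<rho> x powr p * (1 - norm x) powr (p - 1)) \<le> b"
    unfolding bounded_pos by blast
  have "(\<integral>\<^sup>+x\<in>cball 0 (1 / 3). weight p x \<partial>lborel) \<le> (\<integral>\<^sup>+x. ennreal b * indicator (cball (0::'a) (1 / 3)) x \<partial>lborel)"
  proof (rule nn_integral_mono)
    fix x :: 'a
    show "weight p x * indicator (cball 0 (1 / 3)) x \<le> ennreal b * indicator (cball 0 (1 / 3)) x"
      using b[of x] by (auto simp: weight_def indicator_def intro!: ennreal_leI)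
  qed
  also have "\<dots> = ennreal b * emeasure lborel (cball (0::'a) (1 / 3))"
    by (intro nn_integral_cmult_indicator) simp
  also have "\<dots> < \<infinity>"
    using emeasure_lborel_cball_finite[of "0::'a" "1 / 3"] by (simp add: ennreal_mult_less_top)
  finally show ?thesis .
qed

text \<open>Outside the central ball, the points with \<open>v\<close> below \<open>L\<close> form
  one box over the whole sphere; the others are sorted into dyadic layers of \<open>v\<close>, each
  covered by the boxes over its stopping points. A layer costs the p-th power of its level times the
  total size of the caps, and these costs add up to a layer-cake sum for the mean at radius
  \<open>R\<close>.\<close>

lemma weight_finite_if_mean_bounded:
  assumes p: "0 < p" and S: "S < \<infinity>" "\<And>r. 0 < r \<Longrightarrow> r < 1 \<Longrightarrow> mean p r \<le> S"
  shows "(\<integral>\<^sup>+x. weight p x \<partial>lborel) < \<infinity>"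
proof -
  let ?\<sigma> = "sphere_measure :: 'a measure"
  obtain L where L: "0 < L" "\<And>y. norm (y::'a) \<le> 9 / 10 \<Longrightarrow> v y < L"
    using rho_norm_bounded by blast
  obtain m where m: "covering_exponent m" using covering by blast
  obtain \<sigma>S where \<sigma>S: "emeasure sphere_measure (sphere (0::'a) 1) = ennreal \<sigma>S" "0 \<le> \<sigma>S"
    using sphere_measure_finite by (metis ennreal_cases infinity_ennreal_def less_irrefl)
  \<comment> \<open>Large enough for the fivefold caps and for the whole sphere at once, so that a
    single \<open>C\<close> serves both.\<close>
  define cu where "cu = cap_upper + \<sigma>S"
  have cu: "0 \<le> cu" using cap_upper_pos \<sigma>S by (simp add: cu_def)
  obtain C where C: "0 \<le> C" "\<And>E \<Theta> l L. E \<in> sets borel \<Longrightarrow> \<Theta> \<in> sets ?\<sigma> \<Longrightarrow> 0 < l \<Longrightarrow> 0 < L \<Longrightarrow>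
      emeasure ?\<sigma> \<Theta> \<le> ennreal (cu * l ^ (DIM('a) - 1)) \<Longrightarrow>
      (\<And>x. x \<in> E \<Longrightarrow> x \<in> ball 0 1 \<and> 1 / 3 \<le> norm x \<and> v x < 2 * L \<and> 1 - norm x < 5 * l \<and> x /\<^sub>R norm x \<in> \<Theta>) \<Longrightarrow>
      (\<integral>\<^sup>+x\<in>E. weight p x \<partial>lborel) \<le> ennreal (C * L powr p * l ^ (DIM('a) - 1))"
    using box_estimate[OF p cu] by blast
  define Elow where "Elow = {x \<in> ball 0 1. v x \<in> {..<L}} - ball 0 (1 / 3)"
  have Elow: "Elow \<in> sets borel" unfolding Elow_def
    by (intro sets.Diff sets_ball_preimage continuous_on_rho_norm) auto
  have low: "(\<integral>\<^sup>+x\<in>Elow. weight p x \<partial>lborel) \<le> ennreal (C * L powr p * 1 ^ (DIM('a) - 1))"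
  proof (rule C(2)[OF Elow])
    show "sphere 0 1 \<in> sets ?\<sigma>" by (simp add: sets_sphere_measure_iff)
    show "emeasure sphere_measure (sphere (0::'a) 1) \<le> ennreal (cu * 1 ^ (DIM('a) - 1))"
      using cap_upper_pos \<sigma>S by (simp add: cu_def ennreal_leI)
    fix x assume "x \<in> Elow"
    then show "x \<in> ball 0 1 \<and> 1 / 3 \<le> norm x \<and> v x < 2 * L \<and> 1 - norm x < 5 * 1 \<and> x /\<^sub>R norm x \<in> sphere 0 1"
      using L(1) by (cases "x = 0") (auto simp: Elow_def)
  qed (use L in auto)
  define c2 where "c2 = C * (2 / cap_lower)"
  have c2: "0 \<le> c2" using C cap_lower_pos by (simp add: c2_def)
  define K where "K = (\<integral>\<^sup>+x\<in>cball 0 (1 / 3). weight p x \<partial>lborel) + ennreal (C * L powr p) +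
      ennreal c2 * (ennreal (2 powr (m * p) * dyadic_const p) * S)"
  have K: "K < \<infinity>"
    using central_weight_finite[of p] S(1) by (simp add: K_def ennreal_mult_less_top)
  have main: "(\<integral>\<^sup>+x\<in>cball 0 R. weight p x \<partial>lborel) \<le> K" if R: "9 / 10 \<le> R" "R < 1" for R
  proof -
    define E where "E = (\<lambda>j::nat. {x \<in> ball 0 1. v x \<in> {2 ^ j * L..<2 * (2 ^ j * L)}} \<inter> cball 0 R)"
    have E[measurable]: "E j \<in> sets borel" for j unfolding E_def
      by (intro sets.Int sets_ball_preimage continuous_on_rho_norm) auto
    have Ej: "(\<integral>\<^sup>+x\<in>E j. weight p x \<partial>lborel) \<le>
        ennreal c2 * (ennreal ((2 ^ j * L) powr p) * emeasure ?\<sigma> (superlevel R (2 ^ j * L / 2 ^ m)))" for j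
    proof -
      let ?L = "2 ^ j * L"
      have "L \<le> ?L" using L(1) by simp
      then have "\<And>y. norm (y::'a) \<le> 9 / 10 \<Longrightarrow> v y < ?L" using L(2) by (meson less_le_trans)
      note small = this
      obtain F where "cap_cover m ?L R F"
        using m small R unfolding covering_exponent_def by blast
      then have F: "finite F" "\<And>x. x \<in> F \<Longrightarrow> 9 / 10 \<le> norm x \<and> norm x \<le> R \<and> v x = ?L"
        and cov: "\<And>y. norm y \<le> R \<Longrightarrow> ?L \<le> v y \<Longrightarrow> \<exists>x\<in>F.
          y /\<^sub>R norm y \<in> cap (x /\<^sub>R norm x) (5 * cap_const * (1 - norm x)) \<and> 1 - norm y < 5 * (1 - norm x)"
        and sum: "(\<Sum>x\<in>F. ennreal (cap_lower / 2 * (1 - norm x) ^ (DIM('a) - 1))) \<le> emeasure ?\<sigma> (superlevel R (?L / 2 ^ m))"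
        unfolding cap_cover_def by blast+
      \<comment> \<open>The part of the layer in the box over the fivefold cap at \<open>x\<close>.
        These pieces may overlap, which is harmless for an upper bound.\<close>
      define W where "W = (\<lambda>x. E j \<inter> {y. y /\<^sub>R norm y \<in> cap (x /\<^sub>R norm x) (5 * cap_const * (1 - norm x)) \<and> 1 - norm y < 5 * (1 - norm x)})"
      have W[measurable]: "W x \<in> sets borel" for x
      proof -
        have "{y::'a. y /\<^sub>R norm y \<in> cap (x /\<^sub>R norm x) (5 * cap_const * (1 - norm x)) \<and> 1 - norm y < 5 * (1 - norm x)} \<in> sets borel"
          by measurable
        then show ?thesis unfolding W_def by (intro sets.Int E)
      qed
      have "(\<integral>\<^sup>+x\<in>E j. weight p x \<partial>lborel) \<le> (\<integral>\<^sup>+y. (\<Sum>x\<in>F. weight p y * indicator (W x) y) \<partial>lborel)"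
      proof (rule nn_integral_mono)
        fix y
        show "weight p y * indicator (E j) y \<le> (\<Sum>x\<in>F. weight p y * indicator (W x) y)"
        proof (cases "y \<in> E j")
          case True
          then obtain x where x: "x \<in> F" "y \<in> W x" using cov[of y] by (auto simp: E_def W_def)
          have "weight p y * indicator (W x) y \<le> (\<Sum>x\<in>F. weight p y * indicator (W x) y)"
            using x F(1) by (intro member_le_sum) auto
          then show ?thesis using True x by simp
        qed simp
      qed
      also have "\<dots> = (\<Sum>x\<in>F. \<integral>\<^sup>+y\<in>W x. weight p y \<partial>lborel)"
        by (intro nn_integral_sum) measurable
      also have "\<dots> \<le> (\<Sum>x\<in>F. ennreal (c2 * ?L powr p) * ennreal (cap_lower / 2 * (1 - norm x) ^ (DIM('a) - 1)))"
      proof (rule sum_mono)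
        fix x assume "x \<in> F"
        from F(2)[OF this] have x: "9 / 10 \<le> norm x" "norm x < 1" using R by auto
        have nx: "norm (x /\<^sub>R norm x) = 1" using x by (cases "x = 0") auto
        have "(\<integral>\<^sup>+y\<in>W x. weight p y \<partial>lborel) \<le> ennreal (C * ?L powr p * (1 - norm x) ^ (DIM('a) - 1))"
        proof (rule C(2)[OF W cap_sets(2)])
          have "emeasure ?\<sigma> (cap (x /\<^sub>R norm x) (5 * cap_const * (1 - norm x))) \<le> ennreal (cap_upper * (1 - norm x) ^ (DIM('a) - 1))"
            using x nx by (intro emeasure_large_cap_upper) auto
          also have "\<dots> \<le> ennreal (cu * (1 - norm x) ^ (DIM('a) - 1))"
            using x \<sigma>S by (intro ennreal_leI mult_right_mono) (auto simp: cu_def)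
          finally show "emeasure ?\<sigma> (cap (x /\<^sub>R norm x) (5 * cap_const * (1 - norm x))) \<le> ennreal (cu * (1 - norm x) ^ (DIM('a) - 1))" .
          fix y assume y: "y \<in> W x"
          then have "9 / 10 < norm y"
            using L(2)[of y] \<open>L \<le> ?L\<close> by (cases "norm y \<le> 9 / 10") (auto simp: W_def E_def)
          then show "y \<in> ball 0 1 \<and> 1 / 3 \<le> norm y \<and> v y < 2 * ?L \<and> 1 - norm y < 5 * (1 - norm x) \<and>
              y /\<^sub>R norm y \<in> cap (x /\<^sub>R norm x) (5 * cap_const * (1 - norm x))"
            using y by (auto simp: W_def E_def)
        qed (use x L in auto)
        also have "C * ?L powr p * (1 - norm x) ^ (DIM('a) - 1) = c2 * ?L powr p * (cap_lower / 2 * (1 - norm x) ^ (DIM('a) - 1))"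
          using cap_lower_pos by (simp add: c2_def)
        also have "ennreal \<dots> = ennreal (c2 * ?L powr p) * ennreal (cap_lower / 2 * (1 - norm x) ^ (DIM('a) - 1))"
          using c2 cap_lower_pos x by (intro ennreal_mult) auto
        finally show "(\<integral>\<^sup>+y\<in>W x. weight p y \<partial>lborel) \<le> ennreal (c2 * ?L powr p) * ennreal (cap_lower / 2 * (1 - norm x) ^ (DIM('a) - 1))" .
      qed
      also have "\<dots> = ennreal (c2 * ?L powr p) * (\<Sum>x\<in>F. ennreal (cap_lower / 2 * (1 - norm x) ^ (DIM('a) - 1)))"
        by (simp add: sum_distrib_left)
      also have "\<dots> \<le> ennreal (c2 * ?L powr p) * emeasure ?\<sigma> (superlevel R (?L / 2 ^ m))"
        by (intro mult_left_mono sum) simp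
      also have "\<dots> = ennreal c2 * (ennreal (?L powr p) * emeasure ?\<sigma> (superlevel R (?L / 2 ^ m)))"
        using c2 by (simp add: ennreal_mult mult.assoc)
      finally show ?thesis .
    qed
    have "(\<integral>\<^sup>+x\<in>cball 0 R. weight p x \<partial>lborel) \<le>
        (\<integral>\<^sup>+x. weight p x * indicator (cball 0 (1 / 3)) x + weight p x * indicator Elow x + (\<Sum>j. weight p x * indicator (E j) x) \<partial>lborel)"
    proof (rule nn_integral_mono)
      fix x :: 'a
      show "weight p x * indicator (cball 0 R) x \<le>
          weight p x * indicator (cball 0 (1 / 3)) x + weight p x * indicator Elow x + (\<Sum>j. weight p x * indicator (E j) x)"
      proof (cases "x \<in> cball 0 R")
        case True
        then have xb: "x \<in> ball 0 1" using R by auto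
        consider "x \<in> cball 0 (1 / 3)" | "x \<in> Elow" | "L \<le> v x"
          using xb by (cases "L \<le> v x"; cases "norm x \<le> 1 / 3") (auto simp: Elow_def)
        then show ?thesis
        proof cases
          case 1 then show ?thesis using True by (simp add: add_increasing2)
        next
          case 2
          have "weight p x * 1 \<le> weight p x * indicator (cball 0 (1 / 3)) x + weight p x * indicator Elow x"
            using 2 by (simp add: add_increasing)
          then show ?thesis using True by (simp add: add_increasing2)
        next
          case 3
          obtain j :: nat where "2 ^ j * L \<le> v x" "v x < 2 * (2 ^ j * L)"
            using dyadic_interval[OF L(1) 3] by blast
          then have j: "x \<in> E j" using xb True by (simp add: E_def)
          have "weight p x * indicator (E j) x \<le> (\<Sum>j. weight p x * indicator (E j) x)"
            by (rule term_le_suminf)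
          then have "weight p x \<le> (\<Sum>j. weight p x * indicator (E j) x)"
            using j by simp
          then show ?thesis using True by (simp add: add_increasing)
        qed
      qed simp
    qed
    also have "\<dots> = (\<integral>\<^sup>+x\<in>cball 0 (1 / 3). weight p x \<partial>lborel) + (\<integral>\<^sup>+x\<in>Elow. weight p x \<partial>lborel) +
        (\<integral>\<^sup>+x. (\<Sum>j. weight p x * indicator (E j) x) \<partial>lborel)"
    proof -
      have m: "(\<lambda>x. weight p x * indicator (cball 0 (1 / 3)) x) \<in> borel_measurable lborel"
        "(\<lambda>x. weight p x * indicator Elow x) \<in> borel_measurable lborel"
        "(\<lambda>x. \<Sum>j. weight p x * indicator (E j) x) \<in> borel_measurable lborel"
        using Elow E by (simp_all add: weight_indicator_measurable borel_measurable_suminf_order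
            del: ennreal_suminf_cmult)
      show ?thesis
        unfolding nn_integral_add[OF borel_measurable_add[OF m(1,2)] m(3)] nn_integral_add[OF m(1,2)] ..
    qed
    also have "(\<integral>\<^sup>+x. (\<Sum>j. weight p x * indicator (E j) x) \<partial>lborel) = (\<Sum>j. \<integral>\<^sup>+x\<in>E j. weight p x \<partial>lborel)"
      by (intro nn_integral_suminf) measurable
    also have "\<dots> \<le> (\<Sum>j. ennreal c2 * (ennreal ((2 ^ j * L) powr p) * emeasure ?\<sigma> (superlevel R (2 ^ j * L / 2 ^ m))))"
      by (intro suminf_le Ej) auto
    also have "\<dots> = ennreal c2 * (\<Sum>j. ennreal ((2 ^ j * L) powr p) * emeasure ?\<sigma> (superlevel R (2 ^ j * L / 2 ^ m)))"
      by simp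
    also have "\<dots> \<le> ennreal c2 * (ennreal (2 powr (m * p) * dyadic_const p) * mean p R)"
      using R L p by (intro mult_left_mono superlevel_sum_le) auto
    also have "\<dots> \<le> ennreal c2 * (ennreal (2 powr (m * p) * dyadic_const p) * S)"
      using R by (intro mult_left_mono S(2)) auto
    finally show ?thesis unfolding K_def using low by (auto intro: order_trans add_mono)
  qed
  \<comment> \<open>Radii that start at 9 / 10 and increase to 1; as \<open>K\<close> does not
    depend on the radius, monotone convergence carries the bound to the whole ball.\<close>
  define R where "R = (\<lambda>k::nat. 1 - 1 / (real k + 10))"
  have R: "9 / 10 \<le> R k" "R k < 1" for k by (auto simp: R_def field_simps)
  have incR: "incseq R" by (auto simp: R_def incseq_def intro!: divide_left_mono)
  have "(\<integral>\<^sup>+x. weight p x \<partial>lborel) \<le> (\<integral>\<^sup>+x. (SUP k. weight p x * indicator (cball 0 (R k)) x) \<partial>lborel)"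
  proof (rule nn_integral_mono)
    fix x :: 'a
    show "weight p x \<le> (SUP k. weight p x * indicator (cball 0 (R k)) x)"
    proof (cases "x \<in> ball 0 1")
      case True
      then obtain k where k: "inverse (real (Suc k)) < 1 - norm x"
        using reals_Archimedean[of "1 - norm x"] by auto
      have "1 / (real k + 10) \<le> inverse (real (Suc k))" by (simp add: divide_simps)
      then have "x \<in> cball 0 (R k)" using k by (simp add: R_def)
      then show ?thesis by (intro SUP_upper2[of k]) auto
    qed (simp add: weight_def)
  qed
  also have "\<dots> = (SUP k. \<integral>\<^sup>+x\<in>cball 0 (R k). weight p x \<partial>lborel)"
  proof (rule nn_integral_monotone_convergence_SUP)
    show "incseq (\<lambda>k x. weight p x * indicator (cball 0 (R k)) x)"
      using incR by (auto simp: incseq_def le_fun_def indicator_def intro: order_trans)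
  qed (simp add: weight_indicator_measurable)
  also have "\<dots> \<le> K" using R by (intro SUP_least main)
  finally show ?thesis using K by (rule le_less_trans)
qed

section \<open>Radial integrals of the weight\<close>

definition radial_integral :: "real \<Rightarrow> 'a \<Rightarrow> ennreal" where
  "radial_integral p \<omega> = (\<integral>\<^sup>+t\<in>{1 / 2..<1}. weight p (t *\<^sub>R \<omega>) \<partial>lborel)"

lemma measurable_radial_integral: "radial_integral p \<in> borel_measurable sphere_measure"
  unfolding radial_integral_def[abs_def]
  by (rule borel_measurable_radial_integral[OF weight_measurable]) simp

text \<open>The lower limit 1 / 2 in \<open>radial_integral\<close> keeps
  \<open>t ^ (DIM('a) - 1)\<close> bounded below, so the Jacobian can be inserted at the cost of a
  constant.\<close>

lemma nn_integral_radial_integral: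
  "(\<integral>\<^sup>+\<omega>. radial_integral p \<omega> \<partial>sphere_measure) \<le> ennreal (2 ^ (DIM('a) - 1)) * (\<integral>\<^sup>+x. weight p x \<partial>lborel)"
proof -
  let ?f = "\<lambda>\<omega>::'a. \<integral>\<^sup>+t\<in>{0<..<1}. weight p (t *\<^sub>R \<omega>) * ennreal (t ^ (DIM('a) - 1)) \<partial>lborel"
  have f: "?f \<in> borel_measurable sphere_measure"
    using borel_measurable_radial_integral[OF weight_measurable[of p],
        of "\<lambda>t. ennreal (t ^ (DIM('a) - 1)) * indicator {0<..<1} t"]
    by (simp add: mult.assoc)
  have "radial_integral p \<omega> \<le> ennreal (2 ^ (DIM('a) - 1)) * ?f \<omega>" for \<omega>
  proof -
    have "radial_integral p \<omega> \<le> (\<integral>\<^sup>+t. ennreal (2 ^ (DIM('a) - 1)) * (weight p (t *\<^sub>R \<omega>) * ennreal (t ^ (DIM('a) - 1)) * indicator {0<..<1} t) \<partial>lborel)"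
      unfolding radial_integral_def
    proof (rule nn_integral_mono)
      fix t :: real
      show "weight p (t *\<^sub>R \<omega>) * indicator {1 / 2..<1} t \<le>
          ennreal (2 ^ (DIM('a) - 1)) * (weight p (t *\<^sub>R \<omega>) * ennreal (t ^ (DIM('a) - 1)) * indicator {0<..<1} t)"
      proof (cases "t \<in> {1 / 2..<1}")
        case True
        have "1 \<le> (2 * t) ^ (DIM('a) - 1)" using True by (intro one_le_power) auto
        then have "1 \<le> ennreal (2 ^ (DIM('a) - 1) * t ^ (DIM('a) - 1))"
          by (simp add: power_mult_distrib)
        also have "\<dots> = ennreal (2 ^ (DIM('a) - 1)) * ennreal (t ^ (DIM('a) - 1))"
          using True by (intro ennreal_mult) auto
        finally have "1 * weight p (t *\<^sub>R \<omega>) \<le> ennreal (2 ^ (DIM('a) - 1)) * ennreal (t ^ (DIM('a) - 1)) * weight p (t *\<^sub>R \<omega>)"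
          by (intro mult_right_mono) auto
        then show ?thesis using True by (simp add: mult_ac)
      qed simp
    qed
    also have "\<dots> = ennreal (2 ^ (DIM('a) - 1)) * ?f \<omega>"
      by (intro nn_integral_cmult borel_measurable_times_ennreal)
        (auto intro!: measurable_compose[OF _ weight_measurable])
    finally show ?thesis .
  qed
  then have "(\<integral>\<^sup>+\<omega>. radial_integral p \<omega> \<partial>sphere_measure) \<le> (\<integral>\<^sup>+\<omega>. ennreal (2 ^ (DIM('a) - 1)) * ?f \<omega> \<partial>sphere_measure)"
    by (intro nn_integral_mono)
  also have "\<dots> = ennreal (2 ^ (DIM('a) - 1)) * (\<integral>\<^sup>+\<omega>. ?f \<omega> \<partial>sphere_measure)"
    by (rule nn_integral_cmult[OF f])
  also have "(\<integral>\<^sup>+\<omega>. ?f \<omega> \<partial>sphere_measure) = (\<integral>\<^sup>+x\<in>ball 0 1. weight p x \<partial>lborel)"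
    by (rule nn_integral_polar[OF weight_measurable, symmetric])
  also have "\<dots> = (\<integral>\<^sup>+x. weight p x \<partial>lborel)"
    by (intro nn_integral_cong) (auto simp: weight_def indicator_def)
  finally show ?thesis .
qed

text \<open>Between \<open>t\<close> and the midpoint \<open>(1 + t) / 2\<close>, the Harnack
  inequality keeps \<rho> above \<open>\<rho> (t *\<^sub>R \<omega>) / A\<close>, and the distance
  to the sphere is still at least (1 - t) / 2; this interval alone gives the bound. In
  \<open>good_lambda\<close> it is read backwards: a small radial integral makes \<rho> times the
  distance to the sphere small along the ray.\<close>

lemma radial_integral_lower:
  assumes \<omega>: "norm (\<omega>::'a) = 1" and t: "1 / 2 \<le> t" "t < 1" and p: "0 < p"
  shows "ennreal ((\<rho> (t *\<^sub>R \<omega>) * (1 - t)) powr p) \<le> ennreal (2 * (2 * A) powr p) * radial_integral p \<omega>"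
proof -
  let ?x = "t *\<^sub>R \<omega>" and ?b = "(1 + t) / 2"
  have x: "?x \<in> ball 0 1" "norm ?x = t" using \<omega> t by auto
  define a where "a = \<rho> ?x * (1 - t)"
  have a: "0 < a" using pos[OF x(1)] t by (simp add: a_def)
  have "ennreal ((a / (2 * A)) powr p / 2) = (\<integral>\<^sup>+\<tau>. ennreal ((a / (2 * A)) powr p / (1 - t)) * indicator {t..<?b} \<tau> \<partial>lborel)"
  proof -
    have "(a / (2 * A)) powr p / (1 - t) * (?b - t) = (a / (2 * A)) powr p * ((?b - t) / (1 - t))"
      by (simp only: times_divide_eq_left times_divide_eq_right)
    also have "(?b - t) / (1 - t) = 1 / 2" using t by (simp add: field_simps)
    finally have eq: "(a / (2 * A)) powr p / (1 - t) * (?b - t) = (a / (2 * A)) powr p / 2" by simp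
    have "(\<integral>\<^sup>+\<tau>. ennreal ((a / (2 * A)) powr p / (1 - t)) * indicator {t..<?b} \<tau> \<partial>lborel) =
        ennreal ((a / (2 * A)) powr p / (1 - t)) * emeasure lborel {t..<?b}"
      by (rule nn_integral_cmult_indicator) simp
    also have "emeasure lborel {t..<?b} = ennreal (?b - t)"
      using t by (intro emeasure_lborel_Ico) simp
    also have "ennreal ((a / (2 * A)) powr p / (1 - t)) * ennreal (?b - t) =
        ennreal ((a / (2 * A)) powr p / (1 - t) * (?b - t))"
      using t by (intro ennreal_mult[symmetric]) auto
    finally show ?thesis by (simp only: eq)
  qed
  also have "\<dots> \<le> radial_integral p \<omega>"
    unfolding radial_integral_def
  proof (rule nn_integral_mono)
    fix \<tau> :: real
    show "ennreal ((a / (2 * A)) powr p / (1 - t)) * indicator {t..<?b} \<tau> \<le> weight p (\<tau> *\<^sub>R \<omega>) * indicator {1 / 2..<1} \<tau>"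
    proof (cases "\<tau> \<in> {t..<?b}")
      case True
      let ?y = "\<tau> *\<^sub>R \<omega>"
      have \<tau>: "t \<le> \<tau>" "\<tau> < 1" "(1 - t) / 2 \<le> 1 - \<tau>" using True t by (auto simp: field_simps)
      have y: "?y \<in> ball 0 1" "norm ?y = \<tau>" using \<omega> t \<tau> by auto
      have "dist ?x ?y = \<tau> - t"
        using \<omega> \<tau> by (simp add: dist_norm flip: scaleR_left_diff_distrib)
      then have "?y \<in> ball ?x ((1 - norm ?x) / 2)" "?x \<in> ball ?x ((1 - norm ?x) / 2)"
        using True x t by (auto simp: field_simps)
      then have "\<rho> ?x \<le> A * \<rho> ?y" by (intro harnack_le[OF x(1)])
      then have "\<rho> ?x * (1 - t) \<le> (A * \<rho> ?y) * (2 * (1 - \<tau>))"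
        using \<tau> t A1 pos[OF y(1)] by (intro mult_mono) auto
      then have "a / (2 * A) \<le> \<rho> ?y * (1 - \<tau>)" using A1 by (simp add: a_def field_simps)
      then have "(a / (2 * A)) powr p \<le> (\<rho> ?y * (1 - \<tau>)) powr p" using a A1 p by (intro powr_mono2) auto
      \<comment> \<open>With the weight written as
        \<open>(\<rho> ?y * (1 - \<tau>)) powr p / (1 - \<tau>)\<close>, one estimate covers both
        signs of p - 1.\<close>
      then have "(a / (2 * A)) powr p / (1 - t) \<le> (\<rho> ?y * (1 - \<tau>)) powr p / (1 - \<tau>)"
        using \<tau> t by (intro frac_le) auto
      also have "\<dots> = \<rho> ?y powr p * (1 - \<tau>) powr (p - 1)"
        using \<tau> pos[OF y(1)] by (simp add: powr_mult powr_diff)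
      finally have "ennreal ((a / (2 * A)) powr p / (1 - t)) \<le> weight p ?y"
        using y by (simp add: weight_def ennreal_leI)
      then show ?thesis using True \<tau> t by simp
    qed simp
  qed
  finally have "ennreal (2 * (2 * A) powr p) * ennreal ((a / (2 * A)) powr p / 2) \<le> ennreal (2 * (2 * A) powr p) * radial_integral p \<omega>"
    by (intro mult_left_mono) auto
  also have "ennreal (2 * (2 * A) powr p) * ennreal ((a / (2 * A)) powr p / 2) = ennreal (a powr p)"
    using a A1 by (subst ennreal_mult[symmetric]) (auto simp: powr_divide)
  finally show ?thesis by (simp add: a_def)
qed

end

section \<open>From the volume integral to spherical means\<close>

context conf_density begin

text \<open>Seen from a stopping point \<open>x\<close> with \<open>v x = L\<close>, a direction on which \<^term>\<open>v\<close> reaches \<open>2 * L\<close> ends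
  at distance at least \<open>L\<close>, while its radial integral, if small, forces it to start at distance at
  most \<open>L / 2 ^ N\<close>; so it crosses \<open>N\<close> shells around \<open>x\<close>.\<close>

lemma good_lambda:
  assumes m: "covering_exponent m" and small: "\<And>y. norm (y::'a) \<le> 9 / 10 \<Longrightarrow> v y < L"
    and R: "9 / 10 \<le> R" "R < 1" and p: "0 < p" and N: "1 \<le> (N::nat)"
  shows "emeasure sphere_measure (superlevel R (2 * L)) \<le>
    emeasure sphere_measure {\<omega> \<in> sphere 0 1. ennreal ((8 * L / 2 ^ N) powr p) \<le> ennreal (2 * (2 * A) powr p) * radial_integral p \<omega>} +
    ennreal (8 ^ DIM('a) * B * (2 / cap_lower) / N) * emeasure sphere_measure (superlevel R (L / 2 ^ m))"
proof -
  let ?\<sigma> = "sphere_measure :: 'a measure"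
  have "0 \<le> v 0" by (intro rho_norm_nonneg) simp
  moreover have "v 0 < L" by (rule small) simp
  ultimately have L: "0 < L" by linarith
  obtain F where "cap_cover m L R F"
    using m small R unfolding covering_exponent_def by blast
  then have F: "finite F" "\<And>x. x \<in> F \<Longrightarrow> 9 / 10 \<le> norm x \<and> norm x \<le> R \<and> v x = L"
    and cov: "\<And>y. norm y \<le> R \<Longrightarrow> L \<le> v y \<Longrightarrow> \<exists>x\<in>F.
      y /\<^sub>R norm y \<in> cap (x /\<^sub>R norm x) (5 * cap_const * (1 - norm x)) \<and> 1 - norm y < 5 * (1 - norm x)"
    and sum: "(\<Sum>x\<in>F. ennreal (cap_lower / 2 * (1 - norm x) ^ (DIM('a) - 1))) \<le> emeasure ?\<sigma> (superlevel R (L / 2 ^ m))"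
    unfolding cap_cover_def by blast+
  define H where "H = {\<omega> \<in> sphere 0 1. ennreal ((8 * L / 2 ^ N) powr p) \<le> ennreal (2 * (2 * A) powr p) * radial_integral p \<omega>}"
  have H: "H \<in> sets ?\<sigma>"
  proof -
    have "(\<lambda>\<omega>. ennreal (2 * (2 * A) powr p) * radial_integral p \<omega>) \<in> borel_measurable ?\<sigma>"
      by (intro borel_measurable_times_ennreal measurable_radial_integral borel_measurable_const)
    then have "(\<lambda>\<omega>. ennreal (2 * (2 * A) powr p) * radial_integral p \<omega>) -` {ennreal ((8 * L / 2 ^ N) powr p)..} \<inter> space ?\<sigma> \<in> sets ?\<sigma>"
      by (rule measurable_sets) simp
    also have "(\<lambda>\<omega>. ennreal (2 * (2 * A) powr p) * radial_integral p \<omega>) -` {ennreal ((8 * L / 2 ^ N) powr p)..} \<inter> space ?\<sigma> = H"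
      by (auto simp: H_def)
    finally show ?thesis .
  qed
  define E where "E = (\<lambda>x. {\<omega> \<in> sphere 0 1. d x (norm x *\<^sub>R \<omega>) \<in> {..L / 2 ^ N}} \<inter> {\<omega> \<in> sphere 0 1. d x (R *\<^sub>R \<omega>) \<in> {L..}})"
  have E: "E x \<in> sets ?\<sigma>" if "x \<in> F" for x
    unfolding E_def using F(2)[OF that] R
    by (intro sets.Int sets_sphere_radial continuous_on_rho_dist) auto
  have E_le: "emeasure ?\<sigma> (E x) \<le> ennreal (8 ^ DIM('a) * B * (2 / cap_lower) / N) * ennreal (cap_lower / 2 * (1 - norm x) ^ (DIM('a) - 1))"
    if x: "x \<in> F" for x
  proof -
    have nx: "9 / 10 \<le> norm x" "norm x \<le> R" using F(2)[OF x] by auto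
    have "emeasure ?\<sigma> (E x) \<le> ennreal (8 ^ DIM('a) * B * (1 - norm x) ^ (DIM('a) - 1) / N)"
    proof (rule crossing_estimate[of x "norm x" R "L / 2 ^ N"])
      fix \<omega> assume "\<omega> \<in> E x"
      then show "\<exists>p\<in>{norm x..R}. \<exists>q\<in>{norm x..R}. d x (p *\<^sub>R \<omega>) \<le> L / 2 ^ N \<and> 2 ^ N * (L / 2 ^ N) \<le> d x (q *\<^sub>R \<omega>)"
        using nx by (intro bexI[of _ "norm x"] bexI[of _ R]) (auto simp: E_def)
    qed (use nx R L N E[OF x] in auto)
    \<comment> \<open>The constant is split so that the second factor is the term of
      \<open>x\<close> in the sum controlled by \<open>sum\<close>.\<close>
    also have "8 ^ DIM('a) * B * (1 - norm x) ^ (DIM('a) - 1) / N =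
        8 ^ DIM('a) * B * (2 / cap_lower) / N * (cap_lower / 2 * (1 - norm x) ^ (DIM('a) - 1))"
      using cap_lower_pos by simp
    also have "ennreal \<dots> = ennreal (8 ^ DIM('a) * B * (2 / cap_lower) / N) * ennreal (cap_lower / 2 * (1 - norm x) ^ (DIM('a) - 1))"
      using cap_lower_pos B0 nx R by (intro ennreal_mult) auto
    finally show ?thesis .
  qed
  have sub: "superlevel R (2 * L) \<subseteq> H \<union> (\<Union>x\<in>F. E x)"
  proof
    fix \<omega> assume "\<omega> \<in> superlevel R (2 * L)"
    then have \<omega>: "norm \<omega> = 1" and vR: "2 * L \<le> v (R *\<^sub>R \<omega>)" by (auto simp: superlevel_def)
    show "\<omega> \<in> H \<union> (\<Union>x\<in>F. E x)"
    proof (cases "\<omega> \<in> H")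
      case False
      have nR: "norm (R *\<^sub>R \<omega>) = R" "(R *\<^sub>R \<omega>) /\<^sub>R norm (R *\<^sub>R \<omega>) = \<omega>" using \<omega> R by auto
      obtain x where x: "x \<in> F" "\<omega> \<in> cap (x /\<^sub>R norm x) (5 * cap_const * (1 - norm x))"
        using cov[of "R *\<^sub>R \<omega>"] nR vR L unfolding nR by force
      define t where "t = norm x"
      define \<omega>0 where "\<omega>0 = x /\<^sub>R norm x"
      have t: "9 / 10 \<le> t" "t \<le> R" "v x = L" using F(2)[OF x(1)] by (auto simp: t_def)
      have "x \<noteq> 0" using t by (auto simp: t_def)
      then have \<omega>0: "norm \<omega>0 = 1" "t *\<^sub>R \<omega>0 = x" by (auto simp: \<omega>0_def t_def)
      have \<omega>c: "\<omega> \<in> cap \<omega>0 (5 * cap_const * (1 - t))" using x(2) by (simp add: \<omega>0_def t_def)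
      have xb: "x \<in> ball 0 1" "t *\<^sub>R \<omega> \<in> ball 0 1" "R *\<^sub>R \<omega> \<in> ball 0 1" using t R \<omega> by (auto simp: t_def)
      have near: "t *\<^sub>R \<omega> \<in> ball x ((1 - norm x) / 2)" "d x (t *\<^sub>R \<omega>) \<le> \<rho> x * (1 - t) / (8 * A)"
        using rho_dist_near(1,2)[OF \<omega>0(1) _ _ \<omega>c] t R unfolding \<omega>0(2) by auto
      \<comment> \<open>The stopping point need not lie on the ray of \<omega>; the Harnack
        inequality transfers its density to that ray, where the radial integral is small. The factor
        \<open>A\<close> cancels against the one in \<open>8 * A\<close>.\<close>
      have "\<rho> x \<le> A * \<rho> (t *\<^sub>R \<omega>)"
        using near(1) xb by (intro harnack_le[OF xb(1)]) auto
      then have "\<rho> x * (1 - t) / (8 * A) \<le> A * \<rho> (t *\<^sub>R \<omega>) * (1 - t) / (8 * A)"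
        using t R A1 by (intro divide_right_mono mult_right_mono) auto
      then have d1: "d x (t *\<^sub>R \<omega>) \<le> \<rho> (t *\<^sub>R \<omega>) * (1 - t) / 8" using near(2) A1 by simp
      have a0: "0 \<le> \<rho> (t *\<^sub>R \<omega>) * (1 - t)" using pos[OF xb(2)] t R by simp
      have "ennreal ((\<rho> (t *\<^sub>R \<omega>) * (1 - t)) powr p) \<le> ennreal (2 * (2 * A) powr p) * radial_integral p \<omega>"
        using \<omega> t R p by (intro radial_integral_lower) auto
      also have "\<dots> < ennreal ((8 * L / 2 ^ N) powr p)" using False \<omega> by (auto simp: H_def)
      finally have "(\<rho> (t *\<^sub>R \<omega>) * (1 - t)) powr p < (8 * L / 2 ^ N) powr p"
        by (simp add: ennreal_less_iff)
      then have "\<rho> (t *\<^sub>R \<omega>) * (1 - t) < 8 * L / 2 ^ N"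
        using L p powr_mono2[of p "8 * L / 2 ^ N" "\<rho> (t *\<^sub>R \<omega>) * (1 - t)"] by (cases "8 * L / 2 ^ N \<le> \<rho> (t *\<^sub>R \<omega>) * (1 - t)") auto
      then have "d x (t *\<^sub>R \<omega>) \<le> L / 2 ^ N" using d1 by simp
      moreover have "L \<le> d x (R *\<^sub>R \<omega>)"
      proof -
        have "v (R *\<^sub>R \<omega>) \<le> d (R *\<^sub>R \<omega>) x + v x"
          unfolding rho_norm_def using xb by (intro rho_dist_triangle) auto
        then show ?thesis using vR t rho_dist_sym[OF xb(3,1)] by simp
      qed
      ultimately show ?thesis using x(1) \<omega> by (auto simp: E_def t_def)
    qed simp
  qed
  have UE: "(\<Union>x\<in>F. E x) \<in> sets ?\<sigma>" using F(1) E by (intro sets.finite_UN) auto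
  have "emeasure ?\<sigma> (superlevel R (2 * L)) \<le> emeasure ?\<sigma> (H \<union> (\<Union>x\<in>F. E x))"
    using H UE by (intro emeasure_mono sub) auto
  also have "\<dots> \<le> emeasure ?\<sigma> H + emeasure ?\<sigma> (\<Union>x\<in>F. E x)"
    using H UE by (rule emeasure_subadditive)
  also have "emeasure ?\<sigma> (\<Union>x\<in>F. E x) \<le> (\<Sum>x\<in>F. emeasure ?\<sigma> (E x))"
    using F(1) E by (intro emeasure_subadditive_finite) auto
  also have "\<dots> \<le> (\<Sum>x\<in>F. ennreal (8 ^ DIM('a) * B * (2 / cap_lower) / N) * ennreal (cap_lower / 2 * (1 - norm x) ^ (DIM('a) - 1)))"
    by (intro sum_mono E_le)
  also have "\<dots> = ennreal (8 ^ DIM('a) * B * (2 / cap_lower) / N) * (\<Sum>x\<in>F. ennreal (cap_lower / 2 * (1 - norm x) ^ (DIM('a) - 1)))"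
    by (simp add: sum_distrib_left)
  also have "\<dots> \<le> ennreal (8 ^ DIM('a) * B * (2 / cap_lower) / N) * emeasure ?\<sigma> (superlevel R (L / 2 ^ m))"
    by (intro mult_left_mono sum) simp
  finally show ?thesis unfolding H_def by (simp add: add_left_mono)
qed

text \<open>After summation over dyadic levels, the first term of \<open>good_lambda\<close> becomes
  a multiple of the integral of \<open>radial_integral\<close>, hence of the volume integral, while
  the second returns the mean at the same radius.\<close>

lemma mean_bounded_if_weight_finite:
  assumes p: "0 < p" and W: "(\<integral>\<^sup>+x. weight p x \<partial>lborel) < \<infinity>"
  shows "\<exists>S<\<infinity>. \<forall>r. 0 < r \<longrightarrow> r < 1 \<longrightarrow> mean p r \<le> S"
proof -
  let ?\<sigma> = "sphere_measure :: 'a measure" and ?tot = "emeasure sphere_measure (sphere (0::'a) 1)"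
  obtain L where L: "0 < L" "\<And>y. norm (y::'a) \<le> 9 / 10 \<Longrightarrow> v y < L"
    using rho_norm_bounded by blast
  obtain m where m: "covering_exponent m" using covering by blast
  define cg where "cg = 8 ^ DIM('a) * B * (2 / cap_lower)"
  define cm where "cm = 2 powr (m * p) * dyadic_const p"
  have cg: "0 < cg" and cm: "0 < cm"
    using B0 cap_lower_pos dyadic_const_pos[OF p] by (auto simp: cg_def cm_def)
  \<comment> \<open>Makes the coefficient of the returning mean at most 1 / 2:
    \<open>4 powr p\<close> comes from \<open>mean_le_superlevel_sum\<close>, \<open>cg / N\<close>
    from \<open>good_lambda\<close>, and \<open>cm\<close> from \<open>superlevel_sum_le\<close>. As
    \<open>m\<close>, and with it \<open>cm\<close>, is fixed before \<open>N\<close>, there is no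
    circularity.\<close>
  define N where "N = Suc (nat \<lceil>2 * 4 powr p * cg * cm\<rceil>)"
  have N: "1 \<le> N" by (simp add: N_def)
  have "2 * 4 powr p * cg * cm \<le> N" unfolding N_def by linarith
  then have small: "4 powr p * (cg / N * cm) \<le> 1 / 2" using N by (simp add: field_simps)
  define cI where "cI = 2 * (2 * A) powr p"
  define I where "I = (\<lambda>\<omega>. ennreal cI * radial_integral p \<omega>)"
  have I: "I \<in> borel_measurable ?\<sigma>"
    unfolding I_def by (intro borel_measurable_times_ennreal measurable_radial_integral borel_measurable_const)
  \<comment> \<open>This constant grows with \<open>N\<close>, but the term \<open>J\<close> that
    contains it is not absorbed and only has to be finite.\<close>
  define cD where "cD = dyadic_const p / (8 / 2 ^ N) powr p"
  define J where "J = ennreal cD * (\<integral>\<^sup>+\<omega>. I \<omega> \<partial>?\<sigma>)"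
  have "(\<integral>\<^sup>+\<omega>. radial_integral p \<omega> \<partial>?\<sigma>) < \<infinity>"
    using W by (intro order.strict_trans1[OF nn_integral_radial_integral]) (simp add: ennreal_mult_less_top)
  then have J: "J < \<infinity>"
    unfolding J_def I_def by (subst nn_integral_cmult[OF measurable_radial_integral]) (simp add: ennreal_mult_less_top)
  define T where "T = ennreal ((2 * L) powr p) * ?tot + ennreal (4 powr p) * J"
  have T: "T < \<infinity>" using J sphere_measure_finite by (simp add: T_def ennreal_mult_less_top)
  have main: "mean p R \<le> 2 * T" if R: "9 / 10 \<le> R" "R < 1" for R
  proof -
    let ?H = "\<lambda>j::nat. {\<omega> \<in> sphere 0 1. ennreal ((8 / 2 ^ N * (2 ^ j * L)) powr p) \<le> I \<omega>}"
    have H: "?H j \<in> sets ?\<sigma>" for j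
    proof -
      have "I -` {ennreal ((8 / 2 ^ N * (2 ^ j * L)) powr p)..} \<inter> space ?\<sigma> \<in> sets ?\<sigma>"
        using I by (rule measurable_sets) simp
      also have "I -` {ennreal ((8 / 2 ^ N * (2 ^ j * L)) powr p)..} \<inter> space ?\<sigma> = ?H j" by auto
      finally show ?thesis .
    qed
    have Hsum: "(\<Sum>j. ennreal ((2 ^ j * L) powr p) * emeasure ?\<sigma> (?H j)) \<le> J"
    proof -
      have "(\<Sum>j. ennreal ((2 ^ j * L) powr p) * emeasure ?\<sigma> (?H j)) =
          (\<Sum>j. \<integral>\<^sup>+\<omega>. ennreal ((2 ^ j * L) powr p) * indicator (?H j) \<omega> \<partial>?\<sigma>)"
        using H by (simp add: nn_integral_cmult_indicator)
      also have "\<dots> = (\<integral>\<^sup>+\<omega>. (\<Sum>j. ennreal ((2 ^ j * L) powr p) * indicator (?H j) \<omega>) \<partial>?\<sigma>)"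
        using H by (intro nn_integral_suminf[symmetric] borel_measurable_times_ennreal borel_measurable_const borel_measurable_indicator)
      also have "\<dots> \<le> (\<integral>\<^sup>+\<omega>. ennreal cD * I \<omega> \<partial>?\<sigma>)"
      proof (rule nn_integral_mono)
        fix \<omega> :: 'a assume "\<omega> \<in> space ?\<sigma>"
        then have "(\<Sum>j. ennreal ((2 ^ j * L) powr p) * indicator (?H j) \<omega>) =
            (\<Sum>j. ennreal ((2 ^ j * L) powr p) * of_bool (ennreal ((8 / 2 ^ N * (2 ^ j * L)) powr p) \<le> I \<omega>))"
          by (intro suminf_cong) (simp add: indicator_def)
        also have "\<dots> \<le> ennreal cD * I \<omega>"
          unfolding cD_def using L p by (intro dyadic_suminf_ennreal) auto
        finally show "(\<Sum>j. ennreal ((2 ^ j * L) powr p) * indicator (?H j) \<omega>) \<le> ennreal cD * I \<omega>" .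
      qed
      also have "\<dots> = J" unfolding J_def by (rule nn_integral_cmult[OF I])
      finally show ?thesis .
    qed
    let ?S = "\<Sum>j. ennreal ((2 ^ j * L) powr p) * emeasure ?\<sigma> (superlevel R (2 ^ j * L / 2 ^ m))"
    have "mean p R \<le> ennreal ((2 * L) powr p) * ?tot +
        ennreal (4 powr p) * (\<Sum>j. ennreal ((2 ^ j * L) powr p) * emeasure ?\<sigma> (superlevel R (2 * (2 ^ j * L))))"
      using R L p by (intro mean_le_superlevel_sum) auto
    also have "(\<Sum>j. ennreal ((2 ^ j * L) powr p) * emeasure ?\<sigma> (superlevel R (2 * (2 ^ j * L)))) \<le>
        (\<Sum>j. ennreal ((2 ^ j * L) powr p) * emeasure ?\<sigma> (?H j) +
           ennreal (cg / N) * (ennreal ((2 ^ j * L) powr p) * emeasure ?\<sigma> (superlevel R (2 ^ j * L / 2 ^ m))))"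
    proof (intro suminf_le)
      fix j :: nat
      have "L \<le> 2 ^ j * L" using L(1) by simp
      then have "v y < 2 ^ j * L" if "norm y \<le> 9 / 10" for y using L(2)[OF that] by simp
      from good_lambda[OF m this R p N]
      have "emeasure ?\<sigma> (superlevel R (2 * (2 ^ j * L))) \<le>
          emeasure ?\<sigma> (?H j) + ennreal (cg / N) * emeasure ?\<sigma> (superlevel R (2 ^ j * L / 2 ^ m))"
        by (simp add: I_def cI_def cg_def)
      from mult_left_mono[OF this, of "ennreal ((2 ^ j * L) powr p)"]
      show "ennreal ((2 ^ j * L) powr p) * emeasure ?\<sigma> (superlevel R (2 * (2 ^ j * L))) \<le>
          ennreal ((2 ^ j * L) powr p) * emeasure ?\<sigma> (?H j) +
           ennreal (cg / N) * (ennreal ((2 ^ j * L) powr p) * emeasure ?\<sigma> (superlevel R (2 ^ j * L / 2 ^ m)))"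
        by (simp add: distrib_left mult_ac)
    qed auto
    also have "\<dots> = (\<Sum>j. ennreal ((2 ^ j * L) powr p) * emeasure ?\<sigma> (?H j)) + ennreal (cg / N) * ?S"
      by (simp add: suminf_add[symmetric])
    also have "\<dots> \<le> J + ennreal (cg / N) * (ennreal cm * mean p R)"
      unfolding cm_def using R L p by (intro add_mono Hsum mult_left_mono superlevel_sum_le) auto
    finally have "mean p R \<le> ennreal ((2 * L) powr p) * ?tot + ennreal (4 powr p) * (J + ennreal (cg / N) * (ennreal cm * mean p R))"
      by (simp add: add_left_mono mult_left_mono)
    also have "\<dots> = T + ennreal (4 powr p * (cg / N * cm)) * mean p R"
    proof -
      have "ennreal (4 powr p * (cg / N * cm)) = ennreal (4 powr p) * (ennreal (cg / N) * ennreal cm)"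
        using cg cm by (simp only: ennreal_mult powr_ge_zero divide_nonneg_nonneg mult_nonneg_nonneg
            less_imp_le of_nat_0_le_iff)
      then show ?thesis by (simp add: T_def distrib_left mult.assoc add.assoc)
    qed
    also have "\<dots> \<le> T + ennreal (1 / 2) * mean p R"
      using small by (intro add_left_mono mult_right_mono ennreal_leI) auto
    finally have le: "mean p R \<le> T + ennreal (1 / 2) * mean p R" .
    \<comment> \<open>Half of the mean may be subtracted only because the mean is finite at this
      radius.\<close>
    have "mean p R < \<infinity>" using mean_finite[OF p] R by auto
    then obtain a where a: "mean p R = ennreal a" "0 \<le> a"
      by (metis ennreal_cases infinity_ennreal_def less_irrefl)
    obtain b where b: "T = ennreal b" "0 \<le> b" using T by (metis ennreal_cases infinity_ennreal_def less_irrefl)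
    have "ennreal (b + 1 / 2 * a) = ennreal b + ennreal (1 / 2) * ennreal a"
      using a b by (subst ennreal_plus) (auto simp only: ennreal_mult)
    then have "ennreal a \<le> ennreal (b + 1 / 2 * a)"
      using le unfolding a(1) b(1) by (simp only:)
    then have "a \<le> b + 1 / 2 * a" using a b by (subst (asm) ennreal_le_iff) auto
    then have "ennreal a \<le> ennreal (2 * b)" by (intro ennreal_leI) simp
    then show ?thesis using a b by (simp add: ennreal_mult)
  qed
  show ?thesis
  proof (intro exI[of _ "2 * T + ennreal (L powr p) * ?tot"] conjI allI impI)
    show "2 * T + ennreal (L powr p) * ?tot < \<infinity>"
      using T sphere_measure_finite by (simp add: ennreal_mult_less_top)
    fix r :: real assume r: "0 < r" "r < 1"
    show "mean p r \<le> 2 * T + ennreal (L powr p) * ?tot"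
    proof (cases "9 / 10 \<le> r")
      case True
      then show ?thesis using main[OF True r(2)] by (simp add: add_increasing2)
    next
      case False
      have "mean p r \<le> ennreal (L powr p) * ?tot"
      proof (rule mean_bounded[OF p])
        fix \<omega> :: 'a assume "norm \<omega> = 1"
        then show "0 \<le> v (r *\<^sub>R \<omega>) \<and> v (r *\<^sub>R \<omega>) \<le> L"
          using False r L(2)[of "r *\<^sub>R \<omega>"] rho_norm_nonneg[of "r *\<^sub>R \<omega>"] by auto
      qed (use r in auto)
      then show ?thesis by (simp add: add_increasing)
    qed
  qed
qed

section \<open>The Hardy condition in terms of bounded means\<close>

lemma nn_integral_scaled_rho_norm:
  assumes "0 < \<delta>" "0 \<le> r" "r < 1"
  shows "(\<integral>\<^sup>+\<omega>. ennreal ((\<delta> * v (r *\<^sub>R \<omega>)) powr p) \<partial>sphere_measure) = ennreal (\<delta> powr p) * mean p r"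
proof -
  have "(\<integral>\<^sup>+\<omega>. ennreal ((\<delta> * v (r *\<^sub>R \<omega>)) powr p) \<partial>sphere_measure) =
      (\<integral>\<^sup>+\<omega>. ennreal (\<delta> powr p) * ennreal (v (r *\<^sub>R \<omega>) powr p) \<partial>sphere_measure)"
  proof (rule nn_integral_cong)
    fix \<omega> :: 'a assume "\<omega> \<in> space sphere_measure"
    then have "0 \<le> v (r *\<^sub>R \<omega>)" using assms by (intro rho_norm_nonneg) auto
    then show "ennreal ((\<delta> * v (r *\<^sub>R \<omega>)) powr p) = ennreal (\<delta> powr p) * ennreal (v (r *\<^sub>R \<omega>) powr p)"
      using assms by (simp add: powr_mult ennreal_mult)
  qed
  also have "\<dots> = ennreal (\<delta> powr p) * mean p r"
    unfolding mean_def
    by (intro nn_integral_cmult measurable_compose[OF measurable_rho_norm_radial[OF assms(2,3)]]) simp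
  finally show ?thesis .
qed

text \<open>By homogeneity \<open>\<delta> powr p\<close> comes out of the integral; dividing by it
  turns the finite supremum into a bound for the unscaled means. In the other direction \<delta> = 1
  is a witness.\<close>

lemma in_Hardy_iff_mean_bounded:
  "in_Hardy p \<rho> \<longleftrightarrow> (\<exists>S<\<infinity>. \<forall>r. 0 < r \<longrightarrow> r < 1 \<longrightarrow> mean p r \<le> S)"
proof
  assume "in_Hardy p \<rho>"
  then obtain \<delta> where \<delta>: "0 < \<delta>" "(SUP r\<in>{0<..<1::real}.
        \<integral>\<^sup>+\<omega>. ennreal ((\<delta> * v (r *\<^sub>R \<omega>)) powr p) \<partial>sphere_measure) < \<infinity>"
    unfolding in_Hardy_def by blast
  define M where "M = (SUP r\<in>{0<..<1::real}. \<integral>\<^sup>+\<omega>. ennreal ((\<delta> * v (r *\<^sub>R \<omega>)) powr p) \<partial>sphere_measure)"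
  have "mean p r \<le> ennreal (\<delta> powr - p) * M" if r: "0 < r" "r < 1" for r
  proof -
    have "ennreal (\<delta> powr p) * mean p r \<le> M"
      unfolding M_def nn_integral_scaled_rho_norm[OF \<delta>(1) less_imp_le[OF r(1)] r(2), symmetric]
      using r by (intro SUP_upper) auto
    then have "ennreal (\<delta> powr - p) * (ennreal (\<delta> powr p) * mean p r) \<le> ennreal (\<delta> powr - p) * M"
      by (intro mult_left_mono) auto
    moreover have "ennreal (\<delta> powr - p) * ennreal (\<delta> powr p) = 1"
      using \<delta> by (simp flip: ennreal_mult powr_add)
    ultimately show ?thesis by (simp add: mult.assoc[symmetric])
  qed
  then show "\<exists>S<\<infinity>. \<forall>r. 0 < r \<longrightarrow> r < 1 \<longrightarrow> mean p r \<le> S"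
    using \<delta>(2) by (intro exI[of _ "ennreal (\<delta> powr - p) * M"]) (simp add: M_def ennreal_mult_less_top)
next
  assume "\<exists>S<\<infinity>. \<forall>r. 0 < r \<longrightarrow> r < 1 \<longrightarrow> mean p r \<le> S"
  then obtain S where S: "S < \<infinity>" "\<And>r. 0 < r \<Longrightarrow> r < 1 \<Longrightarrow> mean p r \<le> S" by blast
  have "(SUP r\<in>{0<..<1::real}. \<integral>\<^sup>+\<omega>. ennreal ((1 * v (r *\<^sub>R \<omega>)) powr p) \<partial>sphere_measure) \<le> S"
    using S(2) by (intro SUP_least) (simp add: mean_def)
  then have "(SUP r\<in>{0<..<1::real}. \<integral>\<^sup>+\<omega>. ennreal ((1 * v (r *\<^sub>R \<omega>)) powr p) \<partial>sphere_measure) < \<infinity>"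
    using S(1) by (rule le_less_trans)
  then show "in_Hardy p \<rho>" unfolding in_Hardy_def by (intro exI[of _ 1] conjI) simp_all
qed

end

theorem theorem1p2:
  fixes \<rho> :: "real ^ 'n \<Rightarrow> real" and p :: real
  assumes "CARD('n) \<ge> 2"
    and "conformal_density \<rho>"
    and "0 < p"
  shows "in_Hardy p \<rho> \<longleftrightarrow>
    (\<integral>\<^sup>+x\<in>ball 0 1. ennreal (\<rho> x powr p * (1 - norm x) powr (p - 1)) \<partial>lborel) < \<infinity>"
proof -
  obtain A B where "continuous_on (ball 0 1) \<rho>" "\<forall>x\<in>ball 0 1. 0 < \<rho> x"
    "1 \<le> A" "Harnack_inequality A \<rho>" "0 < B" "volume_growth B \<rho>"
    using assms(2) unfolding conformal_density_def by blast
  \<comment> \<open>The locale works with particular constants \<open>A\<close> and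
    \<open>B\<close>, which \<open>conformal_density\<close> provides only existentially.\<close>
  then interpret conf_density \<rho> A B
    using assms(1) by unfold_locales auto
  have "(\<integral>\<^sup>+x\<in>ball 0 1. ennreal (\<rho> x powr p * (1 - norm x) powr (p - 1)) \<partial>lborel) = (\<integral>\<^sup>+x. weight p x \<partial>lborel)"
    by (simp add: weight_def)
  then show ?thesis
    using weight_finite_if_mean_bounded[OF assms(3)] mean_bounded_if_weight_finite[OF assms(3)]
    unfolding in_Hardy_iff_mean_bounded by auto
qed

end
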